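(* Let $\mathcal{D}=\mathcal{P}_{\mathcal{D}}\cup\mathcal{L}_{\mathcal{D}}$ be a minimal primal dominating set of the incidence graph of $\mathrm{PG}(2,q)$, $q=p^h>16$, $p$ prime. Let $c_2=c_3=2^{-1/3}$ and $c_p=1$ for $p>3$. Then one of the following holds: (i) $|\mathcal{D}|=2q$, and $\mathcal{D}$ is the union of $q$ collinear points on a line $\ell$ and $q$ concurrent lines through a point $P$ with $P\in\ell$, $P,\ell\notin\mathcal{D}$; (ii) $|\mathcal{D}|=2q+2$, and $\mathcal{D}$ is the union of all points of a line $\ell$ and all lines through a point $P\notin\ell$; (iii) $|\mathcal{D}|=2q+\sqrt{q}+1$, and either there is a Baer subplane $\Pi'$ and a point $P\in\Pi'$ with $\mathcal{L}_{\mathcal{D}}=[P]$ and $\mathcal{P}_{\mathcal{D}}$ the point set of $\Pi'$ minus $P$, or $\mathcal{D}$ is the dual of such a structure; (iv) $3q-1>|\mathcal{D}|>2q+\sqrt{q}+1$, and $\mathcal{D}$ is stable, and either $\mathcal{L}_{\mathcal{D}}$ is a full pencil and $\mathcal{P}_{\mathcal{D}}$ consists of all but possibly one point of a nontrivial minimal blocking set, or $\mathcal{D}$ is the dual of such a structure (the situation where $\mathcal{L}_{\mathcal{D}}$ is a full pencil plus a further line, or its dual, does not occur); moreover either $|\mathcal{D}|=2q+\sqrt{q}+2$, which happens if and only if there is a Baer subplane $\Pi'$ and a point $P\notin\Pi'$ with $\mathcal{L}_{\mathcal{D}}=[P]$ and $\mathcal{P}_{\mathcal{D}}$ the point set of $\Pi'$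 (or $\mathcal{D}$ is the dual structure), or $|\mathcal{D}|\geq 2q+c_pq^{2/3}+1$; (v) $|\mathcal{D}|\geq 3q-1$. In particular, if $|\mathcal{D}|<3q-1$, then $\mathcal{D}$ is stable.
   Context: $\mathrm{PG}(2,q)$ is the Desarguesian projective plane of order $q$. A dominating set $\mathcal{D}=\mathcal{P}_{\mathcal{D}}\cup\mathcal{L}_{\mathcal{D}}$ of its incidence graph is a set of points and lines such that every point not in $\mathcal{P}_{\mathcal{D}}$ lies on a line of $\mathcal{L}_{\mathcal{D}}$ and every line not in $\mathcal{L}_{\mathcal{D}}$ contains a point of $\mathcal{P}_{\mathcal{D}}$; minimal means no proper subset is dominating. $\mathcal{D}$ is stable if it is minimal and there is no dominating set $\mathcal{D}'\supset\mathcal{D}$ with $|\mathcal{D}'|=|\mathcal{D}|+1$ containing a dominating set of size less than $|\mathcal{D}|$. $\mathcal{D}$ is primal if it contains $q$ concurrent lines or $q$ collinear points. $[P]$ denotes the set of all lines through $P$ (a full pencil). A blocking set is a point set meeting every line; nontrivial if it contains no full line; minimal if no proper subset is a blocking set. A Baer subplane is a subplane of order $\sqrt{q}$ ($q$ a square). The dual of a structure interchanges points and lines. *)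

theory Defs
  imports Complex_Main "HOL-Library.Cardinality" "HOL-Computational_Algebra.Primes"
begin

text \<open>Model of PG(2,q) over a finite field 'a with q = CARD('a).
  A projective point is the set of nonzero scalar multiples of a nonzero vector of 'a^3.
  Lines are represented by the same objects (dual coordinates), and a point X and a line L
  are incident iff their representatives have dot product 0. Hence points and lines live in
  the same set pg_elems, incidence is symmetric, and duality is swapping the roles.\<close>

type_synonym 'a vec3 = "'a \<times> 'a \<times> 'a"

definition scal :: "'a::field \<Rightarrow> 'a vec3 \<Rightarrow> 'a vec3" where
  "scal c v = (c * fst v, c * fst (snd v), c * snd (snd v))"

definition dot3 :: "'a::field vec3 \<Rightarrow> 'a vec3 \<Rightarrow> 'a" where
  "dot3 v w = fst v * fst w + fst (snd v) * fst (snd w) + snd (snd v) * snd (snd w)"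

definition proj_class :: "'a::field vec3 \<Rightarrow> 'a vec3 set" where
  "proj_class v = {scal c v | c. c \<noteq> 0}"

definition pg_elems :: "'a::{finite,field} vec3 set set" where
  "pg_elems = {proj_class v | v. v \<noteq> (0,0,0)}"

definition inc :: "'a::field vec3 set \<Rightarrow> 'a vec3 set \<Rightarrow> bool" where
  "inc X L \<longleftrightarrow> (\<forall>v\<in>X. \<forall>w\<in>L. dot3 v w = 0)"

text \<open>For a point P: the pencil [P] of lines through P; for a line l: the points onset l.\<close>
definition onset :: "'a::{finite,field} vec3 set \<Rightarrow> 'a vec3 set set" where
  "onset x = {y \<in> pg_elems. inc x y}"

definition dominating :: "'a::{finite,field} vec3 set set \<Rightarrow> 'a vec3 set set \<Rightarrow> bool" where
  "dominating Ps Ls \<longleftrightarrow> Ps \<subseteq> pg_elems \<and> Ls \<subseteq> pg_elems \<and>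
     (\<forall>X\<in>pg_elems - Ps. \<exists>L\<in>Ls. inc X L) \<and>
     (\<forall>L\<in>pg_elems - Ls. \<exists>X\<in>Ps. inc X L)"

definition dsize :: "'a set \<Rightarrow> 'a set \<Rightarrow> nat" where
  "dsize Ps Ls = card Ps + card Ls"

definition minimal_dominating :: "'a::{finite,field} vec3 set set \<Rightarrow> 'a vec3 set set \<Rightarrow> bool" where
  "minimal_dominating Ps Ls \<longleftrightarrow> dominating Ps Ls \<and>
     (\<forall>Ps' Ls'. Ps' \<subseteq> Ps \<and> Ls' \<subseteq> Ls \<and> (Ps', Ls') \<noteq> (Ps, Ls) \<longrightarrow> \<not> dominating Ps' Ls')"

definition stable :: "'a::{finite,field} vec3 set set \<Rightarrow> 'a vec3 set set \<Rightarrow> bool" where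
  "stable Ps Ls \<longleftrightarrow> minimal_dominating Ps Ls \<and>
     \<not> (\<exists>Ps' Ls'. dominating Ps' Ls' \<and> Ps \<subseteq> Ps' \<and> Ls \<subseteq> Ls' \<and>
          dsize Ps' Ls' = dsize Ps Ls + 1 \<and>
          (\<exists>Ps'' Ls''. Ps'' \<subseteq> Ps' \<and> Ls'' \<subseteq> Ls' \<and> dominating Ps'' Ls'' \<and>
               dsize Ps'' Ls'' < dsize Ps Ls))"

definition primal :: "'a::{finite,field} vec3 set set \<Rightarrow> 'a vec3 set set \<Rightarrow> bool" where
  "primal Ps Ls \<longleftrightarrow>
     (\<exists>P\<in>pg_elems. \<exists>S. S \<subseteq> Ls \<inter> onset P \<and> card S = CARD('a)) \<or>
     (\<exists>l\<in>pg_elems. \<exists>S. S \<subseteq> Ps \<inter> onset l \<and> card S = CARD('a))"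

definition blocking_set :: "'a::{finite,field} vec3 set set \<Rightarrow> bool" where
  "blocking_set B \<longleftrightarrow> B \<subseteq> pg_elems \<and> (\<forall>L\<in>pg_elems. \<exists>X\<in>B. inc X L)"

definition nontrivial_minimal_blocking_set :: "'a::{finite,field} vec3 set set \<Rightarrow> bool" where
  "nontrivial_minimal_blocking_set B \<longleftrightarrow> blocking_set B \<and>
     (\<forall>L\<in>pg_elems. \<not> onset L \<subseteq> B) \<and>
     (\<forall>B'. B' \<subset> B \<longrightarrow> \<not> blocking_set B')"

definition baer_subplane :: "'a::{finite,field} vec3 set set \<Rightarrow> 'a vec3 set set \<Rightarrow> bool" where
  "baer_subplane Sp Sl \<longleftrightarrow> Sp \<subseteq> pg_elems \<and> Sl \<subseteq> pg_elems \<and>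
     (\<exists>n::nat. n * n = CARD('a) \<and>
        (\<forall>L\<in>Sl. card (Sp \<inter> onset L) = n + 1) \<and>
        (\<forall>X\<in>Sp. card (Sl \<inter> onset X) = n + 1)) \<and>
     (\<forall>X\<in>Sp. \<forall>Y\<in>Sp. X \<noteq> Y \<longrightarrow> (\<exists>L\<in>Sl. inc X L \<and> inc Y L)) \<and>
     (\<forall>L\<in>Sl. \<forall>M\<in>Sl. L \<noteq> M \<longrightarrow> (\<exists>X\<in>Sp. inc X L \<and> inc X M))"

text \<open>Configurations, stated for (A,B) = (points, lines); the dual is obtained by
  applying the predicate to (lines, points).\<close>

definition baer_config_in :: "'a::{finite,field} vec3 set set \<Rightarrow> 'a vec3 set set \<Rightarrow> bool" where
  "baer_config_in A B \<longleftrightarrow> (\<exists>Sp Sl P. baer_subplane Sp Sl \<and> P \<in> Sp \<and> B = onset P \<and> A = Sp - {P})"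

definition baer_config_out :: "'a::{finite,field} vec3 set set \<Rightarrow> 'a vec3 set set \<Rightarrow> bool" where
  "baer_config_out A B \<longleftrightarrow> (\<exists>Sp Sl P. baer_subplane Sp Sl \<and> P \<in> pg_elems \<and> P \<notin> Sp \<and>
       B = onset P \<and> A = Sp)"

definition pencil_blocking_config :: "'a::{finite,field} vec3 set set \<Rightarrow> 'a vec3 set set \<Rightarrow> bool" where
  "pencil_blocking_config A B \<longleftrightarrow> (\<exists>P\<in>pg_elems. B = onset P) \<and>
     (\<exists>Bl. nontrivial_minimal_blocking_set Bl \<and> A \<subseteq> Bl \<and> card (Bl - A) \<le> 1)"

definition pencil_plus_line :: "'a::{finite,field} vec3 set set \<Rightarrow> bool" where
  "pencil_plus_line B \<longleftrightarrow> (\<exists>P\<in>pg_elems. \<exists>l\<in>pg_elems. l \<notin> onset P \<and> B = insert l (onset P))"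

definition c_const :: "nat \<Rightarrow> real" where
  "c_const p = (if p = 2 \<or> p = 3 then 2 powr (-1/3) else 1)"

end

theory Submission
  imports Defs "HOL-Computational_Algebra.Polynomial" "HOL-Library.Product_Plus"
begin

text \<open>Up to duality D contains q lines through a point P. Jamison's theorem, in the form that points off a
  line m blocking all other lines not through P number at least 2 (q - 1), shows that for |D| < 3 q - 1 the
  lines of D are either all lines through P or all but one of them; the latter case gives (i). In the
  former case the points of D, possibly together with P, form a minimal blocking set, and stability
  follows from Jamison's theorem once more.

  It remains to see that a nontrivial minimal blocking set B with fewer than q + c_p q^(2/3) + 1 points is a
  Baer subplane. Taking a tangent at a point R of B as the line at infinity, the abscissas of the affine points
  of B are the roots of a fully reducible lacunary polynomial X^q g + h (Redei). The analysis of such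
  polynomials (Blokhuis, Storme and Szonyi) shows that q = r^2 and that R lies on at least r + 1 lines with at
  least r + 1 points of B. Since this holds for every R in B, counting incidences gives |B| = q + r + 1.\<close>

section \<open>Fully reducible polynomials over a finite field\<close>

text \<open>The exponent 2/3 balances two estimates for a polynomial X^Q G + H with deg G = k and Q
  r = q, where r k is at most |B| - q - 1. One Frobenius step allows at most r k + 1 distinct roots,
  which forces r k to be about q / r or more. For r < Q two steps give a relation of degree about
  k^2, which forces r k to be about sqrt (q r) or more. The worst case is r near q^(1/3), where both
  are q^(2/3); \<open>cube_factor\<close> makes up for the lower-order terms when p is 2 or 3. The
  only case that escapes both estimates is Q = r, k = 1, and it is the one realised by Baer
  subplanes. The threshold 3 q - 1 is what Jamison's theorem yields: a punctured pencil has q lines,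
  a further line that contains no point of the set costs 1, and meeting the remaining lines off P
  costs 2 (q - 1). Points and lines share one carrier with symmetric incidence, so the dual of a
  statement is an instance of it.\<close>

lemma power_card_eq_self:
  fixes x :: "'a::{finite,field}"
  shows "x ^ CARD('a) = x"
proof (cases "x = 0")
  case False
  have "x * (\<Prod>y\<in>UNIV-{0}. x * y) = x * x ^ (CARD('a) - 1) * \<Prod>(UNIV-{0})"
    by (simp add: prod.distrib mult_ac)
  also have "x * x ^ (CARD('a) - 1) = x ^ Suc (CARD('a) - 1)"
    by (subst power_Suc) auto
  also have "Suc (CARD('a) - 1) = CARD('a)"
    using finite_UNIV_card_ge_0[where ?'a = 'a] by simp
  also have "(\<Prod>y\<in>UNIV-{0}. x * y) = (\<Prod>y\<in>UNIV-{0}. y)"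
    by (rule prod.reindex_bij_witness[of _ "\<lambda>y. y / x" "\<lambda>y. x * y"]) (use False in auto)
  finally show ?thesis
    by simp
qed (use finite_UNIV_card_ge_0[where ?'a = 'a] in auto)

text \<open>Translation by 1 permutes the field, so the sum of 1 over all elements vanishes and the
  characteristic divides p^h.\<close>

lemma CHAR_eq_prime:
  assumes "prime p" "CARD('a::{finite,field}) = p ^ h"
  shows "CHAR('a) = p"
proof -
  have "(\<Sum>x\<in>(UNIV::'a set). x + 1) = (\<Sum>x\<in>(UNIV::'a set). x)"
    by (rule sum.reindex_bij_witness[of _ "\<lambda>x. x - 1" "\<lambda>x. x + 1"]) auto
  then have "of_nat (CARD('a)) = (0::'a)"
    by (simp add: sum.distrib)
  then have "CHAR('a) dvd p ^ h"
    using assms(2) of_nat_eq_0_iff_char_dvd by metis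
  moreover have "prime (CHAR('a))"
    by (rule prime_CHAR_semidom) (simp add: finite_imp_CHAR_pos)
  ultimately show ?thesis
    using assms(1) by (meson prime_dvd_power primes_dvd_imp_eq)
qed

lemma degree_pderiv_le: "degree (pderiv p) \<le> degree p - 1"
  by (rule degree_le) (auto simp: coeff_pderiv coeff_eq_0)

definition linear_prod :: "('a::{finite,field} \<Rightarrow> nat) \<Rightarrow> 'a poly" where
  "linear_prod m = (\<Prod>a\<in>UNIV. [:-a, 1:] ^ m a)"

lemma linear_prod_split:
  "linear_prod m = [:-b, 1:] ^ m b * (\<Prod>a\<in>UNIV - {b}. [:-a, 1:] ^ m a)"
  unfolding linear_prod_def by (subst prod.remove[of _ b]) auto

lemma lead_coeff_linear_prod [simp]: "lead_coeff (linear_prod m) = 1"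
  by (simp add: linear_prod_def lead_coeff_prod lead_coeff_power)

lemma linear_prod_nonzero [simp]: "linear_prod m \<noteq> 0"
  using lead_coeff_linear_prod[of m] by force

lemma degree_linear_prod: "degree (linear_prod m) = (\<Sum>a\<in>UNIV. m a)"
  unfolding linear_prod_def by (subst degree_prod_sum_eq) (auto simp: degree_power_eq)

lemma poly_linear_prod_eq_0_iff: "poly (linear_prod m) b = 0 \<longleftrightarrow> m b > 0"
  by (auto simp: linear_prod_def poly_prod)

lemma linear_prod_power: "linear_prod m ^ r = linear_prod (\<lambda>a. m a * r)"
  by (simp add: linear_prod_def prod_power_distrib power_mult)

text \<open>A root b whose multiplicity n is prime to the characteristic is a root of the derivative
  of multiplicity exactly n - 1.\<close>

lemma pderiv_linear_prod_nonzero: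
  fixes m :: "'a::{finite,field} \<Rightarrow> nat"
  assumes "of_nat (m b) \<noteq> (0::'a)"
  shows "pderiv (linear_prod m) \<noteq> 0"
proof
  assume z: "pderiv (linear_prod m) = 0"
  define U where "U = (\<Prod>a\<in>UNIV - {b}. [:-a, 1:] ^ m a)"
  have U: "poly U b \<noteq> 0" by (auto simp: U_def poly_prod)
  obtain k where k: "m b = Suc k" using assms by (cases "m b") auto
  define L where "L = [:-b, 1:]"
  have L: "pderiv L = 1" "L \<noteq> 0" "poly L b = 0" by (auto simp: L_def pderiv_pCons)
  have "linear_prod m = L ^ Suc k * U"
    unfolding U_def k[symmetric] L_def by (rule linear_prod_split)
  then have "pderiv (linear_prod m) = L ^ k * (L * pderiv U + smult (of_nat (Suc k)) U)"
    by (simp only: pderiv_mult pderiv_power_Suc L) (simp add: algebra_simps smult_add_left)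
  with z L have "L * pderiv U + smult (of_nat (Suc k)) U = 0"
    by simp
  then have "poly (L * pderiv U + smult (of_nat (Suc k)) U) b = 0" by simp
  then have "poly L b * poly (pderiv U) b + of_nat (Suc k) * poly U b = 0"
    by (simp only: poly_add poly_mult poly_smult)
  then have "of_nat (Suc k) * poly U b = 0" using L by simp
  with U have "of_nat (Suc k) = (0::'a)" by simp
  with assms k show False by simp
qed

text \<open>In every characteristic a root of multiplicity n is a root of the derivative of
  multiplicity at least n - 1, and the radical supplies the missing factor. The product rule allows
  each summand to be treated separately.\<close>

lemma linear_prod_dvd_radical_pderiv:
  "linear_prod m dvd linear_prod (\<lambda>a. if m a > 0 then 1 else 0) * pderiv (linear_prod m)"
proof -
  let ?s = "linear_prod (\<lambda>a. if m a > 0 then 1 else 0)"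
  have "linear_prod m dvd ?s * ((\<Prod>b\<in>UNIV - {a}. [:-b, 1:] ^ m b) * pderiv ([:-a, 1:] ^ m a))" for a
  proof (cases "m a")
    case 0
    then show ?thesis by simp
  next
    case (Suc k)
    define t where "t = (\<Prod>b\<in>UNIV - {a}. [:-b, 1:] ^ (if m b > 0 then 1 else 0))"
    define L where "L = [:-a, 1:]"
    have L: "pderiv L = 1" by (auto simp: L_def pderiv_pCons)
    have s: "?s = L * t"
      unfolding t_def L_def using Suc linear_prod_split[of "\<lambda>a. if m a > 0 then 1 else 0" a] by simp
    have "?s * ((\<Prod>b\<in>UNIV - {a}. [:-b, 1:] ^ m b) * pderiv ([:-a, 1:] ^ m a))
       = linear_prod m * (t * [:of_nat (Suc k):])"
      unfolding s Suc pderiv_power_Suc linear_prod_split[of m a] L_def[symmetric] L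
      by (simp add: mult_ac)
    then show ?thesis by (simp only: dvd_triv_left)
  qed
  then show ?thesis
    unfolding linear_prod_def[of m] pderiv_prod sum_distrib_left
    by (simp add: linear_prod_def dvd_sum)
qed

text \<open>Induction on the number of linear factors: a root a of d e is a root of d or of e, and
  cancelling X - a there lowers the multiplicity at a by one.\<close>

lemma monic_dvd_linear_prod:
  fixes d e :: "'a::{finite,field} poly"
  assumes "d * e = linear_prod m" "lead_coeff d = 1"
  shows "\<exists>m'. (\<forall>a. m' a \<le> m a) \<and> d = linear_prod m'"
  using assms
proof (induction "\<Sum>a\<in>UNIV. m a" arbitrary: m d e)
  case 0
  then have "degree (d * e) = 0" by (simp add: degree_linear_prod)
  moreover have "d \<noteq> 0" "e \<noteq> 0" using 0 by auto
  ultimately have "degree d = 0" by (simp add: degree_mult_eq)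
  with 0 have "d = 1" by (metis degree_eq_zeroE degree_pCons_0 coeff_pCons_0 one_pCons)
  then have "d = linear_prod (\<lambda>_. 0)" by (simp add: linear_prod_def)
  then show ?case by auto
next
  case (Suc n)
  then obtain a where a: "m a > 0" by (metis Suc_neq_Zero sum.neutral gr0I)
  define m0 where "m0 = m(a := m a - 1)"
  have red: "linear_prod m = [:-a,1:] * linear_prod m0"
  proof -
    obtain k where k: "m a = Suc k" using a by (cases "m a") auto
    have "(\<Prod>b\<in>UNIV - {a}. [:-b, 1:] ^ m b) = (\<Prod>b\<in>UNIV - {a}. [:-b, 1:] ^ m0 b)"
      by (rule prod.cong) (auto simp: m0_def)
    then show ?thesis unfolding linear_prod_split[of _ a] using k by (simp add: m0_def mult.assoc del: mult_pCons_left)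
  qed
  have s0: "n = (\<Sum>a\<in>UNIV. m0 a)"
  proof -
    have "(\<Sum>b\<in>UNIV. m b) = m a + (\<Sum>b\<in>UNIV-{a}. m b)" by (subst sum.remove[of _ a]) auto
    moreover have "(\<Sum>b\<in>UNIV. m0 b) = m0 a + (\<Sum>b\<in>UNIV-{a}. m0 b)" by (subst sum.remove[of _ a]) auto
    moreover have "(\<Sum>b\<in>UNIV-{a}. m b) = (\<Sum>b\<in>UNIV-{a}. m0 b)"
      by (rule sum.cong) (auto simp: m0_def)
    moreover have "m0 a = m a - 1" by (simp add: m0_def)
    ultimately show ?thesis using Suc(2) a by linarith
  qed
  have "poly (d * e) a = 0" using Suc(3) a by (simp add: poly_linear_prod_eq_0_iff)
  then consider "poly d a = 0" | "poly e a = 0" by auto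
  then show ?case
  proof cases
    case 1
    then obtain d' where d': "d = [:-a,1:] * d'" unfolding poly_eq_0_iff_dvd by (rule dvdE)
    then have "[:-a,1:] * (d' * e) = [:-a,1:] * linear_prod m0"
      using Suc(3) red by (simp only: mult.assoc)
    then have de: "d' * e = linear_prod m0" by (subst (asm) mult_left_cancel) simp_all
    have lc: "lead_coeff d' = 1" using Suc(4) by (simp add: d' lead_coeff_mult del: mult_pCons_left)
    from Suc(1)[OF s0 de lc] obtain m' where m': "\<forall>a. m' a \<le> m0 a" "d' = linear_prod m'" by auto
    define m1 where "m1 = m'(a := Suc (m' a))"
    have "(\<Prod>b\<in>UNIV - {a}. [:-b, 1:] ^ m1 b) = (\<Prod>b\<in>UNIV - {a}. [:-b, 1:] ^ m' b)"
      by (rule prod.cong) (auto simp: m1_def)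
    moreover have "m1 a = Suc (m' a)" by (simp add: m1_def)
    ultimately have "d = linear_prod m1"
      unfolding d' m' linear_prod_split[of _ a] by (simp only: power_Suc mult.assoc)
    moreover have "m1 b \<le> m b" for b
      using m'(1)[rule_format, of b] a by (auto simp: m1_def m0_def split: if_splits)
    ultimately show ?thesis by blast
  next
    case 2
    then obtain e' where e': "e = [:-a,1:] * e'" unfolding poly_eq_0_iff_dvd by (rule dvdE)
    then have "[:-a,1:] * (d * e') = [:-a,1:] * linear_prod m0"
      using Suc(3) red by (simp only: mult.left_commute)
    then have de: "d * e' = linear_prod m0" by (subst (asm) mult_left_cancel) simp_all
    from Suc(1)[OF s0 de Suc(4)] obtain m' where m': "\<forall>a. m' a \<le> m0 a" "d = linear_prod m'" by auto
    moreover have "m0 b \<le> m b" for b by (auto simp: m0_def)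
    ultimately show ?thesis using le_trans by blast
  qed
qed

text \<open>d is a nonzero element of least degree in the ideal generated by g and h, finally
  rescaled to be monic. Coprimality of the cofactors is kept as a Bezout identity because this is
  what allows powers of H to be cancelled modulo G later.\<close>

lemma gcd_decomposition:
  fixes g h :: "'a::field poly"
  assumes "g \<noteq> 0"
  shows "\<exists>d g' h' u v. g = d * g' \<and> h = d * h' \<and> u * g' + v * h' = 1 \<and> lead_coeff d = 1"
proof -
  define I where "I = {u * g + v * h | u v. u * g + v * h \<noteq> 0}"
  have "1 * g + 0 * h \<in> I" unfolding I_def using assms by fastforce
  then obtain d where d: "d \<in> I" "\<And>x. x \<in> I \<Longrightarrow> degree d \<le> degree x"
    using ex_has_least_nat[of "\<lambda>x. x \<in> I" _ degree] by blast
  then obtain u v where uv: "d = u * g + v * h" "d \<noteq> 0" unfolding I_def by auto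
  have dvd: "d dvd x" if "x = a * g + b * h" for x a b
  proof (rule ccontr)
    assume "\<not> d dvd x"
    then have nz: "x mod d \<noteq> 0" by (simp add: mod_eq_0_iff_dvd)
    have "x mod d = x - x div d * d" by (simp add: minus_div_mult_eq_mod)
    also have "\<dots> = (a - x div d * u) * g + (b - x div d * v) * h"
      unfolding that uv(1) by (simp add: algebra_simps)
    finally have "x mod d \<in> I" using nz unfolding I_def by auto
    then have "degree d \<le> degree (x mod d)" by (rule d(2))
    moreover have "degree (x mod d) < degree d"
      using degree_mod_less[OF uv(2), of x] nz by auto
    ultimately show False by simp
  qed
  have "d dvd g" by (rule dvd[of _ 1 0]) simp
  moreover have "d dvd h" by (rule dvd[of _ 0 1]) simp
  ultimately obtain g' h' where gh: "g = d * g'" "h = d * h'" by (auto simp: dvd_def)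
  have "d * (u * g' + v * h') = d * 1" using uv(1) gh by (simp add: algebra_simps)
  then have "u * g' + v * h' = 1" using uv(2) by (metis mult_left_cancel)
  moreover define c where "c = lead_coeff d"
  moreover have "c \<noteq> 0" using uv(2) by (simp add: c_def)
  ultimately have "g = smult (1 / c) d * smult c g'" "h = smult (1 / c) d * smult c h'"
    "smult (1 / c) u * smult c g' + smult (1 / c) v * smult c h' = 1" "lead_coeff (smult (1 / c) d) = 1"
    using gh by simp_all
  then show ?thesis by blast
qed

section \<open>Lacunary polynomials\<close>

text \<open>For deg P <= k this is V^k P(U/V) with the denominators cleared.\<close>

definition hom_eval :: "nat \<Rightarrow> 'a::field poly \<Rightarrow> 'a poly \<Rightarrow> 'a poly \<Rightarrow> 'a poly" where
  "hom_eval k P U V = (\<Sum>i\<le>k. smult (coeff P i) (U ^ i * V ^ (k - i)))"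

lemma degree_hom_eval:
  assumes "degree U \<le> k" "degree V \<le> k"
  shows "degree (hom_eval k P U V) \<le> k * k"
  unfolding hom_eval_def
proof (rule degree_sum_le)
  fix i assume i: "i \<in> {..k}"
  have "degree (smult (coeff P i) (U ^ i * V ^ (k - i))) \<le> degree (U ^ i * V ^ (k - i))"
    by (rule degree_smult_le)
  also have "\<dots> \<le> degree (U ^ i) + degree (V ^ (k - i))" by (rule degree_mult_le)
  also have "\<dots> \<le> degree U * i + degree V * (k - i)"
    by (intro add_mono degree_power_le)
  also have "\<dots> \<le> k * i + k * (k - i)"
    using assms by (intro add_mono mult_right_mono) auto
  also have "\<dots> = k * k" using i by (simp flip: distrib_left)
  finally show "degree (smult (coeff P i) (U ^ i * V ^ (k - i))) \<le> k * k" .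
qed simp

lemma poly_hom_eval:
  assumes "degree P \<le> k" "poly U x = y * poly V x"
  shows "poly (hom_eval k P U V) x = poly V x ^ k * poly P y"
proof -
  have "poly P y = (\<Sum>i\<le>k. coeff P i * y ^ i)"
    unfolding poly_altdef by (rule sum.mono_neutral_left) (use assms in \<open>auto simp: coeff_eq_0\<close>)
  then show ?thesis
    by (auto simp: hom_eval_def poly_sum sum_distrib_left assms power_mult_distrib mult_ac
        simp flip: power_add intro!: sum.cong)
qed

text \<open>Modulo V^2 only the summands with the two highest indices survive; with V = G this is
  reduction modulo G^2.\<close>

lemma hom_eval_expand2:
  "\<exists>W. hom_eval (Suc (Suc n)) P U V = smult (coeff P (Suc (Suc n))) (U ^ Suc (Suc n))
      + smult (coeff P (Suc n)) (U ^ Suc n) * V + V * V * W"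
proof -
  have "V * V dvd (\<Sum>i\<le>n. smult (coeff P i) (U ^ i * V ^ (Suc (Suc n) - i)))"
    by (intro dvd_sum dvd_smult) (auto simp: Suc_diff_le)
  then obtain W where "(\<Sum>i\<le>n. smult (coeff P i) (U ^ i * V ^ (Suc (Suc n) - i))) = V * V * W"
    by (auto simp: dvd_def)
  then show ?thesis unfolding hom_eval_def by (intro exI[of _ W]) simp
qed

lemma hom_eval_expand1:
  "\<exists>W. hom_eval k P U V = smult (coeff P k) (U ^ k) + V * W"
proof (cases k)
  case 0
  then show ?thesis by (intro exI[of _ 0]) (simp add: hom_eval_def)
next
  case (Suc n)
  have "V dvd (\<Sum>i\<le>n. smult (coeff P i) (U ^ i * V ^ (Suc n - i)))"
    by (intro dvd_sum dvd_smult) (auto simp: Suc_diff_le)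
  then obtain W where "(\<Sum>i\<le>n. smult (coeff P i) (U ^ i * V ^ (Suc n - i))) = V * W"
    by (auto simp: dvd_def)
  then show ?thesis unfolding hom_eval_def Suc by (intro exI[of _ W]) simp
qed

text \<open>H is a unit modulo G; multiplying by the Bezout identity removes one factor H at a
  time.\<close>

lemma bezout_dvd_mult_power:
  fixes G H :: "'a::comm_ring_1"
  assumes "u * G + v * H = 1" "G dvd Y * H ^ n"
  shows "G dvd Y"
  using assms(2)
proof (induction n)
  case (Suc n)
  have "Y * H ^ n = (u * G + v * H) * (Y * H ^ n)" using assms(1) by simp
  also have "\<dots> = G * (u * Y * H ^ n) + v * (Y * H ^ Suc n)" by (simp add: algebra_simps)
  finally have "G dvd Y * H ^ n" using Suc.prems by (metis dvd_add dvd_triv_left dvd_mult)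
  then show ?case by (rule Suc.IH)
qed simp

lemma pderiv_power_CHAR:
  fixes P :: "'a::field poly"
  assumes "CHAR('a) = p" "w > 0"
  shows "pderiv (P ^ (p ^ w)) = 0"
proof -
  have "of_nat (p ^ w) = (0::'a)"
    using assms by (metis dvd_power of_nat_eq_0_iff_char_dvd)
  then show ?thesis by (simp add: pderiv_power del: of_nat_power)
qed

lemma card_roots_le:
  fixes P :: "'a::{finite,field} poly"
  assumes "P \<noteq> 0" "degree P \<le> n" "\<And>x. x \<in> S \<Longrightarrow> poly P x = 0"
  shows "card S \<le> n"
proof -
  have "card S \<le> card {x. poly P x = 0}" by (intro card_mono) (use assms in auto)
  also have "\<dots> \<le> degree P" by (rule card_poly_roots_bound) fact
  finally show ?thesis using assms by simp
qed

lemma poly_power_frobenius: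
  fixes P :: "'a::field poly"
  assumes "CHAR('a) = p" "prime p" "Q = p ^ i"
  shows "poly P x ^ Q = poly (map_poly (\<lambda>c. c ^ Q) P) (x ^ Q)"
proof -
  have Q: "Q > 0" using assms prime_gt_0_nat by simp
  have "poly P x ^ Q = (\<Sum>i\<le>degree P. (coeff P i * x ^ i) ^ Q)"
    unfolding poly_altdef using assms by (intro freshmans_dream_sum') auto
  also have "\<dots> = poly (map_poly (\<lambda>c. c ^ Q) P) (x ^ Q)"
    unfolding poly_altdef using Q
    by (subst degree_map_poly) (auto simp: coeff_map_poly power_mult_distrib mult.commute power_0_left
        simp flip: power_mult intro!: sum.cong)
  finally show ?thesis .
qed

text \<open>A fully reducible lacunary polynomial F = X^Q G + H over the field with Q r elements, where r is the
  largest common p-th power of the multiplicities that has been extracted. At every root x of F the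
  rational function -H/G agrees with the Frobenius power x^Q, so algebraic identities among Frobenius
  powers turn into polynomials of small degree that vanish at all roots of F. Comparing such degrees
  with the number of distinct roots gives all estimates below.\<close>

locale lacunary_poly =
  fixes m :: "'a::{finite,field} \<Rightarrow> nat" and G H u v :: "'a poly" and p e i k :: nat
  assumes prime_p: "prime p" and char: "CHAR('a) = p"
    and card_field: "CARD('a) = p ^ i * p ^ e" and i_pos: "i > 0"
    and F_eq: "linear_prod m = monom 1 (p ^ i) * G + H"
    and bezout: "u * G + v * H = 1"
    and lead_G: "lead_coeff G = 1" and deg_G: "degree G = k" and deg_H: "degree H \<le> k"
    and pderiv_F: "pderiv (linear_prod m) \<noteq> 0"
begin

abbreviation "Q \<equiv> p ^ i"
abbreviation "r \<equiv> p ^ e"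
abbreviation "\<sigma> \<equiv> card {x. m x > 0}"

lemma Q_pos: "Q > 0" and r_pos: "r > 0"
  using prime_p prime_gt_0_nat by auto

lemma Q_nz: "Q \<noteq> 0"
  using Q_pos by (simp only:)

lemma of_nat_Q: "of_nat Q = (0::'a)"
  using char i_pos by (metis dvd_power of_nat_eq_0_iff_char_dvd)

lemma pderiv_F_eq: "pderiv (linear_prod m) = monom 1 Q * pderiv G + pderiv H"
  unfolding F_eq pderiv_add pderiv_mult pderiv_monom of_nat_Q by simp

lemma k_pos: "k > 0"
proof (rule ccontr)
  assume "\<not> k > 0"
  then have "pderiv G = 0" "pderiv H = 0"
    using deg_G deg_H by (auto elim!: degree_eq_zeroE simp: pderiv_pCons)
  with pderiv_F_eq pderiv_F show False by simp
qed

lemma G_nz: "G \<noteq> 0" using lead_G by auto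

lemma G_dvd: "G dvd Y * (- H) ^ n \<Longrightarrow> G dvd Y"
  by (rule bezout_dvd_mult_power[of u G "- v" "- H"]) (simp_all add: bezout)

lemma G_not_unit: "\<not> G dvd 1"
  using k_pos deg_G by (auto elim!: is_unit_polyE simp: is_unit_poly_iff)

text \<open>Otherwise G would divide G' H, hence G', which has smaller degree. Then G' = H' = 0, and
  the derivative of F would vanish.\<close>

lemma wronskian_nonzero: "pderiv G * H - pderiv H * G \<noteq> 0"
proof
  assume *: "pderiv G * H - pderiv H * G = 0"
  then have "pderiv G * (- H) ^ 1 = G * (- pderiv H)" by (simp add: algebra_simps)
  then have "G dvd pderiv G * (- H) ^ 1" by simp
  then have "G dvd pderiv G" by (rule G_dvd)
  moreover have "degree (pderiv G) < degree G"
    using degree_pderiv_le[of G] k_pos deg_G by simp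
  ultimately have G': "pderiv G = 0" by (meson dvd_imp_degree_le not_le)
  with * G_nz have "pderiv H = 0" by simp
  with G' pderiv_F_eq pderiv_F show False by simp
qed

text \<open>The obvious bound is 2 k - 1. The gain of one is what makes \<open>many_roots\<close>
  produce r + 1 roots, and not just r, when Q = r and k = 1.\<close>

lemma degree_wronskian: "degree (pderiv G * H - pderiv H * G) \<le> 2 * k - 2"
proof -
  define c where "c = coeff H k"
  \<comment> \<open>Subtracting a multiple of G from H leaves the Wronskian unchanged; this multiple
    removes the coefficient of degree k.\<close>
  define H0 where "H0 = H - smult c G"
  have "coeff H0 k = 0" using lead_G deg_G by (simp add: H0_def c_def)
  moreover have "degree H0 \<le> k"
    unfolding H0_def using deg_H deg_G by (intro degree_diff_le) auto
  ultimately have d0: "degree H0 \<le> k - 1"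
    by (intro degree_le) (metis Suc_pred' coeff_eq_0 k_pos le_less_trans nat_neq_iff not_less_eq)
  have H: "H = H0 + smult c G" by (simp add: H0_def)
  have "pderiv G * H - pderiv H * G = pderiv G * H0 - pderiv H0 * G"
    unfolding H pderiv_add pderiv_smult by (simp add: algebra_simps)
  moreover have "degree (pderiv G * H0 - pderiv H0 * G) \<le> 2 * k - 2"
  proof (rule degree_diff_le)
    have "degree (pderiv G * H0) \<le> degree (pderiv G) + degree H0" by (rule degree_mult_le)
    also have "\<dots> \<le> (k - 1) + (k - 1)"
      using d0 degree_pderiv_le[of G] deg_G by simp
    finally show "degree (pderiv G * H0) \<le> 2 * k - 2" by simp
    show "degree (pderiv H0 * G) \<le> 2 * k - 2"
    proof (cases "degree H0 = 0")
      case True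
      then have "pderiv H0 = 0" by (auto elim!: degree_eq_zeroE simp: pderiv_pCons)
      then show ?thesis by simp
    next
      case False
      have "degree (pderiv H0 * G) \<le> degree (pderiv H0) + degree G" by (rule degree_mult_le)
      also have "\<dots> \<le> (degree H0 - 1) + k"
        using degree_pderiv_le[of H0] deg_G by simp
      finally show ?thesis using d0 False by simp
    qed
  qed
  ultimately show ?thesis by simp
qed

lemma degree_F: "degree (linear_prod m) = Q + k"
proof -
  have "degree (monom 1 Q * G) = Q + k"
    using G_nz deg_G by (simp add: degree_mult_eq degree_monom_eq monom_eq_0_iff)
  moreover have "degree H < Q + k" using deg_H Q_pos by linarith
  ultimately show ?thesis unfolding F_eq by (simp add: degree_add_eq_left)
qed

text \<open>Multiple roots of F are roots of the Wronskian of G and H, whose degree is at most 2 k - 2.\<close>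

lemma many_roots: "Q + 2 \<le> \<sigma> + k"
proof -
  let ?F = "linear_prod m" and ?D = "pderiv G * H - pderiv H * G"
  let ?s = "linear_prod (\<lambda>a. if m a > 0 then 1 else 0)"
  obtain Y where Y: "?s * pderiv ?F = ?F * Y"
    using linear_prod_dvd_radical_pderiv[of m] by (auto simp: dvd_def)
  \<comment> \<open>Combined with the fact that F divides \<open>?s\<close> times its derivative,
    this identity shows that F divides \<open>?s\<close> times the Wronskian.\<close>
  have "pderiv ?F * G = pderiv G * ?F - ?D"
    unfolding pderiv_F_eq unfolding F_eq by (simp add: algebra_simps)
  then have "?D = pderiv G * ?F - pderiv ?F * G" by simp
  then have "?s * ?D = ?s * (pderiv G * ?F) - (?s * pderiv ?F) * G"
    by (simp only: right_diff_distrib mult.assoc)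
  also have "\<dots> = ?F * (?s * pderiv G - Y * G)" unfolding Y by (simp add: algebra_simps)
  finally have "?F dvd ?s * ?D" by simp
  moreover have "?s * ?D \<noteq> 0" using wronskian_nonzero by simp
  ultimately have "degree ?F \<le> degree (?s * ?D)" by (rule dvd_imp_degree_le)
  also have "\<dots> = degree ?s + degree ?D" using wronskian_nonzero by (simp add: degree_mult_eq)
  also have "degree ?s = \<sigma>" by (simp add: degree_linear_prod sum.If_cases)
  finally show ?thesis using degree_F degree_wronskian k_pos by simp
qed

lemma root_facts:
  assumes "m x > 0"
  shows "poly (- H) x = x ^ Q * poly G x" "poly G x \<noteq> 0" "x ^ (Q * r) = x"
proof -
  have "poly (linear_prod m) x = 0" using assms by (simp add: poly_linear_prod_eq_0_iff)
  then have *: "x ^ Q * poly G x + poly H x = 0" by (simp add: F_eq poly_monom)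
  then show "poly (- H) x = x ^ Q * poly G x" by (simp add: add_eq_0_iff)
  show "poly G x \<noteq> 0"
  proof
    assume "poly G x = 0"
    moreover from this * have "poly H x = 0" by simp
    ultimately have "poly (u * G + v * H) x = 0" by simp
    then show False unfolding bezout by simp
  qed
  show "x ^ (Q * r) = x" using power_card_eq_self[of x] by (simp add: card_field)
qed

text \<open>The r-th power of -H(x) = x^Q G(x) reads (-H(x))^r = x G(x)^r, because x^(Q r) = x. As
  polynomials the two sides differ, since X G^r has degree r k + 1 and H^r at most r k.\<close>

lemma roots_le_linear: "\<sigma> \<le> r * k + 1"
proof (rule card_roots_le[of "[:0, 1:] * G ^ r - (- H) ^ r"])
  have d1: "degree ([:0, 1:] * G ^ r) = r * k + 1"
    using G_nz deg_G by (subst degree_mult_eq) (auto simp: degree_power_eq)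
  have d2: "degree ((- H) ^ r) \<le> r * k"
  proof -
    have "degree ((- H) ^ r) \<le> degree (- H) * r" by (rule degree_power_le)
    also have "\<dots> \<le> k * r" using deg_H by (intro mult_right_mono) auto
    finally show ?thesis by (simp add: mult.commute)
  qed
  show "[:0, 1:] * G ^ r - (- H) ^ r \<noteq> 0"
  proof
    assume "[:0, 1:] * G ^ r - (- H) ^ r = 0"
    then have "[:0, 1:] * G ^ r = (- H) ^ r" by (simp only: right_minus_eq)
    then show False using d1 d2 by simp
  qed
  show "degree ([:0, 1:] * G ^ r - (- H) ^ r) \<le> r * k + 1"
    using d1 d2 by (intro degree_diff_le) auto
  fix x assume "x \<in> {x. m x > 0}"
  then have m: "m x > 0" by simp
  have "poly ([:0, 1:] * G ^ r - (- H) ^ r) x = x * poly G x ^ r - (poly (- H) x) ^ r"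
    by (simp add: poly_power)
  also have "\<dots> = 0"
    unfolding root_facts(1)[OF m] power_mult_distrib power_mult[symmetric] root_facts(3)[OF m] by simp
  finally show "poly ([:0, 1:] * G ^ r - (- H) ^ r) x = 0" .
qed

text \<open>Iterating x \<mapsto> -H(x)/G(x) twice gives x^(Q^2) = -B(x)/A(x) at the roots of F. Reducing Q^2 modulo
  the order of Frobenius yields a relation of low degree, both for Q < r and for Q \<ge> r.\<close>

definition "G1 = map_poly (\<lambda>c. c ^ Q) G"
definition "H1 = map_poly (\<lambda>c. c ^ Q) H"
definition "A = hom_eval k G1 (- H) G"
definition "B = hom_eval k H1 (- H) G"

lemma coeff_G1: "coeff G1 j = coeff G j ^ Q" and coeff_H1: "coeff H1 j = coeff H j ^ Q"
  using Q_nz by (simp_all only: G1_def H1_def coeff_map_poly power_0_left if_False)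

lemma degree_AB: "degree A \<le> k * k" "degree B \<le> k * k"
  unfolding A_def B_def using deg_G deg_H by (auto intro!: degree_hom_eval)

text \<open>With y = x^Q, the Q-th power of y G(x) + H(x) = 0 turns G(x)^Q and H(x)^Q into the
  conjugate polynomials \<open>G1\<close> and \<open>H1\<close> at y. Since y = -H(x)/G(x),
  multiplying by G(x)^k makes A(x) and B(x) out of them.\<close>

lemma AB_root:
  assumes "m x > 0"
  shows "x ^ (Q * Q) * poly A x + poly B x = 0"
proof -
  define y where "y = x ^ Q"
  have dG: "degree G1 \<le> k" "degree H1 \<le> k"
    by (intro degree_le allI impI; use deg_G deg_H in \<open>simp only: coeff_G1 coeff_H1 coeff_eq_0 power_0_left Q_nz if_False\<close>)+
  have y: "poly (- H) x = y * poly G x" using root_facts(1)[OF assms] by (simp add: y_def)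
  have "poly A x = poly G x ^ k * poly G1 y" "poly B x = poly G x ^ k * poly H1 y"
    unfolding A_def B_def using dG y by (auto intro: poly_hom_eval)
  moreover have "poly G1 y = poly G x ^ Q" "poly H1 y = poly H x ^ Q"
    unfolding G1_def H1_def y_def by (rule poly_power_frobenius[symmetric, OF char prime_p refl])+
  moreover have "y ^ Q * poly G x ^ Q + poly H x ^ Q = 0"
  proof -
    have "y ^ Q * poly G x ^ Q + poly H x ^ Q = (y * poly G x + poly H x) ^ Q"
      unfolding power_mult_distrib[symmetric]
      by (rule freshmans_dream'[symmetric]) (use prime_p char in auto)
    also have "y * poly G x + poly H x = 0" using y by (metis add.left_inverse poly_minus)
    finally show ?thesis using Q_pos by simp
  qed
  ultimately have "y ^ Q * poly A x + poly B x = poly G x ^ k * 0"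
    by (simp only: mult.left_commute[of "y ^ Q"] distrib_left[symmetric])
  then show ?thesis by (simp only: y_def power_mult mult_zero_right)
qed

lemma A_expand: "\<exists>W. A = (- H) ^ k + G * W"
  using hom_eval_expand1[of k G1 "-H" G] lead_G deg_G by (simp add: A_def coeff_G1)

text \<open>Modulo G, A is the unit (-H)^k, whereas G itself is not a unit.\<close>

lemma A_nz: "A \<noteq> 0"
proof
  assume "A = 0"
  with A_expand obtain W where "(- H) ^ k + G * W = 0" by auto
  then have "G dvd (- H) ^ k" by (metis dvd_add_left_iff dvd_triv_left dvd_0_right)
  then have "G dvd 1 * (- H) ^ k" by simp
  then show False using G_dvd G_not_unit by blast
qed

text \<open>Raising x^(Q Q) A(x) = -B(x) to the power r / Q = p^w turns x^(Q Q) into x^(Q r) = x.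
  The resulting polynomial is nonzero because, for w > 0, its derivative is a power of A.\<close>

lemma roots_le_upper:
  assumes "r = Q * p ^ w" "w > 0"
  shows "\<sigma> \<le> p ^ w * (k * k) + 1"
proof (rule card_roots_le[of "[:0, 1:] * A ^ (p ^ w) - (- B) ^ (p ^ w)"])
  let ?u = "p ^ w"
  have dd: "degree (P ^ ?u) \<le> ?u * (k * k)" if "degree P \<le> k * k" for P :: "'a poly"
  proof -
    have "degree (P ^ ?u) \<le> degree P * ?u" by (rule degree_power_le)
    also have "\<dots> \<le> (k * k) * ?u" using that by (intro mult_right_mono) auto
    finally show ?thesis by (simp add: mult.commute)
  qed
  show "[:0, 1:] * A ^ ?u - (- B) ^ ?u \<noteq> 0"
  proof
    assume "[:0, 1:] * A ^ ?u - (- B) ^ ?u = 0"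
    then have "pderiv ([:0, 1:] * A ^ ?u - (- B) ^ ?u) = 0" by simp
    then have "A ^ ?u = 0"
      unfolding pderiv_diff pderiv_mult pderiv_power_CHAR[OF char assms(2)]
      by (simp add: pderiv_pCons)
    then show False using A_nz by simp
  qed
  have "degree ([:0, 1:] * A ^ ?u) \<le> degree [:0, 1::'a:] + degree (A ^ ?u)" by (rule degree_mult_le)
  also have "\<dots> \<le> ?u * (k * k) + 1" using dd[OF degree_AB(1)] by simp
  finally show "degree ([:0, 1:] * A ^ ?u - (- B) ^ ?u) \<le> ?u * (k * k) + 1"
    using dd[of "- B"] degree_AB(2) by (intro degree_diff_le) auto
  fix x assume "x \<in> {x. m x > 0}"
  then have m: "m x > 0" by simp
  have "poly (- B) x = x ^ (Q * Q) * poly A x"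
    using AB_root[OF m] by (simp add: add_eq_0_iff)
  then have "poly (- B) x ^ ?u = x ^ (Q * r) * poly A x ^ ?u"
    by (simp only: power_mult_distrib power_mult[symmetric] assms(1) mult.assoc)
  then show "poly ([:0, 1:] * A ^ ?u - (- B) ^ ?u) x = 0"
    using root_facts(3)[OF m] by (simp add: poly_power)
qed

text \<open>If the relation x^t A + B = 0 is an identity, reduction modulo G shows that G divides x^t + c, and for
  k = t > 1 reduction modulo G^2 forces the derivatives of both G and H to vanish.\<close>

lemma roots_le_lower:
  assumes "Q = p ^ w * r"
  shows "\<sigma> \<le> k * k + p ^ w \<or> k \<le> p ^ w \<and> (k = p ^ w \<longrightarrow> w = 0)"
proof (cases "monom 1 (p ^ w) * A + B = 0")
  case False
  let ?t = "p ^ w"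
  have "\<sigma> \<le> k * k + ?t"
  proof (rule card_roots_le[OF False])
    have "degree (monom 1 ?t * A) \<le> degree (monom (1::'a) ?t) + degree A" by (rule degree_mult_le)
    also have "\<dots> \<le> k * k + ?t" using degree_AB(1) degree_monom_le[of "1::'a" ?t] by simp
    finally show "degree (monom 1 ?t * A + B) \<le> k * k + ?t"
      using degree_AB(2) by (intro degree_add_le) auto
    fix x assume "x \<in> {x. m x > 0}"
    then have m: "m x > 0" by simp
    have "x ^ (Q * Q) = x ^ (Q * r * ?t)" using assms by (simp add: mult_ac)
    also have "\<dots> = x ^ ?t" unfolding power_mult[of x "Q * r"] root_facts(3)[OF m] ..
    finally show "poly (monom 1 ?t * A + B) x = 0"
      using AB_root[OF m] by (simp add: poly_monom)
  qed
  then show ?thesis by simp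
next
  case True
  let ?t = "p ^ w"
  define c where "c = coeff H1 k"
  have t_pos: "?t > 0" using prime_p prime_gt_0_nat by simp
  have m_nz: "monom 1 ?t + [:c:] \<noteq> 0"
  proof
    assume "monom 1 ?t + [:c:] = 0"
    then have "coeff (monom 1 ?t + [:c:]) ?t = 0" by simp
    with t_pos show False by (auto simp: coeff_pCons split: nat.splits)
  qed
  have m_deg: "degree (monom 1 ?t + [:c:]) = ?t"
    using t_pos by (subst degree_add_eq_left) (auto simp: degree_monom_eq)
  obtain W1 where W1: "A = (- H) ^ k + G * W1" using A_expand by auto
  obtain W2 where W2: "B = smult c ((- H) ^ k) + G * W2"
    using hom_eval_expand1[of k H1 "-H" G] by (auto simp: B_def c_def)
  have "(monom 1 ?t + [:c:]) * (- H) ^ k + G * (monom 1 ?t * W1 + W2) = 0"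
    using True unfolding W1 W2 by (simp add: algebra_simps)
  then have "G dvd (monom 1 ?t + [:c:]) * (- H) ^ k"
    by (metis dvd_add_left_iff dvd_triv_left dvd_0_right)
  then have Gd: "G dvd monom 1 ?t + [:c:]" by (rule G_dvd)
  then have kt: "k \<le> ?t" using m_nz m_deg deg_G dvd_imp_degree_le by metis
  moreover have False if k: "k = ?t" and w: "w > 0"
  proof -
    obtain Z where Z: "monom 1 ?t + [:c:] = G * Z" using Gd by (auto simp: dvd_def)
    have "Z \<noteq> 0" using Z m_nz by auto
    then have "degree Z = 0" using Z m_deg deg_G k G_nz by (metis add_cancel_left_right degree_mult_eq)
    then obtain z where z: "Z = [:z:]" by (auto elim: degree_eq_zeroE)
    have "lead_coeff (monom 1 ?t + [:c:]) = 1"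
      unfolding m_deg using t_pos by (auto simp: coeff_pCons split: nat.splits)
    moreover have "lead_coeff (G * Z) = z" using z lead_G by (simp only: lead_coeff_mult) simp
    ultimately have "z = 1" using Z by simp
    then have G: "G = monom 1 ?t + [:c:]" using Z z by simp
    have pG: "pderiv G = 0"
      using pderiv_power_CHAR[OF char w, of "[:0, 1:]"] by (simp add: G pderiv_add pderiv_pCons monom_altdef)
    have "p \<ge> 2" using prime_p prime_ge_2_nat by simp
    then have "?t \<ge> 2" using w self_le_power[of p w] by linarith
    then obtain n' where "k = 2 + n'" using k le_Suc_ex by blast
    then obtain n where n: "k = Suc (Suc n)" by simp
    \<comment> \<open>The coefficient of G just below the leading one vanishes because k =
      \<open>?t\<close> >= 2, so A has no term linear in G modulo G^2.\<close>
    have cG: "coeff G (Suc n) = 0" using k n by (simp add: G)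
    have "coeff G1 (Suc n) = 0" unfolding coeff_G1 cG power_0_left if_not_P[OF Q_nz] ..
    moreover have "coeff G1 k = 1" using lead_G deg_G by (simp add: coeff_G1)
    ultimately obtain W3 where W3: "A = (- H) ^ k + G * G * W3"
      using hom_eval_expand2[of n G1 "-H" G, folded n, folded A_def] by auto
    define b where "b = coeff H1 (Suc n)"
    obtain W4 where W4: "B = smult c ((- H) ^ k) + smult b ((- H) ^ Suc n) * G + G * G * W4"
      using hom_eval_expand2[of n H1 "-H" G, folded n, folded B_def c_def b_def] by auto
    have pk: "(- H) ^ k = - H * (- H) ^ Suc n" by (simp only: n power_Suc)
    have mon: "monom 1 ?t = G - [:c:]" by (simp add: G)
    \<comment> \<open>The multiples of c cancel and every remaining term has a factor G. After one
      factor G is removed, reduction modulo G leaves (b - H) (-H)^(k - 1).\<close>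
    have "G * ((- H) ^ Suc n * (- H + [:b:]) + G * ((G - [:c:]) * W3 + W4)) = 0"
    proof -
      define T where "T = (- H) ^ Suc n"
      have "(G - [:c:]) * (- H * T + G * G * W3) + (smult c (- H * T) + smult b T * G + G * G * W4) = 0"
        using True unfolding mon W3 W4 pk T_def .
      then show ?thesis unfolding T_def[symmetric] by (simp add: algebra_simps)
    qed
    then have "(- H) ^ Suc n * (- H + [:b:]) + G * ((G - [:c:]) * W3 + W4) = 0" using G_nz by simp
    then have "G dvd (- H + [:b:]) * (- H) ^ Suc n"
      by (metis dvd_add_left_iff dvd_triv_left dvd_0_right mult.commute)
    then have "G dvd - H + [:b:]" by (rule G_dvd)
    then obtain Y where Y: "- H + [:b:] = G * Y" by (auto simp: dvd_def)
    have "degree (- H + [:b:]) \<le> k" using deg_H by (intro degree_add_le) auto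
    then have "degree Y = 0"
      using Y deg_G G_nz by (cases "Y = 0") (auto simp: degree_mult_eq)
    then obtain y where "Y = [:y:]" by (auto elim: degree_eq_zeroE)
    then have "H = [:b:] - smult y G" using Y by (simp add: algebra_simps)
    then have "pderiv H = 0" using pG by (simp add: pderiv_diff pderiv_smult pderiv_pCons)
    then show False using pG pderiv_F_eq pderiv_F by simp
  qed
  ultimately show ?thesis by blast
qed

end

section \<open>Elementary inequalities leading from root counts to cubes\<close>

lemma square_to_cube_bound:
  fixes u k Q :: nat
  assumes "Q + 1 \<le> u * (k * k) + k" "u > 0" "k > 0"
  shows "Q \<le> u * k ^ 3"
proof -
  obtain j where j: "k = Suc j" using assms by (cases k) auto
  have "1 \<le> u * (k * k)" using assms by simp
  then have "u * (k * k) + j \<le> u * (k * k) + u * (k * k) * j" by simp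
  also have "\<dots> = u * k ^ 3" by (simp add: j power3_eq_cube algebra_simps)
  finally show ?thesis using assms(1) j by simp
qed

text \<open>Cubes the linear root count for Q = t r. The second hypothesis bounds the resulting (r +
  1)^3; it forces D t > r.\<close>

lemma linear_to_cube_bound:
  fixes t r k D :: nat
  assumes "t * r + 1 \<le> k * (r + 1)" "(r + 1) ^ 3 \<le> D * t * r ^ 2"
  shows "t ^ 2 * r \<le> D * k ^ 3"
proof -
  have "(t * r) ^ 3 \<le> (k * (r + 1)) ^ 3" by (rule power_mono) (use assms in auto)
  then have "D * (t * r) ^ 3 \<le> D * (k * (r + 1)) ^ 3" by (rule mult_left_mono) simp
  then have "D * (t * r) ^ 3 \<le> D * k ^ 3 * (r + 1) ^ 3" by (simp only: power_mult_distrib mult.assoc)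
  moreover have "(t ^ 2 * r) * (r + 1) ^ 3 \<le> (t ^ 2 * r) * (D * t * r ^ 2)"
    using assms(2) by (rule mult_left_mono) simp
  moreover have "(t ^ 2 * r) * (D * t * r ^ 2) = D * (t * r) ^ 3"
    by (simp add: power2_eq_square power3_eq_cube)
  ultimately have "(t ^ 2 * r) * (r + 1) ^ 3 \<le> D * k ^ 3 * (r + 1) ^ 3" by linarith
  then show ?thesis by simp
qed

text \<open>If t > k, then k^2 + k <= t^2, which contradicts s >= 2. With t <= k, the first
  hypothesis bounds t t s by k^2 + 2 k - 2, which is at most 2 k^2, and multiplying by t <= k gives
  the cube.\<close>

lemma quadratic_bound_2:
  fixes t s k :: nat
  assumes "t * (t * s) + 2 \<le> k * k + k + t" "s \<ge> 2" "t > 0"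
  shows "t ^ 3 * s \<le> 2 * k ^ 3"
proof -
  have kt: "t \<le> k"
  proof (rule ccontr)
    assume "\<not> t \<le> k"
    then have "k * k + k \<le> t * k" by (cases t) auto
    also have "\<dots> \<le> t * t" using \<open>\<not> t \<le> k\<close> by simp
    finally have "k * k + k \<le> t * t" .
    moreover have "t * t * 2 \<le> t * t * s" using assms by (intro mult_left_mono) auto
    moreover have "t \<le> t * t" by simp
    ultimately show False using assms(1) by (simp add: algebra_simps)
  qed
  have "real t * (t * (t * s)) \<le> t * (real k * k + k + t - 2)"
    using assms(1) by (intro mult_left_mono) (simp_all flip: of_nat_mult of_nat_add)
  also have "\<dots> \<le> k * (real k * k + k + k - 2)"
  proof (rule mult_mono)
    have "1 \<le> real k" using kt assms(3) by simp
    moreover from this have "real k * 1 \<le> real k * k" by (intro mult_left_mono) auto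
    ultimately show "0 \<le> real k * k + k + t - 2" using assms(3) by linarith
  qed (use kt in auto)
  also have "\<dots> \<le> k * (2 * (real k * k))"
  proof (rule mult_left_mono)
    have "0 \<le> (real k - 1)\<^sup>2" by simp
    then show "real k * k + k + k - 2 \<le> 2 * (real k * k)"
      by (simp add: power2_eq_square algebra_simps)
  qed simp
  finally have "real (t ^ 3 * s) \<le> real (2 * k ^ 3)" by (simp add: power3_eq_cube mult_ac)
  then show ?thesis by (simp only: of_nat_le_iff)
qed

text \<open>For s >= 5 the same argument gives 2 t <= k, and multiplying by t <= k / 2 removes the
  constant 2. In the application s is a positive power of p, which is why the theorem singles out p
  = 2 and p = 3.\<close>

lemma quadratic_bound_5:
  fixes t s k :: nat
  assumes "t * (t * s) + 2 \<le> k * k + k + t" "s \<ge> 5" "t > 0"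
  shows "t ^ 3 * s \<le> k ^ 3"
proof -
  have kt: "2 * t \<le> k"
  proof (rule ccontr)
    assume "\<not> 2 * t \<le> k"
    then have "k * k + k \<le> (2 * t) * k" by (cases "2 * t") auto
    also have "\<dots> \<le> (2 * t) * (2 * t)" using \<open>\<not> 2 * t \<le> k\<close> by (intro mult_left_mono) auto
    finally have "k * k + k \<le> 4 * (t * t)" by simp
    moreover have "t * t * 5 \<le> t * t * s" using assms by (intro mult_left_mono) auto
    moreover have "t \<le> t * t" by simp
    ultimately show False using assms(1) by (simp add: algebra_simps)
  qed
  have "real t * (t * (t * s)) \<le> t * (real k * k + k + t)"
    using assms(1) by (intro mult_left_mono) (simp_all flip: of_nat_mult of_nat_add)
  also have "\<dots> \<le> (k / 2) * (real k * k + k + k / 2)"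
    using kt by (intro mult_mono) auto
  also have "\<dots> \<le> (k / 2) * (2 * (real k * k))"
  proof (rule mult_left_mono)
    have "k \<ge> 2" using kt assms by simp
    then have "real k * 2 \<le> real k * k" by (intro mult_left_mono) auto
    then show "real k * k + k + k / 2 \<le> 2 * (real k * k)" by simp
  qed simp
  finally have "real (t ^ 3 * s) \<le> real (k ^ 3)" by (simp add: power3_eq_cube mult_ac)
  then show ?thesis by (simp only: of_nat_le_iff)
qed

text \<open>This is c_p^(-3) for the constant c_p of the theorem.\<close>

definition cube_factor :: "nat \<Rightarrow> nat" where
  "cube_factor p = (if p = 2 \<or> p = 3 then 2 else 1)"

context lacunary_poly
begin

text \<open>For Q < r and for r < Q < r^2 two Frobenius steps are used, for Q >= r^2 the linear
  count. For Q = r two steps suffice unless k = 1, and then \<open>many_roots\<close> gives r + 1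
  roots. For Q = t r the first alternative amounts to t^2 r <= D k^3 with D =
  \<open>cube_factor p\<close>.\<close>

lemma k_bound:
  assumes "CARD('a) > 16"
  shows "(CARD('a))\<^sup>2 \<le> cube_factor p * (r * k) ^ 3 \<or> Q = r \<and> r + 1 \<le> \<sigma>"
proof -
  let ?D = "cube_factor p"
  have D1: "?D \<ge> 1" by (simp add: cube_factor_def)
  have p2: "p \<ge> 2" using prime_p prime_ge_2_nat by simp
  have rpos: "r \<ge> 1" using r_pos by linarith
  have lin: "Q + 1 \<le> k * (r + 1)"
    using many_roots roots_le_linear by (simp add: algebra_simps)
  have goalI: "(CARD('a))\<^sup>2 \<le> ?D * (r * k) ^ 3" if "t ^ 2 * r \<le> ?D * k ^ 3" "Q = t * r" for t
  proof -
    have "(CARD('a))\<^sup>2 = r ^ 3 * (t ^ 2 * r)"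
      unfolding card_field that(2) by (simp add: power2_eq_square power3_eq_cube mult_ac)
    also have "\<dots> \<le> r ^ 3 * (?D * k ^ 3)" using that(1) by (rule mult_left_mono) simp
    finally show ?thesis by (simp add: power_mult_distrib mult_ac)
  qed
  consider "i < e" | "i = e" | "2 * e \<le> i" "i \<noteq> e" | "e < i" "i < 2 * e" by linarith
  then show ?thesis
  proof cases
    case 1
    define w where "w = e - i"
    have w: "w > 0" "r = Q * p ^ w" using 1 by (auto simp: w_def simp flip: power_add)
    have "Q + 1 \<le> p ^ w * (k * k) + k"
      using many_roots roots_le_upper[OF w(2,1)] by linarith
    then have "Q \<le> p ^ w * k ^ 3"
      by (rule square_to_cube_bound) (use k_pos p2 in auto)
    then have "Q ^ 3 * (p ^ w) ^ 2 * Q \<le> Q ^ 3 * (p ^ w) ^ 2 * (p ^ w * k ^ 3)"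
      by (rule mult_left_mono) simp
    also have "\<dots> = (r * k) ^ 3" unfolding w(2)
      by (simp add: power_mult_distrib power2_eq_square power3_eq_cube mult_ac)
    also have "Q ^ 3 * (p ^ w) ^ 2 * Q = (CARD('a))\<^sup>2" unfolding card_field w(2)
      by (simp add: power_mult_distrib power2_eq_square power3_eq_cube mult_ac)
    also have "(r * k) ^ 3 \<le> ?D * (r * k) ^ 3" using D1 by simp
    finally show ?thesis by blast
  next
    case 2
    then have Q: "Q = p ^ 0 * r" by simp
    show ?thesis
    proof (cases "k \<le> 1")
      case True
      then show ?thesis using many_roots k_pos Q by simp
    next
      case False
      with roots_le_lower[OF Q] have "\<sigma> \<le> k * k + 1" by auto
      then have "r + 1 \<le> 1 * (k * k) + k" using many_roots Q by simp
      then have "r \<le> 1 * k ^ 3" by (rule square_to_cube_bound) (use k_pos in auto)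
      also have "\<dots> \<le> ?D * k ^ 3" using D1 by simp
      finally show ?thesis using goalI[of 1] Q by simp
    qed
  next
    case 3
    define w where "w = i - e"
    have Q: "Q = p ^ w * r" using 3 by (auto simp: w_def simp flip: power_add)
    have "(p ^ w)\<^sup>2 * r \<le> ?D * k ^ 3"
    proof (cases "i = 2 * e")
      case True
      then have we: "p ^ w = r" by (simp add: w_def)
      \<comment> \<open>With t = r, \<open>linear_to_cube_bound\<close> is out of reach for
        \<open>?D\<close> = 1. Integrality helps: k <= r - 1 would give k (r + 1) <= r^2 - 1, below
        Q + 1.\<close>
      have "r \<le> k"
      proof (rule ccontr)
        assume "\<not> r \<le> k"
        then obtain j where j: "r = Suc (k + j)" using less_imp_Suc_add not_le by blast
        have "Q + 1 \<le> k * (r + 1)" by (rule lin)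
        moreover have "k * (k + j) \<le> (k + j) * (k + j)" by (rule mult_right_mono) auto
        ultimately show False unfolding Q we j by simp
      qed
      then have "r ^ 3 \<le> k ^ 3" by (rule power_mono) simp
      also have "\<dots> \<le> ?D * k ^ 3" using D1 by simp
      finally show ?thesis unfolding we by (simp add: power2_eq_square power3_eq_cube)
    next
      case False
      show ?thesis
      proof (rule linear_to_cube_bound)
        show "p ^ w * r + 1 \<le> k * (r + 1)" using lin Q by simp
        show "(r + 1) ^ 3 \<le> ?D * p ^ w * r\<^sup>2"
        proof (cases "e = 0")
          case True
          then have "p ^ w = CARD('a)" by (simp add: card_field w_def)
          \<comment> \<open>Here r = 1, and the inequality to be shown is (1 + 1)^3 <=
            \<open>?D\<close> q.\<close>
          with assms have "8 \<le> p ^ w" by simp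
          also have "\<dots> \<le> ?D * p ^ w" using D1 by simp
          finally show ?thesis using True by (simp add: power3_eq_cube)
        next
          case e: False
          have "w \<ge> e + 1" using False 3 by (simp add: w_def)
          then have "p ^ (e + 1) \<le> p ^ w" using p2 by (intro power_increasing) auto
          then have 1: "?D * (p * r) \<le> ?D * p ^ w" by simp
          \<comment> \<open>For p = 2 and p = 3 it is the factor \<open>?D\<close> = 2 that lifts
            the product to at least 4. Then \<open>?D * p ^ w\<close> is at least 4 r, and (r + 1)^3
            <= 4 r^3 because r >= 2.\<close>
          have "?D * p \<ge> 4"
          proof (cases "p = 2 \<or> p = 3")
            case False
            then have "p \<ge> 4" using p2 by linarith
            then show ?thesis using D1 by (metis mult_le_mono nat_mult_1)
          qed (auto simp: cube_factor_def)
          then have 2: "4 * r \<le> ?D * (p * r)" using mult_right_mono by fastforce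
          have "r \<ge> 2" using e p2 self_le_power[of p e] by linarith
          then obtain j where j: "r = 2 + j" using le_Suc_ex by blast
          have "(r + 1) ^ 3 \<le> 4 * r * r\<^sup>2" unfolding j by (simp add: power2_eq_square power3_eq_cube algebra_simps)
          also have "\<dots> \<le> ?D * p ^ w * r\<^sup>2" using 1 2 by (intro mult_right_mono) linarith+
          finally show ?thesis .
        qed
      qed
    qed
    then show ?thesis using goalI Q by blast
  next
    case 4
    define w where "w = i - e"
    define t where "t = p ^ w"
    define s where "s = p ^ (e - w)"
    have Q: "Q = p ^ w * r" using 4 by (auto simp: w_def simp flip: power_add)
    have w: "w > 0" "w < e" using 4 by (auto simp: w_def)
    have r: "r = t * s" using w by (simp add: t_def s_def flip: power_add)
    have tp: "t \<ge> p" "s \<ge> p" unfolding t_def s_def using w p2 by (auto intro!: self_le_power)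
    have tr: "t \<le> r" unfolding r using tp p2 by simp
    \<comment> \<open>The other alternative of \<open>roots_le_lower\<close> means k < t <= r here,
      and the linear count excludes this.\<close>
    have "\<sigma> \<le> k * k + t"
    proof (rule ccontr)
      assume "\<not> \<sigma> \<le> k * k + t"
      then have "k < t" using roots_le_lower[OF Q] w by (auto simp: t_def)
      then obtain j where j: "t = Suc (k + j)" using less_imp_Suc_add by blast
      obtain l where l: "r = t + l" using tr le_Suc_ex by blast
      have "t * r + 1 \<le> k * (r + 1)" using lin Q by (simp add: t_def)
      then show False using j l by (simp add: algebra_simps)
    qed
    then have *: "t * (t * s) + 2 \<le> k * k + k + t"
      using many_roots unfolding Q[folded t_def] r by simp
    have "t ^ 3 * s \<le> ?D * k ^ 3"
    proof (cases "p = 2 \<or> p = 3")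
      case True
      then show ?thesis using quadratic_bound_2[OF *] tp p2 by (auto simp: cube_factor_def)
    next
      case False
      have "p \<noteq> 4" using prime_p by auto
      then have "p \<ge> 5" using False p2 by linarith
      then show ?thesis using quadratic_bound_5[OF *] tp False by (simp add: cube_factor_def)
    qed
    then have "t\<^sup>2 * r \<le> ?D * k ^ 3" by (simp add: r power2_eq_square power3_eq_cube mult_ac)
    then show ?thesis using goalI Q t_def by blast
  qed
qed

end

text \<open>Reduction to the locale, which asks for coprime G and H and a nonzero derivative of F.
  Dividing by the common divisor d of g and h leaves a fully reducible f'; extracting the largest
  power r = p^e that divides all its multiplicities leaves F. Both steps only lower multiplicities,
  so a root of F has multiplicity at least r in the original polynomial, and r deg G <= K.\<close>

lemma lacunary_bound:
  fixes m :: "'a::{finite,field} \<Rightarrow> nat" and g h :: "'a poly"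
  assumes p: "prime p" "CARD('a) = p ^ n" and q16: "CARD('a) > 16"
    and f: "linear_prod m = monom 1 (CARD('a)) * g + h"
    and g: "lead_coeff g = 1" "degree g = K" and h: "degree h \<le> K" and K: "K < CARD('a)"
    and mult: "\<And>a. m a < CARD('a)"
  shows "(CARD('a))\<^sup>2 \<le> cube_factor p * K ^ 3 \<or> (\<exists>r. CARD('a) = r * r \<and> r + 1 \<le> card {a. m a \<ge> r})"
proof -
  let ?q = "CARD('a)"
  have char: "CHAR('a) = p" using CHAR_eq_prime p by blast
  have "g \<noteq> 0" using g by auto
  obtain d g' h' u v where dec: "g = d * g'" "h = d * h'" "u * g' + v * h' = 1" "lead_coeff d = 1"
    using gcd_decomposition[OF \<open>g \<noteq> 0\<close>] by blast
  have lg: "lead_coeff g' = 1" using g(1) dec by (simp add: lead_coeff_mult)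
  have nz: "d \<noteq> 0" "g' \<noteq> 0" using dec lg by auto
  define f' where "f' = monom 1 ?q * g' + h'"
  have df: "f' * d = linear_prod m" unfolding f f'_def dec by (simp add: algebra_simps)
  have "lead_coeff f' * lead_coeff d = 1" unfolding lead_coeff_mult[symmetric] df by simp
  then have "lead_coeff f' = 1" using dec by simp
  then obtain m' where m': "\<And>a. m' a \<le> m a" "f' = linear_prod m'"
    using monic_dvd_linear_prod[OF df] by blast
  have degg: "degree g' \<le> K" using g(2) dec(1) nz by (simp add: degree_mult_eq)
  have degh: "degree h' \<le> degree g'"
    using h g(2) dec(1,2) nz by (cases "h' = 0") (auto simp: degree_mult_eq)
  have degh_q: "degree h' < ?q" using degh degg K by simp
  have "degree (monom 1 ?q * g') = ?q + degree g'"
    using nz by (simp add: degree_mult_eq degree_monom_eq)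
  then have "degree f' = ?q + degree g'" unfolding f'_def using degh_q
    by (subst degree_add_eq_left) auto
  then have "(\<Sum>a\<in>UNIV. m' a) \<noteq> 0" using m'(2) q16 by (simp add: degree_linear_prod)
  then obtain b0 where b0: "m' b0 > 0" by (metis gr0I sum.neutral)
  define E where "E = {e. \<forall>a. p ^ e dvd m' a}"
  have p2: "p \<ge> 2" using p prime_ge_2_nat by simp
  \<comment> \<open>Some multiplicity is positive, hence at least p^e, and all are below q. So e <
    n, and Q = p^(n - e) is divisible by p.\<close>
  have En: "e < n" if "e \<in> E" for e
  proof -
    have "p ^ e \<le> m' b0" using that b0 by (auto simp: E_def dest: dvd_imp_le)
    also have "\<dots> < p ^ n" using m'(1)[of b0] mult[of b0] p by simp
    finally show ?thesis using p2 by (simp add: power_strict_increasing_iff)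
  qed
  then have fin: "finite E" by (meson finite_nat_set_iff_bounded)
  have "0 \<in> E" by (simp add: E_def)
  define e where "e = Max E"
  have e: "e \<in> E" "Suc e \<notin> E" using Max_in[OF fin] \<open>0 \<in> E\<close> Max_ge[OF fin, of "Suc e"] by (auto simp: e_def)
  define r where "r = p ^ e"
  have r0: "r > 0" using p2 by (simp add: r_def)
  define i where "i = n - e"
  define Q where "Q = p ^ i"
  have i: "i > 0" "?q = Q * r" using En[OF e(1)] p by (auto simp: i_def Q_def r_def simp flip: power_add)
  define m2 where "m2 = (\<lambda>a. m' a div r)"
  have m2: "m' a = m2 a * r" for a using e(1) by (simp add: m2_def r_def E_def)
  obtain b where "\<not> p ^ Suc e dvd m' b" using e(2) by (auto simp: E_def)
  then have "\<not> p dvd m2 b" unfolding m2[of b] using p2 by (simp add: r_def)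
  then have "of_nat (m2 b) \<noteq> (0::'a)" using char of_nat_eq_0_iff_char_dvd by metis
  then have pd: "pderiv (linear_prod m2) \<noteq> 0" by (rule pderiv_linear_prod_nonzero)
  define F where "F = linear_prod m2"
  have Fr: "F ^ r = f'" unfolding F_def linear_prod_power m'(2) m2[symmetric] ..
  define G where "G = F div monom 1 Q"
  define H where "H = F mod monom 1 Q"
  have FGH: "F = monom 1 Q * G + H" by (simp add: G_def H_def)
  have Q0: "Q > 0" using p2 by (simp add: Q_def)
  have HQ: "degree H < Q"
    using degree_mod_less[of "monom 1 Q" F] Q0 by (auto simp: H_def degree_monom_eq)
  have chp: "prime CHAR('a poly)" "r = CHAR('a poly) ^ e" using p char by (simp_all add: r_def)
  have "f' = (monom 1 Q * G) ^ r + H ^ r"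
    unfolding Fr[symmetric] FGH by (rule freshmans_dream'[OF chp])
  then have fr: "f' = monom 1 ?q * G ^ r + H ^ r"
    by (simp add: power_mult_distrib monom_power i(2))
  have degHr: "degree (H ^ r) < ?q"
  proof -
    have "degree (H ^ r) \<le> degree H * r" by (rule degree_power_le)
    also have "\<dots> < Q * r" using HQ r0 by simp
    finally show ?thesis by (simp add: i(2))
  qed
  have diff: "monom 1 ?q * (g' - G ^ r) = H ^ r - h'"
    using fr unfolding f'_def by (simp add: algebra_simps)
  \<comment> \<open>f' is split at degree q in two ways, both with a remainder of degree below q;
    hence quotients and remainders agree.\<close>
  have gG: "g' = G ^ r"
  proof (rule ccontr)
    assume "g' \<noteq> G ^ r"
    then have "degree (monom 1 ?q * (g' - G ^ r)) = ?q + degree (g' - G ^ r)"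
      by (simp add: degree_mult_eq degree_monom_eq)
    moreover have "degree (H ^ r - h') < ?q" using degHr degh_q by (rule degree_diff_less)
    ultimately show False unfolding diff by simp
  qed
  then have hH: "h' = H ^ r" using diff by simp
  have "lead_coeff G ^ r = 1" using lg gG by (simp add: lead_coeff_power)
  \<comment> \<open>Frobenius is additive, so the r-th power of \<open>lead_coeff G - 1\<close> is 1
    - 1 = 0.\<close>
  moreover have "(lead_coeff G - 1 + 1) ^ r = (lead_coeff G - 1) ^ r + 1 ^ r"
    by (rule freshmans_dream'[of r e]) (use p char in \<open>simp_all add: r_def\<close>)
  ultimately have lG: "lead_coeff G = 1" using r0 by simp
  have dG: "degree g' = r * degree G" using gG lG by (metis degree_power_eq leading_coeff_0_iff mult.commute zero_neq_one)
  have dH: "degree H \<le> degree G"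
  proof (cases "H = 0")
    case False
    then have "degree h' = r * degree H" using hH by (metis degree_power_eq mult.commute)
    then show ?thesis using degh dG r0 by simp
  qed simp
  have "r = Suc (r - 1)" using r0 by simp
  then have "G ^ r = G ^ (r - 1) * G" "H ^ r = H ^ (r - 1) * H" by (metis power_Suc2)+
  then have bez: "(u * G ^ (r - 1)) * G + (v * H ^ (r - 1)) * H = 1"
    using dec(3) gG hH by (simp add: mult.assoc)
  interpret lacunary_poly m2 G H "u * G ^ (r - 1)" "v * H ^ (r - 1)" p e i "degree G"
    by unfold_locales (use p char i bez lG dH pd FGH in \<open>simp_all add: F_def Q_def r_def\<close>)
  from k_bound[OF q16] consider "?q\<^sup>2 \<le> cube_factor p * (r * degree G) ^ 3"
    | "Q = r" "r + 1 \<le> card {x. m2 x > 0}" unfolding r_def Q_def by blast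
  then show ?thesis
  proof cases
    case 1
    have "(r * degree G) ^ 3 \<le> K ^ 3" using dG degg by (intro power_mono) auto
    then have "cube_factor p * (r * degree G) ^ 3 \<le> cube_factor p * K ^ 3" by simp
    then show ?thesis using 1 by linarith
  next
    case 2
    have "{x. m2 x > 0} \<subseteq> {a. m a \<ge> r}"
    proof safe
      fix x assume "m2 x > 0"
      then have "r \<le> m' x" using m2[of x] by simp
      then show "r \<le> m x" using m'(1)[of x] by simp
    qed
    then have "r + 1 \<le> card {a. m a \<ge> r}" using 2(2) by (meson card_mono finite le_trans)
    then show ?thesis using i(2) 2(1) by blast
  qed
qed

section \<open>Coordinates of the projective plane\<close>

lemma scal_simps [simp]: "fst (scal c v) = c * fst v" "fst (snd (scal c v)) = c * fst (snd v)"
  "snd (snd (scal c v)) = c * snd (snd v)"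
  by (simp_all add: scal_def)

lemma vec3_eq_iff: "v = w \<longleftrightarrow> fst v = fst w \<and> fst (snd v) = fst (snd w) \<and> snd (snd v) = snd (snd w)"
  for v w :: "'a vec3"
  by (auto simp: prod_eq_iff)

lemma vec3_zero: "(0, 0, 0) = (0 :: 'a::field vec3)"
  by (simp add: vec3_eq_iff)

lemma dot3_commute: "dot3 v w = dot3 w v"
  by (simp add: dot3_def mult.commute)

lemma dot3_scal [simp]: "dot3 (scal c v) w = c * dot3 v w" "dot3 v (scal c w) = c * dot3 v w"
  by (simp_all add: dot3_def algebra_simps)

lemma dot3_add: "dot3 (u + v) w = dot3 u w + dot3 v w" "dot3 w (u + v) = dot3 w u + dot3 w v"
  by (simp_all add: dot3_def algebra_simps)

lemma dot3_zero [simp]: "dot3 0 w = 0" "dot3 w 0 = 0"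
  by (simp_all add: dot3_def)

lemma scal_scal [simp]: "scal c (scal d v) = scal (c * d) v"
  by (simp add: scal_def mult.assoc)

lemma scal_one [simp]: "scal 1 v = v"
  by (simp add: scal_def)

lemma scal_zero [simp]: "scal 0 v = 0"
  by (simp add: vec3_eq_iff)

lemma scal_eq_0_iff [simp]: "scal c v = 0 \<longleftrightarrow> c = 0 \<or> v = 0"
  by (auto simp: vec3_eq_iff)

lemma proj_class_eq_iff: "proj_class v = proj_class w \<longleftrightarrow> (\<exists>c. c \<noteq> 0 \<and> w = scal c v)"
proof
  assume "proj_class v = proj_class w"
  moreover have "w \<in> proj_class w" unfolding proj_class_def by (rule CollectI, rule exI[of _ 1]) simp
  ultimately show "\<exists>c. c \<noteq> 0 \<and> w = scal c v" by (auto simp: proj_class_def)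
next
  assume "\<exists>c. c \<noteq> 0 \<and> w = scal c v"
  then obtain c where c: "c \<noteq> 0" "w = scal c v" by auto
  show "proj_class v = proj_class w"
  proof (intro equalityI subsetI)
    fix x assume "x \<in> proj_class v"
    then obtain d where "d \<noteq> 0" "x = scal d v" by (auto simp: proj_class_def)
    then have "x = scal (d / c) w" "d / c \<noteq> 0" using c by simp_all
    then show "x \<in> proj_class w" by (auto simp: proj_class_def)
  next
    fix x assume "x \<in> proj_class w"
    then obtain d where "d \<noteq> 0" "x = scal d w" by (auto simp: proj_class_def)
    then have "x = scal (d * c) v" "d * c \<noteq> 0" using c by simp_all
    then show "x \<in> proj_class v" by (auto simp: proj_class_def)
  qed
qed

lemma inc_proj_class: "inc (proj_class v) (proj_class w) \<longleftrightarrow> dot3 v w = 0"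
proof
  assume "inc (proj_class v) (proj_class w)"
  moreover have "x \<in> proj_class x" for x :: "'a vec3"
    unfolding proj_class_def by (rule CollectI, rule exI[of _ 1]) simp
  ultimately show "dot3 v w = 0" unfolding inc_def by blast
qed (auto simp: inc_def proj_class_def)

lemma inc_commute: "inc X L \<longleftrightarrow> inc L X"
  by (auto simp: inc_def dot3_commute)

lemma pg_elemsE:
  assumes "X \<in> pg_elems"
  obtains v where "v \<noteq> 0" "X = proj_class v"
  using assms by (auto simp: pg_elems_def vec3_zero)

lemma proj_class_in_pg_elems: "v \<noteq> 0 \<Longrightarrow> proj_class v \<in> pg_elems"
  unfolding pg_elems_def vec3_zero by blast

lemma finite_pg_elems [simp]: "finite (A :: 'a::{finite,field} vec3 set set)"
  by (rule finite_subset[of _ UNIV]) auto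

section \<open>Joins and meets by the vector product\<close>

definition cross :: "'a::field vec3 \<Rightarrow> 'a vec3 \<Rightarrow> 'a vec3" where
  "cross v w = (fst (snd v) * snd (snd w) - snd (snd v) * fst (snd w),
     snd (snd v) * fst w - fst v * snd (snd w), fst v * fst (snd w) - fst (snd v) * fst w)"

lemma dot3_cross [simp]: "dot3 v (cross v w) = 0" "dot3 w (cross v w) = 0"
  by (simp_all add: cross_def dot3_def algebra_simps)

text \<open>The triple product expansion. It shows that a vector l orthogonal to v and w has zero
  product with \<open>cross v w\<close>, hence is proportional to it: this is the uniqueness of
  joins.\<close>

lemma cross_cross: "cross l (cross v w) = scal (dot3 l w) v + scal (- dot3 l v) w"
  by (simp add: vec3_eq_iff cross_def dot3_def algebra_simps)

lemma cross_eq_0D: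
  assumes "cross v w = 0" "v \<noteq> 0"
  shows "\<exists>c. w = scal c v"
proof -
  obtain v1 v2 v3 where v: "v = (v1, v2, v3)" by (cases v) auto
  obtain w1 w2 w3 where w: "w = (w1, w2, w3)" by (cases w) auto
  have eq: "v2 * w3 = v3 * w2" "v3 * w1 = v1 * w3" "v1 * w2 = v2 * w1"
    using assms(1) by (auto simp: v w cross_def vec3_eq_iff)
  consider "v1 \<noteq> 0" | "v2 \<noteq> 0" | "v3 \<noteq> 0" using assms(2) by (auto simp: v vec3_eq_iff)
  then show ?thesis
  proof cases
    case 1
    then show ?thesis using eq by (intro exI[of _ "w1 / v1"]) (auto simp: v w scal_def field_simps)
  next
    case 2
    then show ?thesis using eq by (intro exI[of _ "w2 / v2"]) (auto simp: v w scal_def field_simps)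
  next
    case 3
    then show ?thesis using eq by (intro exI[of _ "w3 / v3"]) (auto simp: v w scal_def field_simps)
  qed
qed

lemma cross_nonzero:
  assumes "proj_class v \<noteq> proj_class w" "v \<noteq> 0" "w \<noteq> 0"
  shows "cross v w \<noteq> 0"
proof
  assume "cross v w = 0"
  then obtain c where "w = scal c v" using cross_eq_0D assms(2) by blast
  then show False using assms by (auto simp: proj_class_eq_iff)
qed

lemma ex_join:
  assumes "X \<in> pg_elems" "Y \<in> pg_elems" "X \<noteq> Y"
  shows "\<exists>L\<in>pg_elems. inc X L \<and> inc Y L"
proof -
  obtain v w where vw: "v \<noteq> 0" "X = proj_class v" "w \<noteq> 0" "Y = proj_class w"
    using assms pg_elemsE by metis
  have "cross v w \<noteq> 0" using cross_nonzero vw assms by blast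
  then show ?thesis
    using vw by (intro bexI[of _ "proj_class (cross v w)"]) (auto simp: inc_proj_class proj_class_in_pg_elems)
qed

lemma join_unique:
  assumes "X \<in> pg_elems" "Y \<in> pg_elems" "X \<noteq> Y" "L \<in> pg_elems" "M \<in> pg_elems"
    "inc X L" "inc Y L" "inc X M" "inc Y M"
  shows "L = M"
proof -
  obtain v w where vw: "v \<noteq> 0" "X = proj_class v" "w \<noteq> 0" "Y = proj_class w"
    using assms pg_elemsE by metis
  have nz: "cross v w \<noteq> 0" using cross_nonzero vw assms by blast
  have *: "K = proj_class (cross v w)" if K: "K \<in> pg_elems" "inc X K" "inc Y K" for K
  proof -
    obtain l where l: "l \<noteq> 0" "K = proj_class l" using pg_elemsE[OF K(1)] by blast
    have "dot3 v l = 0" "dot3 w l = 0" using K vw(2,4) l(2) by (simp_all add: inc_proj_class)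
    then have "dot3 l v = 0" "dot3 l w = 0" by (simp_all add: dot3_commute)
    then have "cross l (cross v w) = 0" by (simp add: cross_cross)
    then obtain c where "cross v w = scal c l" using cross_eq_0D l by blast
    then show ?thesis using nz l by (auto simp: proj_class_eq_iff)
  qed
  show ?thesis using *[of L] *[of M] assms by simp
qed

text \<open>The equation is solved for a coordinate in which v is nonzero; the other two coordinates
  serve as parameters.\<close>

lemma perp_basis:
  fixes v :: "'a::field vec3"
  assumes "v \<noteq> 0"
  shows "\<exists>u w. dot3 v u = 0 \<and> dot3 v w = 0
    \<and> (\<forall>l. dot3 v l = 0 \<longrightarrow> (\<exists>a b. l = scal a u + scal b w))
    \<and> (\<forall>a b. scal a u + scal b w = 0 \<longrightarrow> a = 0 \<and> b = 0)"
proof -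
  obtain v1 v2 v3 where v: "v = (v1, v2, v3)" by (cases v) auto
  consider "v1 \<noteq> 0" | "v2 \<noteq> 0" | "v3 \<noteq> 0" using assms by (auto simp: v vec3_eq_iff)
  then show ?thesis
  proof cases
    case 1
    have "l = scal (fst (snd l)) (- v2 / v1, 1, 0) + scal (snd (snd l)) (- v3 / v1, 0, 1)"
      if "dot3 v l = 0" for l
    proof -
      have "v1 * fst l = - (v2 * fst (snd l)) - v3 * snd (snd l)"
        using that by (simp add: v dot3_def eq_neg_iff_add_eq_0 algebra_simps)
      then have "fst l = (- (v2 * fst (snd l)) - v3 * snd (snd l)) / v1" using 1 by (metis nonzero_mult_div_cancel_left)
      then show ?thesis by (simp add: vec3_eq_iff diff_divide_distrib mult.commute)
    qed
    then show ?thesis using 1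
      by (intro exI[of _ "(- v2 / v1, 1, 0)"] exI[of _ "(- v3 / v1, 0, 1)"])
        (auto simp: v dot3_def vec3_eq_iff)
  next
    case 2
    have "l = scal (fst l) (1, - v1 / v2, 0) + scal (snd (snd l)) (0, - v3 / v2, 1)"
      if "dot3 v l = 0" for l
    proof -
      have "v2 * fst (snd l) = - (v1 * fst l) - v3 * snd (snd l)"
        using that by (simp add: v dot3_def eq_neg_iff_add_eq_0 algebra_simps)
      then have "fst (snd l) = (- (v1 * fst l) - v3 * snd (snd l)) / v2" using 2 by (metis nonzero_mult_div_cancel_left)
      then show ?thesis by (simp add: vec3_eq_iff diff_divide_distrib mult.commute)
    qed
    then show ?thesis using 2
      by (intro exI[of _ "(1, - v1 / v2, 0)"] exI[of _ "(0, - v3 / v2, 1)"])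
        (auto simp: v dot3_def vec3_eq_iff)
  next
    case 3
    have "l = scal (fst l) (1, 0, - v1 / v3) + scal (fst (snd l)) (0, 1, - v2 / v3)"
      if "dot3 v l = 0" for l
    proof -
      have "v3 * snd (snd l) = - (v1 * fst l) - v2 * fst (snd l)"
        using that by (simp add: v dot3_def eq_neg_iff_add_eq_0 algebra_simps)
      then have "snd (snd l) = (- (v1 * fst l) - v2 * fst (snd l)) / v3" using 3 by (metis nonzero_mult_div_cancel_left)
      then show ?thesis by (simp add: vec3_eq_iff diff_divide_distrib mult.commute)
    qed
    then show ?thesis using 3
      by (intro exI[of _ "(1, 0, - v1 / v3)"] exI[of _ "(0, 1, - v2 / v3)"])
        (auto simp: v dot3_def vec3_eq_iff)
  qed
qed

lemma onset_iff: "Y \<in> onset X \<longleftrightarrow> Y \<in> pg_elems \<and> inc X Y"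
  by (simp add: onset_def)

lemma card_onset:
  fixes X :: "'a::{finite,field} vec3 set"
  assumes "X \<in> pg_elems"
  shows "card (onset X) = CARD('a) + 1"
proof -
  obtain v where v: "v \<noteq> 0" "X = proj_class v" using assms pg_elemsE by metis
  obtain u w where uw: "dot3 v u = 0" "dot3 v w = 0"
    "\<And>l. dot3 v l = 0 \<Longrightarrow> \<exists>a b. l = scal a u + scal b w"
    "\<And>a b. scal a u + scal b w = 0 \<Longrightarrow> a = 0 \<and> b = 0"
    using perp_basis[OF v(1)] by blast
  have coords: "a = a' \<and> b = b'" if "scal a u + scal b w = scal a' u + scal b' w" for a b a' b'
  proof -
    have "scal (a - a') u + scal (b - b') w = 0"
      using that by (simp add: vec3_eq_iff algebra_simps)
    then show ?thesis using uw(4) by fastforce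
  qed
  let ?f = "\<lambda>a. proj_class (scal 1 u + scal a w)"
  have w0: "w \<noteq> 0" using uw(4)[of 0 1] by auto
  have f0: "scal 1 u + scal a w \<noteq> 0" for a using uw(4)[of 1 a] by auto
  have scal_dist: "scal c (scal a u + scal b w) = scal (c * a) u + scal (c * b) w" for a b c
    by (simp add: vec3_eq_iff algebra_simps)
  have inj: "inj ?f"
  proof (rule injI)
    fix a b assume "?f a = ?f b"
    then obtain c where "scal 1 u + scal b w = scal c (scal 1 u + scal a w)"
      unfolding proj_class_eq_iff by blast
    then have "scal 1 u + scal b w = scal (c * 1) u + scal (c * a) w" unfolding scal_dist .
    from coords[OF this] show "a = b" by auto
  qed
  have notin: "proj_class w \<notin> range ?f"
  proof
    assume "proj_class w \<in> range ?f"
    then obtain a where "proj_class w = ?f a" by auto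
    then obtain c where "scal 1 u + scal a w = scal c w" unfolding proj_class_eq_iff by auto
    then have "scal 1 u + scal a w = scal 0 u + scal c w" by simp
    from coords[OF this] show False by simp
  qed
  have "onset X = insert (proj_class w) (range ?f)"
  proof (intro equalityI subsetI)
    fix Y assume "Y \<in> onset X"
    then obtain l where l: "l \<noteq> 0" "Y = proj_class l" "dot3 v l = 0"
      unfolding onset_iff v using pg_elemsE by (metis inc_proj_class)
    obtain a b where ab: "l = scal a u + scal b w" using uw(3) l by blast
    show "Y \<in> insert (proj_class w) (range ?f)"
    proof (cases "a = 0")
      case True
      then have "l = scal b w" "b \<noteq> 0" using ab l(1) by auto
      then have "Y = proj_class w" unfolding l(2) by (metis proj_class_eq_iff)
      then show ?thesis by simp
    next
      case False
      then have "l = scal a (scal 1 u + scal (b / a) w)" unfolding scal_dist ab by simp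
      then have "?f (b / a) = Y" unfolding l(2) proj_class_eq_iff using False by blast
      then show ?thesis by blast
    qed
  next
    fix Y assume "Y \<in> insert (proj_class w) (range ?f)"
    then show "Y \<in> onset X"
      using uw w0 f0 by (auto simp: onset_iff v proj_class_in_pg_elems inc_proj_class dot3_add simp del: scal_one)
  qed
  then show ?thesis using notin inj by (simp add: card_image)
qed

section \<open>The theorems of Jamison and Redei\<close>

lemma two_le_card_field: "2 \<le> CARD('a::{finite,field})"
  using card_mono[of "UNIV :: 'a set" "{0, 1}"] by simp

lemma degree_monom_diff: "degree P < n \<Longrightarrow> degree (monom (1::'a::field) n - P) = n"
  using degree_add_eq_left[of "- P" "monom 1 n"] by (simp add: degree_monom_eq)

text \<open>Replacing x by c x multiplies the sum by c^s, and some nonzero c has c^s different from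
  1 because X^s - 1 has at most s < q - 1 roots. For s = 0 every summand is 1, also at x = 0, and
  the sum is q = 0 in the field.\<close>

lemma sum_power_eq_0:
  assumes "s < CARD('a) - 1"
  shows "(\<Sum>x\<in>(UNIV::'a::{finite,field} set). x ^ s) = 0"
proof (cases "s = 0")
  case True
  have "(\<Sum>x\<in>(UNIV::'a set). x + 1) = (\<Sum>x\<in>(UNIV::'a set). x)"
    by (rule sum.reindex_bij_witness[of _ "\<lambda>x. x - 1" "\<lambda>x. x + 1"]) auto
  then show ?thesis using True by (simp add: sum.distrib)
next
  case False
  have "\<exists>c::'a. c \<noteq> 0 \<and> c ^ s \<noteq> 1"
  proof (rule ccontr)
    assume "\<not> ?thesis"
    then have 1: "c ^ s = 1" if "c \<noteq> 0" for c :: 'a using that by blast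
    have deg: "degree (monom (1::'a) s - 1) = s"
      using False by (intro degree_monom_diff) simp
    have nz: "monom (1::'a) s - 1 \<noteq> 0" using deg False by auto
    have "card (UNIV - {0::'a}) \<le> s"
      by (rule card_roots_le[OF nz]) (use 1 deg in \<open>auto simp: poly_monom\<close>)
    then show False using assms by simp
  qed
  then obtain c :: 'a where c: "c \<noteq> 0" "c ^ s \<noteq> 1" by blast
  have "(\<Sum>x\<in>(UNIV::'a set). (c * x) ^ s) = (\<Sum>x\<in>(UNIV::'a set). x ^ s)"
    by (rule sum.reindex_bij_witness[of _ "\<lambda>x. x / c" "\<lambda>x. c * x"]) (use c in auto)
  then have "c ^ s * (\<Sum>x\<in>(UNIV::'a set). x ^ s) = 1 * (\<Sum>x\<in>(UNIV::'a set). x ^ s)"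
    by (simp add: power_mult_distrib sum_distrib_left)
  then show ?thesis using c by (metis mult_right_cancel)
qed

text \<open>Expanding the product gives monomials of total degree below 2 (q - 1), so in each of
  them one exponent is below q - 1 and the corresponding power sum vanishes. The exponents s and t
  record the monomial already extracted during the induction.\<close>

lemma sum_linear_products_eq_0:
  fixes a b c :: "'i \<Rightarrow> 'a::{finite,field}"
  assumes "finite I" "s + t + card I < 2 * (CARD('a) - 1)"
  shows "(\<Sum>x\<in>UNIV. \<Sum>y\<in>UNIV. x ^ s * y ^ t * (\<Prod>i\<in>I. a i * x + b i * y + c i)) = 0"
  using assms
proof (induction I arbitrary: s t rule: finite_induct)
  case empty
  have "(\<Sum>x\<in>(UNIV::'a set). \<Sum>y\<in>(UNIV::'a set). x ^ s * y ^ t)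
      = (\<Sum>x\<in>(UNIV::'a set). x ^ s) * (\<Sum>y\<in>(UNIV::'a set). y ^ t)"
    by (simp add: sum_product)
  moreover have "s < CARD('a) - 1 \<or> t < CARD('a) - 1" using empty by auto
  ultimately show ?case using sum_power_eq_0 by auto
next
  case (insert j I)
  let ?P = "\<lambda>x y. \<Prod>i\<in>I. a i * x + b i * y + c i"
  have "(\<Sum>x\<in>UNIV. \<Sum>y\<in>UNIV. x ^ s * y ^ t * (\<Prod>i\<in>insert j I. a i * x + b i * y + c i))
    = a j * (\<Sum>x\<in>UNIV. \<Sum>y\<in>UNIV. x ^ Suc s * y ^ t * ?P x y)
    + b j * (\<Sum>x\<in>UNIV. \<Sum>y\<in>UNIV. x ^ s * y ^ Suc t * ?P x y)
    + c j * (\<Sum>x\<in>UNIV. \<Sum>y\<in>UNIV. x ^ s * y ^ t * ?P x y)"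
    using insert.hyps by (simp add: sum_distrib_left sum.distrib[symmetric] algebra_simps)
  also have "\<dots> = 0"
    using insert.IH[of "Suc s" t] insert.IH[of s "Suc t"] insert.IH[of s t] insert.prems insert.hyps by simp
  finally show ?case .
qed

definition rep :: "'a::{finite,field} vec3 set \<Rightarrow> 'a vec3" where
  "rep X = (SOME v. v \<noteq> 0 \<and> X = proj_class v)"

lemma rep:
  assumes "X \<in> pg_elems"
  shows "rep X \<noteq> 0 \<and> proj_class (rep X) = X"
proof -
  have "\<exists>v. v \<noteq> 0 \<and> X = proj_class v" using assms pg_elemsE by blast
  from someI_ex[OF this] show ?thesis unfolding rep_def by simp
qed

lemma inc_rep: "X \<in> pg_elems \<Longrightarrow> L \<in> pg_elems \<Longrightarrow> inc X L \<longleftrightarrow> dot3 (rep X) (rep L) = 0"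
  using rep inc_proj_class by metis

lemma inc_proj_class_rep: "L \<in> pg_elems \<Longrightarrow> inc (proj_class v) L \<longleftrightarrow> dot3 v (rep L) = 0"
  using rep inc_proj_class by metis

text \<open>In affine coordinates with origin O', the product of the linear forms of the lines in S vanishes
  everywhere except at the origin, so its sum over the plane is nonzero.\<close>

lemma jamison:
  fixes O' m :: "'a::{finite,field} vec3 set"
  assumes "O' \<in> pg_elems" "m \<in> pg_elems" "\<not> inc O' m" "S \<subseteq> pg_elems"
    and notO: "\<And>L. L \<in> S \<Longrightarrow> \<not> inc O' L"
    and cover: "\<And>X. X \<in> pg_elems \<Longrightarrow> X \<noteq> O' \<Longrightarrow> \<not> inc X m \<Longrightarrow> \<exists>L\<in>S. inc X L"
  shows "2 * (CARD('a) - 1) \<le> card S"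
proof (rule ccontr)
  assume "\<not> ?thesis"
  then have small: "0 + 0 + card S < 2 * (CARD('a) - 1)" by simp
  define p w where "p = rep O'" and "w = rep m"
  have pw: "dot3 w p \<noteq> 0" "w \<noteq> 0" "proj_class p = O'" "proj_class w = m"
    using assms(1-3) rep[of O'] rep[of m] inc_rep[of O' m] dot3_commute[of w p] unfolding p_def w_def by metis+
  obtain u1 u2 where u: "dot3 w u1 = 0" "dot3 w u2 = 0"
    "\<And>a b. scal a u1 + scal b u2 = 0 \<Longrightarrow> a = 0 \<and> b = 0"
    using perp_basis[OF pw(2)] by blast
  let ?P = "\<lambda>x y. \<Prod>L\<in>S. dot3 u1 (rep L) * x + dot3 u2 (rep L) * y + dot3 p (rep L)"
  have "(\<Sum>x\<in>UNIV. \<Sum>y\<in>UNIV. x ^ 0 * y ^ 0 * ?P x y) = 0"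
    by (rule sum_linear_products_eq_0[OF _ small]) simp
  then have zero: "(\<Sum>x\<in>UNIV. \<Sum>y\<in>UNIV. ?P x y) = 0" by simp
  have vanish: "?P x y = 0" if "(x, y) \<noteq> (0, 0)" for x y
  proof -
    \<comment> \<open>These vectors represent points off m, and \<open>O'\<close> only for x = y =
      0.\<close>
    define v where "v = p + (scal x u1 + scal y u2)"
    have wv: "dot3 w v = dot3 w p" using u by (simp add: v_def dot3_add)
    have v0: "v \<noteq> 0" using wv pw by auto
    have "\<not> inc (proj_class v) m"
      using pw wv by (metis inc_proj_class dot3_commute)
    moreover have "proj_class v \<noteq> O'"
    proof
      assume "proj_class v = O'"
      then obtain c where c: "v = scal c p" using pw proj_class_eq_iff by metis
      then have "dot3 w p = c * dot3 w p" using wv by simp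
      then have "c = 1" using pw(1) by simp
      then have "scal x u1 + scal y u2 = 0" using c by (simp add: v_def)
      then show False using u(3) that by auto
    qed
    ultimately obtain L where "L \<in> S" "inc (proj_class v) L"
      using cover v0 proj_class_in_pg_elems by blast
    then have "L \<in> S" "dot3 v (rep L) = 0" using assms(4) inc_proj_class_rep[of L v] by blast+
    then have "dot3 u1 (rep L) * x + dot3 u2 (rep L) * y + dot3 p (rep L) = 0"
      by (simp add: v_def dot3_add algebra_simps)
    with \<open>L \<in> S\<close> show ?thesis by (intro prod_zero) auto
  qed
  have "(\<Sum>y\<in>UNIV. ?P x y) = (if x = 0 then ?P 0 0 else 0)" for x
  proof (cases "x = 0")
    case True
    have "(\<Sum>y\<in>UNIV. ?P 0 y) = (\<Sum>y\<in>{0}. ?P 0 y)"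
    proof (rule sum.mono_neutral_right)
      show "\<forall>y\<in>UNIV - {0}. ?P 0 y = 0" using vanish by blast
    qed auto
    then show ?thesis using True by simp
  qed (use vanish in \<open>simp add: sum.neutral\<close>)
  then have "(\<Sum>x\<in>UNIV. \<Sum>y\<in>UNIV. ?P x y) = ?P 0 0" by simp
  moreover have "?P 0 0 \<noteq> 0"
    using notO assms(1,4) by (auto simp: p_def inc_rep[symmetric] subset_iff)
  ultimately show False using zero by simp
qed

text \<open>The product is a Redei polynomial in T with coefficients in y. Up to sign the
  coefficient of T^j is an elementary symmetric function of the b i + a i y; its degree in y is
  therefore at most |A| - j, and its coefficient in that degree comes from the terms a i y
  alone.\<close>

lemma coeff_prod_linear:
  fixes a b :: "'i \<Rightarrow> 'a::field"
  assumes "finite A"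
  shows "degree (coeff (\<Prod>i\<in>A. [:- [:b i, a i:], 1:]) j) \<le> card A - j
    \<and> coeff (coeff (\<Prod>i\<in>A. [:- [:b i, a i:], 1:]) j) (card A - j) = coeff (\<Prod>i\<in>A. [:- a i, 1:]) j"
  using assms
proof (induction A arbitrary: j rule: finite_induct)
  case empty
  then show ?case by (cases j) (auto simp: coeff_1)
next
  case (insert k A)
  let ?P = "\<Prod>i\<in>A. [:- [:b i, a i:], 1:]" and ?p = "\<Prod>i\<in>A. [:- a i, 1:]"
  have deg: "degree (coeff ?P j) \<le> card A - j" "coeff (coeff ?P j) (card A - j) = coeff ?p j" for j
    using insert.IH by auto
  have degP: "degree ?P \<le> card A"
    by (rule order.trans[OF degree_prod_sum_le]) (use insert in auto)
  have degp: "degree ?p \<le> card A"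
    by (rule order.trans[OF degree_prod_sum_le]) (use insert in auto)
  have c: "card (insert k A) = Suc (card A)" using insert by simp
  have eqP: "coeff (\<Prod>i\<in>insert k A. [:- [:b i, a i:], 1:]) j
      = (if j = 0 then 0 else coeff ?P (j - 1)) - [:b k, a k:] * coeff ?P j"
    using insert.hyps by (simp add: coeff_pCons split: nat.splits)
  have eqp: "coeff (\<Prod>i\<in>insert k A. [:- a i, 1:]) j
      = (if j = 0 then 0 else coeff ?p (j - 1)) - a k * coeff ?p j"
    using insert.hyps by (simp add: coeff_pCons split: nat.splits)
  show ?case
  proof (cases "j \<le> card A")
    case True
    have "degree ([:b k, a k:] * coeff ?P j) \<le> degree [:b k, a k:] + degree (coeff ?P j)"
      by (rule degree_mult_le)
    also have "\<dots> \<le> 1 + (card A - j)" using deg(1)[of j] by (intro add_mono) auto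
    finally have d1: "degree ([:b k, a k:] * coeff ?P j) \<le> Suc (card A) - j" using True by simp
    have d2: "degree (if j = 0 then 0 else coeff ?P (j - 1)) \<le> Suc (card A) - j"
      using deg(1)[of "j - 1"] by (cases j) auto
    have "coeff (coeff ?P j) (Suc (card A) - j) = 0"
      using deg(1)[of j] True by (intro coeff_eq_0) simp
    then have "coeff ([:b k, a k:] * coeff ?P j) (Suc (card A) - j) = a k * coeff ?p j"
      using deg(2)[of j] True by (simp add: Suc_diff_le)
    moreover have "coeff (if j = 0 then 0 else coeff ?P (j - 1)) (Suc (card A) - j)
        = (if j = 0 then 0 else coeff ?p (j - 1))"
      using deg(2)[of "j - 1"] by (cases j) auto
    ultimately show ?thesis
      unfolding c eqP eqp coeff_diff using degree_diff_le[OF d2 d1] by presburger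
  next
    case False
    have z: "coeff ?P j = 0" "coeff ?p j = 0" using False degP degp by (auto intro!: coeff_eq_0)
    from False obtain j' where j': "j = Suc j'" "card A \<le> j'" by (cases j) auto
    show ?thesis unfolding c eqP eqp z using deg[of j'] j' by simp
  qed
qed

lemma poly_eq_const_of_values:
  fixes P :: "'a::{finite,field} poly"
  assumes "degree P < CARD('a)" "\<And>y. poly P y = c"
  shows "P = [:c:]"
proof (rule ccontr)
  assume "P \<noteq> [:c:]"
  then have "P - [:c:] \<noteq> 0" by simp
  then have "card (UNIV :: 'a set) \<le> degree P"
    by (rule card_roots_le) (use assms in \<open>auto intro: degree_diff_le\<close>)
  then show False using assms by simp
qed

text \<open>The remainder modulo X^q - X still vanishes on the whole field but has degree below
  q.\<close>

lemma vanishing_factor: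
  fixes P :: "'a::{finite,field} poly"
  assumes "\<And>t. poly P t = 0"
  shows "\<exists>S. P = (monom 1 (CARD('a)) - monom 1 1) * S"
proof -
  let ?q = "CARD('a)"
  let ?V = "monom (1::'a) ?q - monom 1 1"
  have q2: "?q > 1" using two_le_card_field[where 'a='a] by linarith
  have degV: "degree ?V = ?q" using q2 by (intro degree_monom_diff) (simp add: degree_monom_eq)
  have V0: "?V \<noteq> 0" using degV q2 by auto
  have van: "poly ?V t = 0" for t by (simp add: poly_monom power_card_eq_self)
  have "P mod ?V = 0"
  proof (rule ccontr)
    assume nz: "P mod ?V \<noteq> 0"
    have "poly (P mod ?V) t = 0" for t
    proof -
      have "poly P t = poly (P div ?V * ?V + P mod ?V) t" by (simp only: div_mult_mod_eq)
      also have "\<dots> = poly (P mod ?V) t" by (simp only: poly_add poly_mult van) simp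
      finally show ?thesis using assms by simp
    qed
    then have "card (UNIV :: 'a set) \<le> degree (P mod ?V)" by (intro card_roots_le[OF nz]) auto
    moreover have "degree (P mod ?V) < ?q" using degree_mod_less[OF V0, of P] nz degV by auto
    ultimately show False by simp
  qed
  then show ?thesis by (metis div_mult_mod_eq add.right_neutral mult.commute)
qed

text \<open>Redei's argument: the coefficient of T^j in the product of the factors T - (y a_i + b_i) is a polynomial
  in y of degree at most |A| - j, which for the exponents in question is constant on the field.\<close>

lemma redei_coeffs:
  fixes a b :: "'i \<Rightarrow> 'a::{finite,field}"
  assumes fin: "finite A" and block: "\<And>t y. \<exists>i\<in>A. t = y * a i + b i"
    and card_A: "card A = CARD('a) + K"
    and j: "K < j" "j < CARD('a)"
  shows "coeff (\<Prod>i\<in>A. [:- a i, 1:]) j = 0"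
proof -
  let ?q = "CARD('a)"
  let ?PP = "\<Prod>i\<in>A. [:- [:b i, a i:], 1:]"
  \<comment> \<open>For fixed y the product equals (T^q - T) S with S monic of degree K. For K < j <
    q only -T S contributes to T^j; it gives minus the coefficient of S at j - 1, which is the
    leading one exactly for j = K + 1.\<close>
  define c :: 'a where "c = (if j = Suc K then - 1 else 0)"
  have "poly (coeff ?PP j) y = c" for y
  proof -
    define P where "P = (\<Prod>i\<in>A. [:- (y * a i + b i), 1:])"
    have "map_poly (\<lambda>c. poly c y) (\<Prod>i\<in>B. [:- [:b i, a i:], 1:]) = (\<Prod>i\<in>B. [:- (y * a i + b i), 1:])"
      if "finite B" for B
      using that
    proof (induction B rule: finite_induct)
      case (insert k B)
      have "map_poly (\<lambda>c. poly c y) ([:- [:b k, a k:], 1:] * R)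
          = [:- (y * a k + b k), 1:] * map_poly (\<lambda>c. poly c y) R" for R :: "'a poly poly"
        by (rule poly_eqI) (auto simp: coeff_map_poly coeff_pCons algebra_simps split: nat.splits)
      then show ?case using insert by (simp del: mult_pCons_left)
    qed simp
    from this[OF fin] have "coeff P j = coeff (map_poly (\<lambda>c. poly c y) ?PP) j" by (simp add: P_def)
    then have cP: "coeff P j = poly (coeff ?PP j) y" by (simp add: coeff_map_poly)
    have "poly P t = 0" for t
    proof -
      obtain i where "i \<in> A" "t = y * a i + b i" using block by blast
      then show ?thesis unfolding P_def poly_prod by (intro prod_zero[OF fin] bexI[of _ i]) auto
    qed
    then obtain S where S: "P = (monom 1 ?q - monom 1 1) * S" using vanishing_factor by blast
    have lcP: "lead_coeff P = 1" by (simp add: P_def lead_coeff_prod)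
    have degP: "degree P = ?q + K"
      unfolding P_def card_A[symmetric] using fin by (subst degree_prod_sum_eq) auto
    have q1: "?q > 1" using j by simp
    have degV: "degree (monom (1::'a) ?q - monom 1 1) = ?q"
      using q1 by (intro degree_monom_diff) (simp add: degree_monom_eq)
    have "P \<noteq> 0" using lcP by auto
    then have "S \<noteq> 0" "monom (1::'a) ?q - monom 1 1 \<noteq> 0" using S by auto
    then have "degree P = ?q + degree S" unfolding S by (subst degree_mult_eq) (simp_all only: degV not_False_eq_True)
    then have degS: "degree S = K" using degP by simp
    have "lead_coeff P = lead_coeff (monom (1::'a) ?q - monom 1 1) * lead_coeff S"
      unfolding S by (rule lead_coeff_mult)
    moreover have "lead_coeff (monom (1::'a) ?q - monom 1 1) = 1" unfolding degV using q1 by simp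
    ultimately have lcS: "coeff S K = 1" using lcP degS by simp
    have "coeff P j = - coeff S (j - 1)"
      unfolding S left_diff_distrib coeff_diff coeff_monom_mult using j by simp
    also have "\<dots> = c"
      using lcS j degS by (auto simp: c_def coeff_eq_0)
    finally show ?thesis using cP by simp
  qed
  moreover have "degree (coeff ?PP j) < ?q"
  proof -
    have "degree (coeff ?PP j) \<le> card A - j" using coeff_prod_linear[OF fin] by blast
    then show ?thesis using j card_A by linarith
  qed
  ultimately have "coeff ?PP j = [:c:]" by (intro poly_eq_const_of_values) auto
  moreover have "coeff (coeff ?PP j) (card A - j) = coeff (\<Prod>i\<in>A. [:- a i, 1:]) j"
    using coeff_prod_linear[OF fin] by blast
  moreover have "card A - j > 0" using j card_A by simp
  ultimately show ?thesis by (simp add: coeff_eq_0)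
qed

text \<open>R is the point at infinity of the vertical lines and l the line at infinity; the multiplicity m a counts
  the affine points of B on the vertical line with abscissa a.\<close>

lemma tangent_multiplicities:
  fixes B :: "'a::{finite,field} vec3 set set"
  assumes B: "blocking_set B" and R: "R \<in> B" and l: "l \<in> pg_elems" and tangent: "B \<inter> onset l = {R}"
    and K: "card B = CARD('a) + K + 1" "K < CARD('a)"
  shows "\<exists>m (line :: 'a \<Rightarrow> 'a vec3 set) g h. inj line \<and> range line \<subseteq> onset R
    \<and> (\<forall>a. card (B \<inter> onset (line a)) = m a + 1)
    \<and> linear_prod m = monom 1 (CARD('a)) * g + h
    \<and> lead_coeff g = 1 \<and> degree g = K \<and> degree h \<le> K"
proof -
  let ?q = "CARD('a)"
  have Bpg: "B \<subseteq> pg_elems" and blockB: "\<And>L. L \<in> pg_elems \<Longrightarrow> \<exists>X\<in>B. inc X L"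
    using B by (auto simp: blocking_set_def)
  have Rpg: "R \<in> pg_elems" using Bpg R by auto
  have Rl: "inc R l" using tangent by (auto simp: onset_def inc_commute)
  have "card (onset R) > 1" using card_onset[OF Rpg] by simp
  then obtain l' where l': "l' \<in> onset R" "l' \<noteq> l" 
    by (metis card.empty card.infinite is_singletonI' is_singleton_altdef less_irrefl not_less_zero)
  define e where "e = rep R"
  define w where "w = rep l"
  define \<alpha> where "\<alpha> = rep l'"
  have e: "e \<noteq> 0" "proj_class e = R" using rep[OF Rpg] by (auto simp: e_def)
  have w: "w \<noteq> 0" "proj_class w = l" using rep[OF l] by (auto simp: w_def)
  have l'pg: "l' \<in> pg_elems" using l' by (simp add: onset_iff)
  have \<alpha>: "\<alpha> \<noteq> 0" "proj_class \<alpha> = l'" using rep[OF l'pg] by (auto simp: \<alpha>_def)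
  have perp: "dot3 e w = 0" "dot3 e \<alpha> = 0"
    using Rl l' e w \<alpha> by (metis inc_proj_class, metis inc_proj_class onset_iff)
  have "\<exists>\<beta>. dot3 e \<beta> = 1"
  proof -
    consider "fst e \<noteq> 0" | "fst (snd e) \<noteq> 0" | "snd (snd e) \<noteq> 0" using e(1) by (auto simp: vec3_eq_iff)
    then show ?thesis
    proof cases
      case 1 then show ?thesis by (intro exI[of _ "(1 / fst e, 0, 0)"]) (simp add: dot3_def)
    next
      case 2 then show ?thesis by (intro exI[of _ "(0, 1 / fst (snd e), 0)"]) (simp add: dot3_def)
    next
      case 3 then show ?thesis by (intro exI[of _ "(0, 0, 1 / snd (snd e))"]) (simp add: dot3_def)
    qed
  qed
  then obtain \<beta> where \<beta>: "dot3 e \<beta> = 1" by blast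
  define A where "A = B - {R}"
  have Aw: "dot3 (rep X) w \<noteq> 0" if "X \<in> A" for X
  proof
    assume "dot3 (rep X) w = 0"
    moreover have X: "X \<in> pg_elems" using that Bpg by (auto simp: A_def)
    ultimately have "inc X l" using l by (simp add: inc_rep w_def)
    then have "X \<in> B \<inter> onset l" using that X by (auto simp: A_def onset_iff inc_commute)
    then show False using tangent that by (auto simp: A_def)
  qed
  define a where "a X = dot3 (rep X) \<alpha> / dot3 (rep X) w" for X
  define b where "b X = - (dot3 (rep X) \<beta> / dot3 (rep X) w)" for X
  have cardA: "card A = ?q + K" using K R by (simp add: A_def)
  \<comment> \<open>The line t w - y \<open>\<alpha>\<close> + \<open>\<beta>\<close> misses R
    because e has product 1 with \<open>\<beta>\<close>, so it contains a point X of A. Solving the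
    incidence for t gives t = y a X + b X; the denominators are nonzero because X is off the tangent
    l.\<close>
  have block: "\<exists>X\<in>A. t = y * a X + b X" for t y
  proof -
    define v where "v = scal t w + (scal (- y) \<alpha> + scal 1 \<beta>)"
    have "dot3 e v = 1" using perp \<beta> by (simp add: v_def dot3_add)
    then have v: "v \<noteq> 0" "\<not> inc R (proj_class v)" using e by (auto simp: inc_proj_class[of e v, simplified])
    obtain X where X: "X \<in> B" "inc X (proj_class v)"
      using blockB proj_class_in_pg_elems[OF v(1)] by blast
    then have XA: "X \<in> A" using v by (auto simp: A_def)
    have "X \<in> pg_elems" using X Bpg by auto
    then have "dot3 (rep X) v = 0" using X(2) inc_proj_class rep by metis
    then have "t * dot3 (rep X) w + ((- y) * dot3 (rep X) \<alpha> + 1 * dot3 (rep X) \<beta>) = 0"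
      by (simp only: v_def dot3_add dot3_scal)
    then have "t * dot3 (rep X) w = y * dot3 (rep X) \<alpha> - dot3 (rep X) \<beta>" by algebra
    then have "t = y * a X + b X" using Aw[OF XA] by (simp add: a_def b_def field_simps)
    then show ?thesis using XA by blast
  qed
  define m where "m c = card {X \<in> A. a X = c}" for c
  have prod_eq: "(\<Prod>X\<in>A. [:- a X, 1:]) = linear_prod m"
  proof -
    have "(\<Prod>X\<in>A. [:- a X, 1:]) = (\<Prod>c\<in>UNIV. \<Prod>X\<in>{X \<in> A. a X = c}. [:- a X, 1:])"
      by (subst prod.group) auto
    also have "\<dots> = linear_prod m" unfolding linear_prod_def m_def
      by (rule prod.cong) (auto simp: prod_constant[symmetric] intro!: prod.cong simp del: prod_constant)
    finally show ?thesis .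
  qed
  \<comment> \<open>In the pencil of R, spanned by w and \<open>\<alpha>\<close>, these are the
    lines other than l; a point X of A lies on the one for c exactly if a X = c.\<close>
  define line where "line c = proj_class (\<alpha> + scal (- c) w)" for c
  have indep: "\<alpha> \<noteq> scal c w" for c
  proof
    assume "\<alpha> = scal c w"
    moreover from this have "c \<noteq> 0" using \<alpha>(1) by auto
    ultimately have "proj_class w = proj_class \<alpha>" by (auto simp: proj_class_eq_iff)
    then show False using w \<alpha> l' by simp
  qed
  have nz: "\<alpha> + scal (- c) w \<noteq> 0" for c
  proof
    assume "\<alpha> + scal (- c) w = 0"
    then have "\<alpha> = scal c w" by (simp add: vec3_eq_iff)
    then show False using indep by simp
  qed
  have inj: "inj line"
  proof (rule injI)
    fix c d assume "line c = line d"
    then obtain k where k: "\<alpha> + scal (- d) w = scal k (\<alpha> + scal (- c) w)"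
      unfolding line_def proj_class_eq_iff by blast
    have "k = 1"
    proof (rule ccontr)
      assume "k \<noteq> 1"
      then have "\<alpha> = scal ((d - k * c) / (1 - k)) w"
        using k by (simp add: vec3_eq_iff field_simps) 
      then show False using indep by simp
    qed
    then have "scal (d - c) w = 0" using k by (auto simp: vec3_eq_iff algebra_simps)
    then show "c = d" using w by simp
  qed
  have lineR: "inc R (line c)" for c
    unfolding line_def e(2)[symmetric] inc_proj_class using perp by (simp add: dot3_add)
  have linepg: "line c \<in> pg_elems" for c using nz by (auto simp: line_def proj_class_in_pg_elems)
  have card_line: "card (B \<inter> onset (line c)) = m c + 1" for c
  proof -
    have "inc X (line c) \<longleftrightarrow> a X = c" if "X \<in> A" for X
    proof -
      have "X \<in> pg_elems" using that Bpg by (auto simp: A_def)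
      then have "inc X (line c) \<longleftrightarrow> dot3 (rep X) (\<alpha> + scal (- c) w) = 0"
        unfolding line_def using rep inc_proj_class by metis
      also have "\<dots> \<longleftrightarrow> a X = c" using Aw[OF that] by (auto simp: dot3_add a_def field_simps)
      finally show ?thesis .
    qed
    note inc_line = this
    have "X \<in> B \<inter> onset (line c) \<longleftrightarrow> X \<in> insert R {X \<in> A. a X = c}" for X
    proof (cases "X = R")
      case True
      then show ?thesis using R Rpg lineR[of c] by (simp add: onset_iff inc_commute)
    next
      case False
      then have XA: "X \<in> A \<longleftrightarrow> X \<in> B" by (simp add: A_def)
      show ?thesis
      proof (cases "X \<in> B")
        case True
        then show ?thesis
          using inc_line[of X] XA False Bpg inc_commute[of X "line c"] by (simp add: onset_iff subsetD)
      qed (use XA False in simp)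
    qed
    then have "B \<inter> onset (line c) = insert R {X \<in> A. a X = c}" by (rule set_eqI)
    moreover have "R \<notin> {X \<in> A. a X = c}" by (simp add: A_def)
    ultimately show ?thesis by (simp add: m_def)
  qed
  have deg: "degree (linear_prod m) = ?q + K"
    unfolding prod_eq[symmetric] cardA[symmetric] by (subst degree_prod_sum_eq) auto
  define g where "g = poly_shift ?q (linear_prod m)"
  define h where "h = poly_cutoff ?q (linear_prod m)"
  have 1: "linear_prod m = monom 1 ?q * g + h"
    by (rule poly_eqI) (auto simp: g_def h_def coeff_poly_shift coeff_poly_cutoff coeff_monom_mult)
  have dg: "degree g \<le> K"
    by (rule degree_le) (auto simp: g_def coeff_poly_shift deg intro!: coeff_eq_0)
  have cg: "coeff g K = 1"
    using lead_coeff_linear_prod[of m] unfolding deg by (simp add: g_def coeff_poly_shift add.commute)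
  have 2: "degree g = K" using dg cg le_degree[of g K] by fastforce
  have 3: "degree h \<le> K"
  proof (rule degree_le, intro allI impI)
    fix j assume "K < j"
    then show "coeff h j = 0"
      using redei_coeffs[OF _ block cardA, of j] by (simp add: h_def coeff_poly_cutoff prod_eq)
  qed
  have "range line \<subseteq> onset R" using lineR linepg by (auto simp: onset_iff)
  then show ?thesis using inj card_line 1 2 3 cg by blast
qed

section \<open>Counting in a projective plane\<close>

text \<open>E serves both as point set and as line set, and I is symmetric, so every lemma can be
  read in the dual plane without a second proof. The last assumption is Jamison's theorem, the only
  one that goes beyond the incidence geometry of a finite plane.\<close>

locale incidence_plane =
  fixes E :: "'e set" and I :: "'e \<Rightarrow> 'e \<Rightarrow> bool" and q :: nat
  assumes finite_E: "finite E" and I_sym: "I X Y \<longleftrightarrow> I Y X"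
    and join: "X \<in> E \<Longrightarrow> Y \<in> E \<Longrightarrow> X \<noteq> Y \<Longrightarrow> \<exists>L\<in>E. I X L \<and> I Y L"
    and join_eq: "X \<in> E \<Longrightarrow> Y \<in> E \<Longrightarrow> X \<noteq> Y \<Longrightarrow> L \<in> E \<Longrightarrow> M \<in> E \<Longrightarrow>
      I X L \<Longrightarrow> I Y L \<Longrightarrow> I X M \<Longrightarrow> I Y M \<Longrightarrow> L = M"
    and card_lines: "X \<in> E \<Longrightarrow> card {Y \<in> E. I X Y} = q + 1"
    and q_ge_2: "q \<ge> 2"
    and jamison_bound: "P \<in> E \<Longrightarrow> m \<in> E \<Longrightarrow> \<not> I P m \<Longrightarrow> S \<subseteq> E \<Longrightarrow>
      (\<And>L. L \<in> S \<Longrightarrow> \<not> I P L) \<Longrightarrow> (\<And>X. X \<in> E \<Longrightarrow> X \<noteq> P \<Longrightarrow> \<not> I X m \<Longrightarrow> \<exists>L\<in>S. I X L) \<Longrightarrow>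
      2 * (q - 1) \<le> card S"
begin

definition st :: "'e \<Rightarrow> 'e set" where
  "st X = {Y \<in> E. I X Y}"

lemma st_iff: "Y \<in> st X \<longleftrightarrow> Y \<in> E \<and> I X Y"
  by (simp add: st_def)

lemma card_st: "X \<in> E \<Longrightarrow> card (st X) = q + 1"
  using card_lines by (simp add: st_def)

lemma st_subset: "st X \<subseteq> E"
  by (auto simp: st_def)

lemma finite_sub: "A \<subseteq> E \<Longrightarrow> finite A"
  using finite_E finite_subset by blast

lemma finite_st [simp]: "finite (st X)"
  using st_subset finite_sub by blast

lemma card_st_inter:
  assumes "X \<in> E" "Y \<in> E" "X \<noteq> Y"
  shows "card (st X \<inter> st Y) = 1"
proof -
  obtain L where L: "L \<in> E" "I X L" "I Y L" using join assms by blast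
  have "M = L" if "M \<in> st X \<inter> st Y" for M
    using join_eq[OF assms, of M L] that L by (simp add: st_iff)
  moreover have "L \<in> st X \<inter> st Y" using L by (simp add: st_iff)
  ultimately have "st X \<inter> st Y = {L}" by blast
  then show ?thesis by simp
qed

lemma card_pencil_partition:
  assumes "P \<in> E" "B \<subseteq> E"
  shows "(\<Sum>L\<in>st P. card ((B - {P}) \<inter> st L)) = card (B - {P})"
proof -
  have "card (\<Union>L\<in>st P. (B - {P}) \<inter> st L) = (\<Sum>L\<in>st P. card ((B - {P}) \<inter> st L))"
  proof (rule card_UN_disjoint)
    show "\<forall>L\<in>st P. \<forall>M\<in>st P. L \<noteq> M \<longrightarrow> (B - {P}) \<inter> st L \<inter> ((B - {P}) \<inter> st M) = {}"
    proof (intro ballI impI)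
      fix L M assume LM: "L \<in> st P" "M \<in> st P" "L \<noteq> M"
      have False if "X \<in> B" "X \<noteq> P" "X \<in> st L" "X \<in> st M" for X
        using join_eq[of X P L M] that LM assms I_sym by (auto simp: st_iff)
      then show "(B - {P}) \<inter> st L \<inter> ((B - {P}) \<inter> st M) = {}" by blast
    qed
  qed auto
  moreover have "(\<Union>L\<in>st P. (B - {P}) \<inter> st L) = B - {P}"
  proof (intro equalityI subsetI)
    fix X assume X: "X \<in> B - {P}"
    then obtain L where "L \<in> E" "I X L" "I P L" using join[of X P] assms by auto
    then have "L \<in> st P" "X \<in> st L" using X assms I_sym by (auto simp: st_iff)
    then show "X \<in> (\<Union>L\<in>st P. (B - {P}) \<inter> st L)" using X by blast
  qed auto
  ultimately show ?thesis by simp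
qed

lemma card_E:
  assumes "E \<noteq> {}"
  shows "card E = q * q + q + 1"
proof -
  obtain P where P: "P \<in> E" using assms by blast
  have "card ((E - {P}) \<inter> st L) = q" if "L \<in> st P" for L
  proof -
    have L: "L \<in> E" "P \<in> st L" using that P I_sym by (auto simp: st_iff)
    have "(E - {P}) \<inter> st L = st L - {P}" using st_subset by auto
    then show ?thesis using card_st[OF L(1)] L(2) by simp
  qed
  then have "card (E - {P}) = (q + 1) * q"
    using card_pencil_partition[OF P order_refl] card_st[OF P] by simp
  moreover have "card E = Suc (card (E - {P}))" using P finite_E by (metis card_Suc_Diff1)
  ultimately show ?thesis by (simp add: algebra_simps)
qed

text \<open>Double counting of the incident pairs (X, L) with X in B, weighted by f L.\<close>

lemma sum_card_lines:
  fixes f :: "'e \<Rightarrow> real"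
  assumes "B \<subseteq> E"
  shows "(\<Sum>L\<in>E. real (card (B \<inter> st L)) * f L) = (\<Sum>X\<in>B. \<Sum>L\<in>st X. f L)"
proof -
  have "(\<Sum>L\<in>E. real (card (B \<inter> st L)) * f L) = (\<Sum>L\<in>E. \<Sum>X\<in>{X\<in>B. X \<in> st L}. f L)"
  proof (rule sum.cong[OF refl])
    fix L
    have "{X\<in>B. X \<in> st L} = B \<inter> st L" by auto
    then show "real (card (B \<inter> st L)) * f L = (\<Sum>X\<in>{X\<in>B. X \<in> st L}. f L)" by simp
  qed
  also have "\<dots> = (\<Sum>X\<in>B. \<Sum>L\<in>{L\<in>E. X \<in> st L}. f L)"
    by (rule sum.swap_restrict) (use finite_sub[OF assms] finite_E in auto)
  also have "\<dots> = (\<Sum>X\<in>B. \<Sum>L\<in>st X. f L)"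
  proof (rule sum.cong[OF refl])
    fix X assume "X \<in> B"
    then have "{L\<in>E. X \<in> st L} = st X" using assms I_sym by (auto simp: st_iff)
    then show "(\<Sum>L\<in>{L\<in>E. X \<in> st L}. f L) = (\<Sum>L\<in>st X. f L)" by simp
  qed
  finally show ?thesis .
qed

lemma sum_line_sizes: "B \<subseteq> E \<Longrightarrow> (\<Sum>L\<in>E. real (card (B \<inter> st L))) = card B * (q + 1)"
  using sum_card_lines[of B "\<lambda>_. 1"] card_st by (simp add: subset_iff algebra_simps)

lemma sum_pencil_sizes:
  assumes "B \<subseteq> E" "X \<in> B"
  shows "(\<Sum>L\<in>st X. real (card (B \<inter> st L)) - 1) = real (card B) - 1"
proof -
  have X: "X \<in> E" using assms by auto
  have "card (B \<inter> st L) = Suc (card ((B - {X}) \<inter> st L))" if "L \<in> st X" for L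
  proof -
    have "B \<inter> st L = insert X ((B - {X}) \<inter> st L)"
      using assms that X I_sym by (auto simp: st_iff)
    then show ?thesis by simp
  qed
  then have "(\<Sum>L\<in>st X. real (card (B \<inter> st L)) - 1) = (\<Sum>L\<in>st X. real (card ((B - {X}) \<inter> st L)))"
    by simp
  also have "\<dots> = card (B - {X})" using card_pencil_partition[OF X assms(1)] by (simp flip: of_nat_sum)
  also have "card (B - {X}) = card B - 1" using assms finite_sub by (simp add: card_Diff_singleton)
  also have "card B \<ge> 1" using assms finite_sub[OF assms(1)] by (metis One_nat_def Suc_leI card_gt_0_iff empty_iff)
  then have "real (card B - 1) = real (card B) - 1" by (simp add: of_nat_diff)
  finally show ?thesis .
qed

text \<open>Counts ordered pairs of distinct points of B, each of which lies on exactly one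
  line.\<close>

lemma sum_line_sizes_squared:
  assumes "B \<subseteq> E"
  shows "(\<Sum>L\<in>E. real (card (B \<inter> st L)) * (real (card (B \<inter> st L)) - 1)) = card B * (real (card B) - 1)"
  unfolding sum_card_lines[OF assms] using sum_pencil_sizes[OF assms] by simp

lemma blocking_card_ge:
  assumes "B \<subseteq> E" "\<And>L. L \<in> E \<Longrightarrow> \<exists>X\<in>B. I X L" "P \<in> E" "P \<notin> B"
  shows "q + 1 \<le> card B"
proof -
  have "1 \<le> card ((B - {P}) \<inter> st L)" if "L \<in> st P" for L
  proof -
    have L: "L \<in> E" using that by (simp add: st_iff)
    then obtain X where "X \<in> B" "I X L" using assms(2) by blast
    then have "X \<in> (B - {P}) \<inter> st L" using assms I_sym L by (auto simp: st_iff)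
    then show ?thesis by (metis One_nat_def Suc_leI card_gt_0_iff empty_iff finite_Int finite_st)
  qed
  then have "(\<Sum>L\<in>st P. 1) \<le> (\<Sum>L\<in>st P. card ((B - {P}) \<inter> st L))" by (intro sum_mono) auto
  then show ?thesis using card_pencil_partition[OF assms(3,1)] card_st[OF assms(3)] assms(4) by simp
qed

lemma Collect_subset_st: "{L \<in> st R. \<phi> L} \<subseteq> st R"
  by blast

text \<open>With x denoting the number of points of B on a line, the sum of (x - 1)(x - 2) over all lines is determined
  by |B|, whereas the long lines alone contribute at least |B| r (r - 1).\<close>

lemma many_long_lines_imp_baer:
  assumes B: "B \<subseteq> E" "B \<noteq> {}" and block: "\<And>L. L \<in> E \<Longrightarrow> B \<inter> st L \<noteq> {}"
    and q: "q = r * r" "r \<ge> 4" and card_B: "card B = q + 1 + K" and K: "K ^ 3 < q ^ 2"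
    and long: "\<And>R. R \<in> B \<Longrightarrow> r + 1 \<le> card {L \<in> st R. r + 1 \<le> card (B \<inter> st L)}"
  shows "K = r
    \<and> (\<forall>R\<in>B. \<forall>L\<in>st R. card (B \<inter> st L) = 1 \<or> card (B \<inter> st L) = r + 1)
    \<and> (\<forall>R\<in>B. card {L \<in> st R. card (B \<inter> st L) = r + 1} = r + 1)"
proof -
  define x where "x L = real (card (B \<inter> st L))" for L
  have x1: "x L \<ge> 1" if "L \<in> E" for L
  proof -
    have "card (B \<inter> st L) \<noteq> 0" using block[OF that] by simp
    then have "1 \<le> card (B \<inter> st L)" by linarith
    then have "real 1 \<le> x L" unfolding x_def of_nat_le_iff .
    then show ?thesis by simp
  qed
  have long_sum1: "(\<Sum>L\<in>st R. x L - 1) \<ge> (\<Sum>L\<in>{L \<in> st R. r + 1 \<le> card (B \<inter> st L)}. x L - 1)" for R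
    by (rule sum_mono2) (use x1 st_subset in auto)
  have long_sum2: "(\<Sum>L\<in>{L \<in> st R. r + 1 \<le> card (B \<inter> st L)}. x L - 1)
      \<ge> (\<Sum>L\<in>{L \<in> st R. r + 1 \<le> card (B \<inter> st L)}. real r)" for R
    by (rule sum_mono) (simp add: x_def)
  have sum_x: "(\<Sum>L\<in>st R. x L - 1) = real q + K" if "R \<in> B" for R
    using sum_pencil_sizes[OF B(1) that] card_B by (simp add: x_def)
  obtain R0 where R0: "R0 \<in> B" using B(2) by blast
  have Kr: "r \<le> K"
  proof -
    have "real (r + 1) * r \<le> real (card {L \<in> st R0. r + 1 \<le> card (B \<inter> st L)}) * r"
      using long[OF R0] by (intro mult_right_mono) auto
    also have "\<dots> \<le> real q + K" using long_sum1[of R0] long_sum2[of R0] sum_x[OF R0] by simp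
    finally have "real r \<le> K" using q by (simp add: algebra_simps)
    then show ?thesis by simp
  qed
  have K_eq: "K = r"
  proof (rule ccontr)
    assume "K \<noteq> r"
    obtain d' where d': "K = r + d'" using Kr le_Suc_ex by blast
    with \<open>K \<noteq> r\<close> obtain d where d: "K = r + d" "d > 0" by simp
    \<comment> \<open>The division by x makes the points of B on a line contribute (x - 1)(x - 2) in
      total, while the long lines can still be estimated from a single point R.\<close>
    define f where "f L = (x L - 1) * (x L - 2) / x L" for L
    have f0: "f L \<ge> 0" if "L \<in> E" for L
    proof -
      have "x L = 1 \<or> x L \<ge> 2" using x1[OF that] by (auto simp: x_def)
      then show ?thesis using x1[OF that] by (auto simp: f_def)
    qed
    have fr: "f L \<ge> real r * (real r - 1) / (real r + 1)" if "r + 1 \<le> card (B \<inter> st L)" for L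
    proof -
      have "x L \<ge> real r + 1" using that by (simp add: x_def)
      define y where "y = x L - (real r + 1)"
      have y: "x L = real r + 1 + y" "y \<ge> 0" using \<open>x L \<ge> real r + 1\<close> by (simp_all add: y_def)
      have "real r * (real r - 1) * (real r + 1 + y) \<le> (real r + y) * (real r - 1 + y) * (real r + 1)"
      proof -
        have "0 \<le> y * (real r * real r + (2 * real r - 1)) + (real r + 1) * (y * y)"
          using y q(2) by (intro add_nonneg_nonneg mult_nonneg_nonneg) auto
        then show ?thesis by (simp add: algebra_simps)
      qed
      then have "real r * (real r - 1) / (real r + 1) * (real r + 1 + y) \<le> (real r + y) * (real r - 1 + y)"
        by (simp add: pos_divide_le_eq)
      then have "real r * (real r - 1) / (real r + 1) \<le> (real r + y) * (real r - 1 + y) / (real r + 1 + y)"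
        using y(2) by (simp add: pos_le_divide_eq)
      moreover have "x L - 1 = real r + y" "x L - 2 = real r - 1 + y" using y(1) by simp_all
      then have "f L = (real r + y) * (real r - 1 + y) / (real r + 1 + y)"
        by (simp only: f_def) (simp only: y(1))
      ultimately show ?thesis by (simp only:)
    qed
    have h1: "real (card B) * (real r * (real r - 1)) \<le> (\<Sum>R\<in>B. \<Sum>L\<in>st R. f L)"
    proof -
      have "real r * (real r - 1) \<le> (\<Sum>L\<in>st R. f L)" if "R \<in> B" for R
      proof -
        let ?L = "{L \<in> st R. r + 1 \<le> card (B \<inter> st L)}"
        define c where "c = real r * (real r - 1) / (real r + 1)"
        have c0: "0 \<le> c" unfolding c_def using q(2)
          by (intro divide_nonneg_nonneg mult_nonneg_nonneg) auto
        have "real r * (real r - 1) = real (r + 1) * c"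
          unfolding c_def by (simp add: nonzero_eq_divide_eq add_eq_0_iff)
        also have "\<dots> \<le> real (card ?L) * c"
          by (rule mult_right_mono[OF _ c0]) (use long[OF that] in \<open>simp only: of_nat_le_iff\<close>)
        also have "\<dots> = (\<Sum>L\<in>?L. c)" by simp
        also have "\<dots> \<le> (\<Sum>L\<in>?L. f L)" unfolding c_def by (rule sum_mono) (use fr in blast)
        also have "\<dots> \<le> (\<Sum>L\<in>st R. f L)" by (rule sum_mono2) (use f0 st_subset in auto)
        finally show ?thesis .
      qed
      then have "(\<Sum>R\<in>B. real r * (real r - 1)) \<le> (\<Sum>R\<in>B. \<Sum>L\<in>st R. f L)" by (rule sum_mono)
      then show ?thesis by simp
    qed
    have h2: "(\<Sum>R\<in>B. \<Sum>L\<in>st R. f L) = (\<Sum>L\<in>E. x L * f L)"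
      using sum_card_lines[OF B(1), of f] by (simp add: x_def)
    have h3: "(\<Sum>L\<in>E. x L * f L) = (\<Sum>L\<in>E. (x L * (x L - 1) - 2 * x L) + 2)"
    proof (rule sum.cong[OF refl])
      fix L assume "L \<in> E"
      then have "x L \<noteq> 0" using x1 by fastforce
      then have "x L * f L = (x L - 1) * (x L - 2)" by (simp add: f_def)
      then show "x L * f L = (x L * (x L - 1) - 2 * x L) + 2" by (simp add: algebra_simps)
    qed
    have h4: "(\<Sum>L\<in>E. (x L * (x L - 1) - 2 * x L) + 2) = (\<Sum>L\<in>E. x L * (x L - 1)) - 2 * (\<Sum>L\<in>E. x L) + real (card E) * 2"
      by (simp only: sum.distrib sum_subtractf sum_distrib_left[symmetric] sum_constant)
    have h5: "(\<Sum>L\<in>E. x L * (x L - 1)) - 2 * (\<Sum>L\<in>E. x L) + real (card E) * 2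
        = real (card B) * (real (card B) - 1) - 2 * (real (card B) * (real q + 1))
        + 2 * (real q * real q + real q + 1)"
    proof -
      have "E \<noteq> {}" using B by blast
      then have "card E = q * q + q + 1" by (rule card_E)
      then have "real (card E) = real q * real q + real q + 1" by (simp only: of_nat_add of_nat_mult of_nat_1)
      moreover have "(\<Sum>L\<in>E. x L) = real (card B) * (real q + 1)"
        using sum_line_sizes[OF B(1)] by (simp add: x_def algebra_simps)
      moreover have "(\<Sum>L\<in>E. x L * (x L - 1)) = real (card B) * (real (card B) - 1)"
        unfolding x_def by (rule sum_line_sizes_squared[OF B(1)])
      ultimately show ?thesis by (simp only: mult_ac)
    qed
    have fin: "real (card B) * (real r * (real r - 1))
      \<le> real (card B) * (real (card B) - 1) - 2 * (real (card B) * (real q + 1))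
        + 2 * (real q * real q + real q + 1)"
      using h1 unfolding h2 h3 h4 h5 .
    have qr: "real q = real r * real r" using q by simp
    have cB: "real (card B) = real r * real r + 1 + real r + real d" unfolding card_B d(1) q(1) by simp
    \<comment> \<open>The terms free of d cancel, since d = 0 is the case of a Baer subplane, where
      equality holds. A positive d is thus at least r^2 - 3 r + 1, which means K >= (r -
      1)^2.\<close>
    from fin have "0 \<le> real d * (real d + 3 * r - r * r - 1)"
      unfolding cB qr by (simp add: algebra_simps)
    then have "real r * r + 1 \<le> real d + 3 * r" using d(2) by (simp add: zero_le_mult_iff)
    then have "real (r * r + 1) \<le> real (d + 3 * r)" by simp
    then have rd: "r * r + 1 \<le> d + 3 * r" by (simp only: of_nat_le_iff)
    \<comment> \<open>In terms of s, r - 1 is s + 3. Since r >= 4, (r - 1)^3 is at least r^2, and K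
      >= (r - 1)^2 contradicts K^3 < q^2 = r^4.\<close>
    obtain s where s: "r = 4 + s" using q(2) le_Suc_ex by blast
    have "(s + 3) * (s + 3) \<le> K" using rd unfolding d(1) s by (simp add: algebra_simps)
    then have "((s + 3) * (s + 3)) ^ 3 \<le> K ^ 3" by (rule power_mono) simp
    moreover have "q ^ 2 \<le> ((s + 3) * (s + 3)) ^ 3"
    proof -
      have "r * r \<le> (s + 3) ^ 3" unfolding s by (simp add: power3_eq_cube algebra_simps)
      then have "(r * r) ^ 2 \<le> ((s + 3) ^ 3) ^ 2" by (rule power_mono) simp
      also have "\<dots> = ((s + 3) * (s + 3)) ^ 3" by (simp add: power_mult_distrib power2_eq_square power3_eq_cube mult_ac)
      finally show ?thesis by (simp add: q)
    qed
    ultimately show False using K by linarith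
  qed
  have struct: "card {L \<in> st R. r + 1 \<le> card (B \<inter> st L)} = r + 1
    \<and> (\<forall>L\<in>st R. card (B \<inter> st L) = 1 \<or> card (B \<inter> st L) = r + 1)" if R: "R \<in> B" for R
  proof -
    let ?L = "{L \<in> st R. r + 1 \<le> card (B \<inter> st L)}"
    \<comment> \<open>For K = r the long lines already exhaust the whole sum. So there are exactly r
      + 1 of them, each with exactly r + 1 points of B, and every other line through R has exactly
      one.\<close>
    have tot: "(\<Sum>L\<in>st R. x L - 1) = real (r + 1) * r"
      unfolding sum_x[OF R] q(1) K_eq by (simp add: algebra_simps)
    have ge: "real (r + 1) * r \<le> real (card ?L) * r"
      by (rule mult_right_mono) (use long[OF R] in \<open>simp_all only: of_nat_le_iff of_nat_0_le_iff\<close>)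
    have a: "(\<Sum>L\<in>?L. real r) = real (card ?L) * r" by simp
    have e1: "real (card ?L) * r = real (r + 1) * r" and e2: "(\<Sum>L\<in>?L. x L - 1) = (\<Sum>L\<in>?L. real r)"
      and e3: "(\<Sum>L\<in>st R. x L - 1) = (\<Sum>L\<in>?L. x L - 1)"
      using tot ge a long_sum1[of R] long_sum2[of R] by linarith+
    have "card ?L = r + 1" using e1 q(2) by simp
    moreover have "card (B \<inter> st L) = r + 1" if "L \<in> ?L" for L
    proof -
      have "(\<Sum>L\<in>?L. (x L - 1) - real r) = 0" using e2 by (simp add: sum_subtractf)
      then have "\<forall>L\<in>?L. (x L - 1) - real r = 0"
        by (subst (asm) sum_nonneg_eq_0_iff) (auto simp: x_def)
      then have "x L - 1 - real r = 0" using that by blast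
      then have "x L = real (r + 1)" by simp
      then show ?thesis by (simp only: x_def of_nat_eq_iff)
    qed
    moreover have "card (B \<inter> st L) = 1" if "L \<in> st R - ?L" for L
    proof -
      have "(\<Sum>L\<in>st R. x L - 1) = (\<Sum>L\<in>st R - ?L. x L - 1) + (\<Sum>L\<in>?L. x L - 1)"
        by (rule sum.subset_diff[OF Collect_subset_st finite_st])
      then have "(\<Sum>L\<in>st R - ?L. x L - 1) = 0" using e3 by linarith
      then have "\<forall>L\<in>st R - ?L. x L - 1 = 0"
        by (subst (asm) sum_nonneg_eq_0_iff) (use x1 st_subset in auto)
      then have "x L - 1 = 0" using that by blast
      then have "x L = real 1" by simp
      then show ?thesis by (simp only: x_def of_nat_eq_iff)
    qed
    ultimately show ?thesis by blast
  qed
  have "{L \<in> st R. card (B \<inter> st L) = r + 1} = {L \<in> st R. r + 1 \<le> card (B \<inter> st L)}" if "R \<in> B" for R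
  proof -
    have "card (B \<inter> st L) = r + 1 \<longleftrightarrow> r + 1 \<le> card (B \<inter> st L)" if "L \<in> st R" for L
    proof -
      have "card (B \<inter> st L) = 1 \<or> card (B \<inter> st L) = r + 1"
        using struct[OF \<open>R \<in> B\<close>] that by blast
      then show ?thesis using q(2) by linarith
    qed
    then show ?thesis by blast
  qed
  then have "card {L \<in> st R. card (B \<inter> st L) = r + 1} = r + 1" if "R \<in> B" for R
    using struct[OF that] that by presburger
  then show ?thesis using K_eq struct by blast
qed

text \<open>Two long lines meet in B by counting. If R in B lies on M but not on L, the joins of R
  with the r + 1 points of B on L are r + 1 distinct long lines through R, hence all of them, and M
  is one of these.\<close>

lemma baer_lines_meet:
  assumes B: "B \<subseteq> E"
    and sec: "\<And>R L. R \<in> B \<Longrightarrow> L \<in> st R \<Longrightarrow> card (B \<inter> st L) = 1 \<or> card (B \<inter> st L) = r + 1"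
    and num: "\<And>R. R \<in> B \<Longrightarrow> card {L \<in> st R. card (B \<inter> st L) = r + 1} = r + 1"
  shows "X \<in> B \<Longrightarrow> Y \<in> B \<Longrightarrow> X \<noteq> Y \<Longrightarrow> L \<in> E \<Longrightarrow> I X L \<Longrightarrow> I Y L \<Longrightarrow> card (B \<inter> st L) = r + 1"
    and "L \<in> E \<Longrightarrow> M \<in> E \<Longrightarrow> card (B \<inter> st L) = r + 1 \<Longrightarrow> card (B \<inter> st M) = r + 1 \<Longrightarrow>
      \<exists>X\<in>B. I X L \<and> I X M"
proof -
  show secant: "card (B \<inter> st L) = r + 1" if "X \<in> B" "Y \<in> B" "X \<noteq> Y" "L \<in> E" "I X L" "I Y L" for X Y L
  proof -
    have "L \<in> st X" using that by (simp add: st_iff)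
    moreover have "card (B \<inter> st L) \<noteq> 1"
    proof
      assume "card (B \<inter> st L) = 1"
      then obtain Z where "B \<inter> st L = {Z}" by (auto simp: card_1_singleton_iff)
      moreover have "X \<in> B \<inter> st L" "Y \<in> B \<inter> st L" using that B I_sym by (auto simp: st_iff)
      ultimately show False using that(3) by auto
    qed
    ultimately show ?thesis using sec[OF that(1)] by blast
  qed
  assume L: "L \<in> E" "card (B \<inter> st L) = r + 1" and M: "M \<in> E" "card (B \<inter> st M) = r + 1"
  have "B \<inter> st M \<noteq> {}" using M by auto
  then obtain R where R: "R \<in> B" "I R M" using I_sym by (auto simp: st_iff)
  show "\<exists>X\<in>B. I X L \<and> I X M"
  proof (cases "I R L")
    case False
    have RE: "R \<in> E" using R B by auto
    have "\<exists>N. N \<in> E \<and> I R N \<and> I X N" if "X \<in> B \<inter> st L" for X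
      using join[of R X] RE that False I_sym by (auto simp: st_iff)
    then obtain j where j: "\<And>X. X \<in> B \<inter> st L \<Longrightarrow> j X \<in> E \<and> I R (j X) \<and> I X (j X)" by metis
    have inj: "inj_on j (B \<inter> st L)"
    proof (rule inj_onI)
      fix X Y assume XY: "X \<in> B \<inter> st L" "Y \<in> B \<inter> st L" "j X = j Y"
      show "X = Y"
      proof (rule ccontr)
        assume "X \<noteq> Y"
        then have "j X = L" using join_eq[of X Y "j X" L] XY j[OF XY(1)] j[OF XY(2)] L(1) I_sym
          by (auto simp: st_iff)
        then show False using j[OF XY(1)] False by simp
      qed
    qed
    have sub: "j ` (B \<inter> st L) \<subseteq> {N \<in> st R. card (B \<inter> st N) = r + 1}"
    proof
      fix N assume "N \<in> j ` (B \<inter> st L)"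
      then obtain X where X: "X \<in> B \<inter> st L" "N = j X" by auto
      then have "X \<noteq> R" using False I_sym by (auto simp: st_iff)
      then show "N \<in> {N \<in> st R. card (B \<inter> st N) = r + 1}"
        using secant[of R X N] j[OF X(1)] X R(1) by (auto simp: st_iff)
    qed
    have "j ` (B \<inter> st L) = {N \<in> st R. card (B \<inter> st N) = r + 1}"
      by (rule card_subset_eq[OF _ sub]) (use num[OF R(1)] L inj in \<open>auto simp: card_image\<close>)
    moreover have "M \<in> {N \<in> st R. card (B \<inter> st N) = r + 1}" using M R by (simp add: st_iff)
    ultimately obtain X where "X \<in> B \<inter> st L" "M = j X" by auto
    then show ?thesis using j[of X] I_sym by (auto simp: st_iff)
  qed (use R in auto)
qed

end

section \<open>Dominating sets containing an almost full pencil\<close>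

context incidence_plane
begin

definition dom :: "'e set \<Rightarrow> 'e set \<Rightarrow> bool" where
  "dom Ps Ls \<longleftrightarrow> Ps \<subseteq> E \<and> Ls \<subseteq> E \<and>
     (\<forall>X\<in>E - Ps. \<exists>L\<in>Ls. I X L) \<and> (\<forall>L\<in>E - Ls. \<exists>X\<in>Ps. I X L)"

lemma dom_swap: "dom Ps Ls \<Longrightarrow> dom Ls Ps"
  unfolding dom_def using I_sym by metis

definition min_dom :: "'e set \<Rightarrow> 'e set \<Rightarrow> bool" where
  "min_dom Ps Ls \<longleftrightarrow> dom Ps Ls \<and>
     (\<forall>Ps' Ls'. Ps' \<subseteq> Ps \<and> Ls' \<subseteq> Ls \<and> dom Ps' Ls' \<longrightarrow> Ps' = Ps \<and> Ls' = Ls)"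

lemma min_domD:
  "min_dom Ps Ls \<Longrightarrow> Ps' \<subseteq> Ps \<Longrightarrow> Ls' \<subseteq> Ls \<Longrightarrow> dom Ps' Ls' \<Longrightarrow> Ps' = Ps \<and> Ls' = Ls"
  by (simp add: min_dom_def)

lemma ex_line_through: "X \<in> E \<Longrightarrow> \<exists>L\<in>st X. L \<noteq> M"
proof -
  assume "X \<in> E"
  then have "card (st X - {M}) \<ge> 2" using card_st[of X] q_ge_2 by (simp add: card_Diff_singleton_if)
  then have "st X - {M} \<noteq> {}" by (metis card.empty not_numeral_le_zero)
  then show ?thesis by blast
qed

lemma line_meet_le_1:
  "L \<in> E \<Longrightarrow> M \<in> E \<Longrightarrow> L \<noteq> M \<Longrightarrow> X \<in> E \<Longrightarrow> Y \<in> E \<Longrightarrow> I X L \<Longrightarrow> I X M \<Longrightarrow> I Y L \<Longrightarrow> I Y M \<Longrightarrow> X = Y"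
  using join_eq by blast

lemma ex_point_off:
  assumes "L \<in> E" "M \<in> E" "L \<noteq> M"
  shows "\<exists>X\<in>E. I X L \<and> \<not> I X M"
proof -
  have "card (st L \<inter> st M) = 1" by (rule card_st_inter[OF assms])
  moreover have "card (st L) = q + 1" using assms card_st by simp
  moreover have "st L \<inter> st M = st L" if "st L \<subseteq> st M" using that by blast
  ultimately have "\<not> st L \<subseteq> st M" using q_ge_2 by auto
  then show ?thesis using I_sym by (auto simp: st_iff)
qed

text \<open>Jamison's bound in the dual plane; each line of T is replaced by one of its points off m.\<close>

lemma card_ge_of_avoided_line:
  assumes P: "P \<in> E" and m: "m \<in> E" "\<not> I P m" and Ps: "Ps \<subseteq> E" "\<And>X. X \<in> Ps \<Longrightarrow> \<not> I X m"
    and T: "T \<subseteq> E" "m \<notin> T"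
    and block: "\<And>L. L \<in> E \<Longrightarrow> \<not> I P L \<Longrightarrow> L \<noteq> m \<Longrightarrow> L \<in> T \<or> (\<exists>X\<in>Ps. I X L)"
  shows "2 * (q - 1) \<le> card Ps + card T"
proof -
  have "\<forall>L\<in>T. \<exists>X\<in>E. I X L \<and> \<not> I X m"
  proof
    fix L assume "L \<in> T"
    then have "L \<in> E" "L \<noteq> m" using T by auto
    then show "\<exists>X\<in>E. I X L \<and> \<not> I X m" using ex_point_off m(1) by blast
  qed
  then obtain f where f: "\<And>L. L \<in> T \<Longrightarrow> f L \<in> E \<and> I (f L) L \<and> \<not> I (f L) m" by metis
  have "2 * (q - 1) \<le> card (Ps \<union> f ` T)"
  proof (rule jamison_bound[OF m(1) P])
    show "\<not> I m P" using m I_sym by blast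
    show "Ps \<union> f ` T \<subseteq> E" using Ps f by blast
    show "\<not> I m X" if "X \<in> Ps \<union> f ` T" for X
      using that Ps(2) f I_sym by blast
    show "\<exists>X\<in>Ps \<union> f ` T. I L X" if "L \<in> E" "L \<noteq> m" "\<not> I L P" for L
    proof -
      have "L \<in> T \<or> (\<exists>X\<in>Ps. I X L)" using block[of L] that I_sym by blast
      then show ?thesis
      proof
        assume "L \<in> T"
        then show ?thesis using f I_sym by blast
      qed (use I_sym in blast)
    qed
  qed
  also have "\<dots> \<le> card Ps + card (f ` T)" by (rule card_Un_le)
  also have "\<dots> \<le> card Ps + card T" using card_image_le[OF finite_sub[OF T(1)]] by simp
  finally show ?thesis .
qed

definition pencil_config :: "'e \<Rightarrow> 'e set \<Rightarrow> bool" where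
  "pencil_config P Ps \<longleftrightarrow> P \<in> E \<and> Ps \<subseteq> E \<and> P \<notin> Ps \<and>
     (\<forall>L\<in>E. \<not> I P L \<longrightarrow> (\<exists>X\<in>Ps. I X L)) \<and>
     (\<forall>X\<in>Ps. \<exists>L\<in>E. \<not> I P L \<and> I X L \<and> (\<forall>Y\<in>Ps. I Y L \<longrightarrow> Y = X)) \<and>
     (\<forall>L\<in>st P. \<exists>X\<in>st L. X \<noteq> P \<and> X \<notin> Ps)"

lemma pencil_case:
  assumes min: "min_dom Ps Ls" and P: "P \<in> E" "st P \<subseteq> Ls" and small: "card Ps + card Ls + 1 < 3 * q"
  shows "Ls = st P \<and> pencil_config P Ps"
proof -
  have d: "dom Ps Ls" using min by (simp add: min_dom_def)
  have sub: "Ps \<subseteq> E" "Ls \<subseteq> E" and pts: "\<And>X. X \<in> E \<Longrightarrow> X \<notin> Ps \<Longrightarrow> \<exists>L\<in>Ls. I X L"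
    and lns: "\<And>L. L \<in> E \<Longrightarrow> L \<notin> Ls \<Longrightarrow> \<exists>X\<in>Ps. I X L" using d by (auto simp: dom_def)
  have pencil: "\<exists>L\<in>st P. I X L" if "X \<in> E" for X
  proof (cases "X = P")
    case True
    obtain L where "L \<in> st P" using ex_line_through[OF P(1)] by blast
    then show ?thesis using True by (auto simp: st_iff)
  next
    case False
    then show ?thesis using join[of X P] that P(1) by (auto simp: st_iff)
  qed
  have dom_pts: "dom Ps' Ls'" if "Ps' \<subseteq> E" "st P \<subseteq> Ls'" "Ls' \<subseteq> E"
    "\<And>L. L \<in> E \<Longrightarrow> L \<notin> Ls' \<Longrightarrow> \<exists>X\<in>Ps'. I X L" for Ps' Ls'
    unfolding dom_def using that pencil by blast
  have through: "I P L \<Longrightarrow> L \<in> E \<Longrightarrow> L \<in> Ls" for L using P(2) by (auto simp: st_iff)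
  have PnPs: "P \<notin> Ps"
  proof
    assume "P \<in> Ps"
    have "dom (Ps - {P}) Ls"
    proof (rule dom_pts)
      fix L assume "L \<in> E" "L \<notin> Ls"
      then obtain X where "X \<in> Ps" "I X L" using lns by blast
      moreover have "X \<noteq> P" using through \<open>L \<in> E\<close> \<open>L \<notin> Ls\<close> \<open>I X L\<close> by blast
      ultimately show "\<exists>X\<in>Ps - {P}. I X L" by blast
    qed (use sub P in auto)
    then have "Ps - {P} = Ps" using min_domD[OF min, of "Ps - {P}" Ls] by blast
    then show False using \<open>P \<in> Ps\<close> by blast
  qed
  have Ls_eq: "Ls = st P"
  proof (rule ccontr)
    assume "Ls \<noteq> st P"
    then obtain m where m: "m \<in> Ls" "m \<notin> st P" using P(2) by blast
    then have mE: "m \<in> E" "\<not> I P m" using sub by (auto simp: st_iff)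
    have free: "\<not> I X m" if "X \<in> Ps" for X
    proof
      assume "I X m"
      have "dom Ps (Ls - {m})"
      proof (rule dom_pts)
        fix L assume "L \<in> E" "L \<notin> Ls - {m}"
        then show "\<exists>X\<in>Ps. I X L" using lns[of L] that \<open>I X m\<close> by blast
      qed (use sub P m in auto)
      then have "Ls - {m} = Ls" using min_domD[OF min, of Ps "Ls - {m}"] by blast
      then show False using m by blast
    qed
    have "2 * (q - 1) \<le> card Ps + card (Ls - st P - {m})"
    proof (rule card_ge_of_avoided_line[OF P(1) mE sub(1) free])
      fix L assume L: "L \<in> E" "\<not> I P L" "L \<noteq> m"
      show "L \<in> Ls - st P - {m} \<or> (\<exists>X\<in>Ps. I X L)"
        using lns[OF L(1)] L by (auto simp: st_iff)
    qed (use sub in auto)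
    moreover have "card (Ls - st P - {m}) + 1 = card (Ls - st P)"
      using m finite_sub[OF sub(2)] card_Suc_Diff1[of "Ls - st P" m] by simp
    moreover have "card (Ls - st P) + (q + 1) = card Ls"
      using card_Diff_subset[of "st P" Ls] P card_st[OF P(1)] card_mono[OF finite_sub[OF sub(2)] P(2)] by simp
    ultimately show False using small q_ge_2 by linarith
  qed
  have "\<exists>L\<in>E. \<not> I P L \<and> I X L \<and> (\<forall>Y\<in>Ps. I Y L \<longrightarrow> Y = X)" if X: "X \<in> Ps" for X
  proof (rule ccontr)
    assume *: "\<not> ?thesis"
    have "dom (Ps - {X}) Ls"
    proof (rule dom_pts)
      fix L assume L: "L \<in> E" "L \<notin> Ls"
      then have "\<not> I P L" using through by blast
      obtain Y where Y: "Y \<in> Ps" "I Y L" using lns L by blast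
      show "\<exists>Y\<in>Ps - {X}. I Y L"
      proof (cases "Y = X")
        case True
        then obtain Z where "Z \<in> Ps" "I Z L" "Z \<noteq> X" using * L \<open>\<not> I P L\<close> Y by blast
        then show ?thesis by blast
      qed (use Y in blast)
    qed (use sub P in auto)
    then have "Ps - {X} = Ps" using min_domD[OF min, of "Ps - {X}" Ls] by blast
    then show False using X by blast
  qed
  moreover have "\<exists>X\<in>st L. X \<noteq> P \<and> X \<notin> Ps" if L: "L \<in> st P" for L
  proof (rule ccontr)
    assume *: "\<not> ?thesis"
    have LE: "L \<in> E" "I P L" using L by (auto simp: st_iff)
    have "dom Ps (Ls - {L})"
      unfolding dom_def
    proof (intro conjI ballI)
      fix X assume X: "X \<in> E - Ps"
      show "\<exists>M\<in>Ls - {L}. I X M"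
      proof (cases "X = P")
        case True
        obtain M where "M \<in> st P" "M \<noteq> L" using ex_line_through[OF P(1)] by blast
        then show ?thesis using True P(2) by (auto simp: st_iff)
      next
        case False
        then obtain M where M: "M \<in> E" "I X M" "I P M" using join[of X P] X P by auto
        have "\<not> I X L" using * False X I_sym by (auto simp: st_iff)
        then have "M \<noteq> L" using M by blast
        then show ?thesis using M through by blast
      qed
    next
      fix M assume M: "M \<in> E - (Ls - {L})"
      show "\<exists>X\<in>Ps. I X M"
      proof (cases "M = L")
        case True
        obtain X where X: "X \<in> st L" "X \<noteq> P" using ex_line_through[OF LE(1)] by blast
        then have "X \<in> Ps" using * by blast
        then show ?thesis using X True I_sym by (auto simp: st_iff)
      qed (use M lns in blast)
    qed (use sub in auto)
    then have "Ls - {L} = Ls" using min_domD[OF min, of Ps "Ls - {L}"] by blast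
    then show False using L P by blast
  qed
  moreover have "\<exists>X\<in>Ps. I X L" if "L \<in> E" "\<not> I P L" for L
    using lns[of L] that unfolding Ls_eq by (auto simp: st_iff)
  ultimately show ?thesis unfolding pencil_config_def using Ls_eq P(1) sub PnPs by blast
qed

text \<open>The remaining lines through P cannot dominate X, since L is the only line of the pencil
  through X.\<close>

lemma missing_line_points:
  assumes "dom Ps Ls" "P \<in> E" "L \<in> st P" "L \<notin> Ls" "X \<in> st L" "X \<noteq> P" "X \<notin> Ps"
  shows "\<exists>M\<in>Ls. M \<notin> st P \<and> I X M"
proof -
  have XE: "X \<in> E" "I X L" "L \<in> E" "I P L" using assms I_sym by (auto simp: st_iff)
  then have "\<exists>M\<in>Ls. I X M" using assms(1,7) unfolding dom_def by blast
  then obtain M where M: "M \<in> Ls" "I X M" by blast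
  have ME: "M \<in> E" using M assms by (auto simp: dom_def)
  have "\<not> I P M" using join_eq[of X P M L] XE ME M assms by blast
  then show ?thesis using M by (auto simp: st_iff)
qed

lemma card_two_lines:
  assumes "P \<in> E" "L \<in> st P" "M \<in> st P" "L \<noteq> M"
  shows "card ((st L - {P}) \<union> (st M - {P})) = 2 * q"
proof -
  have LM: "L \<in> E" "M \<in> E" "P \<in> st L" "P \<in> st M" using assms I_sym by (auto simp: st_iff)
  have "X = P" if "X \<in> st L" "X \<in> st M" for X
    using line_meet_le_1[OF LM(1,2) assms(4), of X P] that LM assms(1) I_sym by (simp add: st_iff)
  then have "(st L - {P}) \<inter> (st M - {P}) = {}" by blast
  then have "card ((st L - {P}) \<union> (st M - {P})) = card (st L - {P}) + card (st M - {P})"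
    by (intro card_Un_disjoint) auto
  then show ?thesis using LM card_st by simp
qed

lemma ex_two_distinct:
  assumes "finite A" "card A \<ge> 2"
  shows "\<exists>x y. x \<in> A \<and> y \<in> A \<and> x \<noteq> y"
  using assms by (metis card_le_Suc0_iff_eq not_less_eq_eq numeral_2_eq_2)

text \<open>z is the added element. No point y of Ps can be lost: either Ps - {y} meets all lines
  off P but one, against Jamison's bound, or two such lines need y and a single z cannot serve both.
  A smaller dominating set then omits two lines of the pencil, and all or nearly all of their 2 q
  points other than P must lie in Ps, which is too small.\<close>

lemma pencil_stable:
  assumes min: "min_dom Ps (st P)" and conf: "pencil_config P Ps" and small: "card Ps + 2 < 2 * q"
    and ext: "(Ps' \<subseteq> insert z Ps \<and> Ls' \<subseteq> st P) \<or> (Ps' \<subseteq> Ps \<and> Ls' \<subseteq> insert z (st P))"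
    and d: "dom Ps' Ls'"
  shows "card Ps + (q + 1) \<le> card Ps' + card Ls'"
proof (rule ccontr)
  assume "\<not> ?thesis"
  then have less: "card Ps' + card Ls' < card Ps + (q + 1)" by simp
  have P: "P \<in> E" "P \<notin> Ps" and Ps: "Ps \<subseteq> E" and block: "\<And>L. L \<in> E \<Longrightarrow> \<not> I P L \<Longrightarrow> \<exists>X\<in>Ps. I X L"
    and ess: "\<And>X. X \<in> Ps \<Longrightarrow> \<exists>L\<in>E. \<not> I P L \<and> I X L \<and> (\<forall>Y\<in>Ps. I Y L \<longrightarrow> Y = X)"
    using conf unfolding pencil_config_def by blast+
  have sub': "Ps' \<subseteq> E" "Ls' \<subseteq> E" using d by (auto simp: dom_def)
  have cst: "card (st P) = q + 1" using card_st P by blast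
  have sup: "Ps \<subseteq> Ps'"
  proof
    fix y assume y: "y \<in> Ps"
    show "y \<in> Ps'"
    proof (rule ccontr)
      assume y': "y \<notin> Ps'"
      obtain t where t: "t \<in> E" "\<not> I P t" "I y t" "\<And>Y. Y \<in> Ps \<Longrightarrow> I Y t \<Longrightarrow> Y = y"
        using ess[OF y] by blast
      have unblocked: "\<exists>X. X \<in> Ps - {y} \<and> I X L" if L: "L \<in> E" "\<not> I P L" "L \<noteq> t" for L
      proof (rule ccontr)
        assume *: "\<not> ?thesis"
        have only: "L' \<in> Ls' \<or> (I z L' \<and> z \<in> E \<and> z \<noteq> y \<and> Ls' \<subseteq> st P)"
          if L': "L' \<in> E" "\<not> I P L'" "\<And>Y. Y \<in> Ps \<Longrightarrow> I Y L' \<Longrightarrow> Y = y" for L'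
        proof (cases "L' \<in> Ls'")
          case False
          then have "\<exists>X\<in>Ps'. I X L'" using d L'(1) unfolding dom_def by blast
          then obtain X where X: "X \<in> Ps'" "I X L'" by blast
          then have "X \<noteq> y" using y' by blast
          then have "X \<notin> Ps" using L'(3) X(2) by blast
          then have "X = z" "Ls' \<subseteq> st P" using ext X(1) by blast+
          then show ?thesis using X \<open>X \<noteq> y\<close> sub' by blast
        qed simp
        have Ly: "Y = y" if "Y \<in> Ps" "I Y L" for Y using * that by blast
        have "I y L" using block[OF L(1,2)] Ly by blast
        have 1: "L \<in> Ls' \<or> (I z L \<and> z \<in> E \<and> z \<noteq> y \<and> Ls' \<subseteq> st P)" using only[OF L(1,2)] Ly by blast
        have 2: "t \<in> Ls' \<or> (I z t \<and> z \<in> E \<and> z \<noteq> y \<and> Ls' \<subseteq> st P)" using only[OF t(1,2)] t(4) by blast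
        have notst: "L \<notin> st P" "t \<notin> st P" using L t by (auto simp: st_iff)
        show False
        proof (cases "L \<in> Ls' \<or> t \<in> Ls'")
          case True
          then have "\<not> Ls' \<subseteq> st P" using notst by blast
          then have "L \<in> Ls'" "t \<in> Ls'" "Ls' \<subseteq> insert z (st P)" using 1 2 ext by blast+
          then have "L = z" "t = z" using notst by blast+
          then show False using L(3) by blast
        next
          case False
          then have "I z L" "I z t" "z \<in> E" "z \<noteq> y" using 1 2 by blast+
          moreover have "y \<in> E" using y Ps by blast
          ultimately show False using join_eq[of z y L t] L t \<open>I y L\<close> by blast
        qed
      qed
      have "2 * (q - 1) \<le> card (Ps - {y}) + card ({} :: 'e set)"
      proof (rule card_ge_of_avoided_line[OF P(1) t(1,2)])
        show "\<not> I X t" if "X \<in> Ps - {y}" for X using that t(4) by blast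
        show "L \<in> {} \<or> (\<exists>X\<in>Ps - {y}. I X L)" if "L \<in> E" "\<not> I P L" "L \<noteq> t" for L
          using unblocked[OF that] by blast
      qed (use Ps in auto)
      then have "2 * (q - 1) \<le> card (Ps - {y})" by simp
      also have "card (Ps - {y}) \<le> card Ps" by (rule card_mono) (use finite_sub[OF Ps] in auto)
      finally show False using small by linarith
    qed
  qed
  have no_sub: False if "Ps' = Ps" "Ls' \<subseteq> st P"
  proof -
    have "Ls' = st P" using min_domD[OF min, of Ps Ls'] that d by blast
    then show False using less that cst by simp
  qed
  have ge_Ps: "card Ps \<le> card Ps'" using sup finite_sub[OF sub'(1)] card_mono by blast
  have two: "\<exists>L M. L \<in> st P - Ls' \<and> M \<in> st P - Ls' \<and> L \<noteq> M" if "card (Ls' \<inter> st P) + 2 \<le> q + 1"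
  proof (rule ex_two_distinct)
    have "card (st P) = card (st P \<inter> Ls') + card (st P - Ls')"
      using card_Int_Diff[of "st P" Ls'] by simp
    then show "2 \<le> card (st P - Ls')" using that cst by (simp add: Int_commute)
  qed simp
  consider (point) "Ps' \<subseteq> insert z Ps" "Ls' \<subseteq> st P" "Ps' \<noteq> Ps" | (line) "Ps' = Ps" "Ls' \<subseteq> insert z (st P)" "\<not> Ls' \<subseteq> st P"
    using ext no_sub sup by blast
  then show False
  proof cases
    case point
    then have Ps'_eq: "Ps' = insert z Ps" "z \<notin> Ps" using sup by blast+
    then have "card Ps' = card Ps + 1" using finite_sub[OF Ps] by simp
    moreover have "Ls' \<inter> st P = Ls'" using point by blast
    ultimately obtain L M where LM: "L \<in> st P - Ls'" "M \<in> st P - Ls'" "L \<noteq> M" using two less by auto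
    have "X \<in> Ps'" if "N \<in> st P - Ls'" "X \<in> st N - {P}" for N X
      using missing_line_points[OF d P(1), of N X] that point(2) by blast
    then have "(st L - {P}) \<union> (st M - {P}) \<subseteq> Ps'" using LM by blast
    then have "card ((st L - {P}) \<union> (st M - {P})) \<le> card Ps'"
      by (rule card_mono[OF finite_sub[OF sub'(1)]])
    moreover have "card ((st L - {P}) \<union> (st M - {P})) = 2 * q"
      using card_two_lines[OF P(1), of L M] LM by blast
    ultimately have "2 * q \<le> card Ps'" by simp
    then show False using \<open>card Ps' = card Ps + 1\<close> small by linarith
  next
    case line
    then have z: "z \<in> Ls'" "z \<notin> st P" by blast+
    then have zE: "z \<in> E" using sub' by blast
    have "Ls' = insert z (Ls' \<inter> st P)" using line z by blast
    then have "card Ls' = card (Ls' \<inter> st P) + 1" using z(2)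
      card_insert_disjoint[of "Ls' \<inter> st P" z] by simp
    then obtain L M where LM: "L \<in> st P - Ls'" "M \<in> st P - Ls'" "L \<noteq> M" using two less line(1) by auto
    have in_Ps: "X \<in> Ps" if NX: "N \<in> st P - Ls'" "X \<in> st N - {P}" "X \<notin> st z" for N X
    proof (rule ccontr)
      assume "X \<notin> Ps"
      then obtain K where K: "K \<in> Ls'" "K \<notin> st P" "I X K"
        using missing_line_points[OF d P(1), of N X] NX line(1) by blast
      then have "K = z" using line(2) by blast
      then show False using K(3) NX I_sym by (auto simp: st_iff)
    qed
    \<comment> \<open>The added line z dominates at most one point on each of L and M, so Ps
      contains at least 2 q - 2 of their points.\<close>
    then have sub_Ps: "((st L - {P}) \<union> (st M - {P})) - (st z \<inter> st L) - (st z \<inter> st M) \<subseteq> Ps" using LM by blast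
    have "L \<in> E" "M \<in> E" "L \<noteq> z" "M \<noteq> z" using LM z by (auto simp: st_iff)
    then have c1: "card (st z \<inter> st L) = 1" "card (st z \<inter> st M) = 1"
      using card_st_inter[OF zE] by blast+
    have "card ((st L - {P}) \<union> (st M - {P})) = 2 * q"
      using card_two_lines[OF P(1), of L M] LM by blast
    then have "2 * q = card ((st L - {P}) \<union> (st M - {P}))" by (rule sym)
    also have "\<dots> \<le> card (Ps \<union> ((st z \<inter> st L) \<union> (st z \<inter> st M)))"
      by (rule card_mono) (use finite_sub[OF Ps] sub_Ps in auto)
    also have "\<dots> \<le> card Ps + card ((st z \<inter> st L) \<union> (st z \<inter> st M))" by (rule card_Un_le)
    also have "\<dots> \<le> card Ps + (1 + 1)" using card_Un_le[of "st z \<inter> st L" "st z \<inter> st M"] c1 by simp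
    finally show False using small by linarith
  qed
qed

text \<open>By Jamison's bound Ps meets every line off P, since otherwise the total is at least q +
  1 + 2 (q - 1). Suppose a point Q of l other than P is not in Ps. The q other lines through Q need
  q different points of Ps off l. Each of the q points of l other than P is itself in Ps or needs a
  line off P of its own. With the q lines of the pencil this makes 3 q.\<close>

lemma punctured_pencil_case:
  assumes min: "min_dom Ps Ls" and P: "P \<in> E" and l: "l \<in> st P" "l \<notin> Ls" and sub_Ls: "st P - {l} \<subseteq> Ls"
    and small: "card Ps + card Ls + 1 < 3 * q"
  shows "Ps = st l - {P} \<and> Ls = st P - {l}"
proof -
  have d: "dom Ps Ls" using min by (simp add: min_dom_def)
  have sub: "Ps \<subseteq> E" "Ls \<subseteq> E" and lns: "\<And>L. L \<in> E \<Longrightarrow> L \<notin> Ls \<Longrightarrow> \<exists>X\<in>Ps. I X L"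
    using d by (auto simp: dom_def)
  have lE: "l \<in> E" "I P l" "P \<in> st l" using l P I_sym by (auto simp: st_iff)
  define T where "T = Ls - st P"
  have cLs: "card Ls = q + card T"
  proof -
    have "Ls = (st P - {l}) \<union> T" "(st P - {l}) \<inter> T = {}" using sub_Ls l by (auto simp: T_def)
    then have "card Ls = card (st P - {l}) + card T"
      using finite_sub[OF sub(2)] card_Un_disjoint[of "st P - {l}" T] by (simp add: T_def)
    then show ?thesis using l(1) card_st[OF P] by simp
  qed
  have blocked: "\<exists>X\<in>Ps. I X L" if L: "L \<in> E" "\<not> I P L" for L
  proof (rule ccontr)
    assume *: "\<not> ?thesis"
    then have "L \<in> Ls" using lns L by blast
    then have LT: "L \<in> T" using L by (auto simp: T_def st_iff)
    have "2 * (q - 1) \<le> card Ps + card (T - {L})"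
    proof (rule card_ge_of_avoided_line[OF P L])
      show "M \<in> T - {L} \<or> (\<exists>X\<in>Ps. I X M)" if "M \<in> E" "\<not> I P M" "M \<noteq> L" for M
        using lns[of M] that by (auto simp: T_def st_iff)
    qed (use sub * in \<open>auto simp: T_def\<close>)
    moreover have "card (T - {L}) + 1 = card T"
      using LT finite_sub[OF sub(2)] card_Suc_Diff1[of T L] by (simp add: T_def)
    ultimately show False using small cLs q_ge_2 by linarith
  qed
  have all: "st l - {P} \<subseteq> Ps"
  proof (rule ccontr)
    assume "\<not> ?thesis"
    then obtain Q where Q: "Q \<in> st l" "Q \<noteq> P" "Q \<notin> Ps" by blast
    have QE: "Q \<in> E" "I Q l" using Q I_sym by (auto simp: st_iff)
    define U where "U = st l - {P} - Ps"
    have UT: "card U \<le> card T"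
    proof -
      have "\<exists>M. M \<in> T \<and> I X M" if "X \<in> U" for X
        using missing_line_points[OF d P l, of X] that by (auto simp: U_def T_def)
      then obtain g where g: "\<And>X. X \<in> U \<Longrightarrow> g X \<in> T \<and> I X (g X)" by metis
      have "inj_on g U"
      proof (rule inj_onI)
        fix X Y assume XY: "X \<in> U" "Y \<in> U" "g X = g Y"
        show "X = Y"
        proof (rule ccontr)
          assume "X \<noteq> Y"
          have in_l: "X \<in> E" "Y \<in> E" "I X l" "I Y l" using XY I_sym by (auto simp: U_def st_iff)
          have gT: "g X \<in> E" "\<not> I P (g X)" "I X (g X)" "I Y (g X)"
            using g[OF XY(1)] g[OF XY(2)] XY(3) sub by (auto simp: T_def st_iff)
          have "g X = l" using join_eq[OF in_l(1,2) \<open>X \<noteq> Y\<close> gT(1) lE(1) gT(3,4) in_l(3,4)] .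
          then show False using gT(2) lE(2) by blast
        qed
      qed
      moreover have "g ` U \<subseteq> T" using g by blast
      moreover have "finite T" using finite_sub[OF sub(2)] by (simp add: T_def)
      ultimately show ?thesis using card_inj_on_le by blast
    qed
    have off: "q \<le> card (Ps - st l)"
    proof -
      have ex: "\<exists>X. X \<in> Ps - st l \<and> I X M" if "M \<in> st Q - {l}" for M
      proof -
        have M: "M \<in> E" "I Q M" "M \<noteq> l" using that by (auto simp: st_iff)
        have "\<not> I P M" using join_eq[of P Q M l] M P QE lE Q(2) by blast
        then obtain X where X: "X \<in> Ps" "I X M" using blocked M by blast
        have "X \<noteq> Q" using X Q by blast
        have "\<not> I X l" using join_eq[of X Q M l] X M QE lE \<open>X \<noteq> Q\<close> sub by blast
        then show ?thesis using X I_sym by (auto simp: st_iff)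
      qed
      then obtain g where g: "\<And>M. M \<in> st Q - {l} \<Longrightarrow> g M \<in> Ps - st l \<and> I (g M) M" by metis
      have "inj_on g (st Q - {l})"
      proof (rule inj_onI)
        fix L M assume LM: "L \<in> st Q - {l}" "M \<in> st Q - {l}" "g L = g M"
        have 1: "g L \<in> Ps" "g L \<notin> st l" "I (g L) L" "I (g L) M" using g[OF LM(1)] g[OF LM(2)] LM(3) by auto
        have "g L \<noteq> Q" using 1 Q by blast
        moreover have "L \<in> E" "M \<in> E" "I Q L" "I Q M" using LM by (auto simp: st_iff)
        ultimately show "L = M" using join_eq[of "g L" Q L M] 1 sub QE by blast
      qed
      moreover have "g ` (st Q - {l}) \<subseteq> Ps - st l" using g by blast
      moreover have "finite (Ps - st l)" using finite_sub[OF sub(1)] by simp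
      ultimately have "card (st Q - {l}) \<le> card (Ps - st l)" using card_inj_on_le by blast
      moreover have "card (st Q - {l}) = q" using card_st[OF QE(1)] QE lE by (simp add: st_iff)
      ultimately show ?thesis by simp
    qed
    have on: "q \<le> card (Ps \<inter> st l) + card U"
    proof -
      have "st l - {P} \<subseteq> (Ps \<inter> st l) \<union> U" by (auto simp: U_def)
      then have "card (st l - {P}) \<le> card ((Ps \<inter> st l) \<union> U)" by (intro card_mono) (auto simp: U_def)
      also have "\<dots> \<le> card (Ps \<inter> st l) + card U" by (rule card_Un_le)
      finally show ?thesis using card_st[OF lE(1)] lE(3) by simp
    qed
    have "card Ps = card (Ps \<inter> st l) + card (Ps - st l)"
      using card_Int_Diff[OF finite_sub[OF sub(1)]] .
    then show False using small cLs UT off on by linarith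
  qed
  have "dom (st l - {P}) (st P - {l})"
    unfolding dom_def
  proof (intro conjI ballI)
    fix X assume X: "X \<in> E - (st l - {P})"
    show "\<exists>L\<in>st P - {l}. I X L"
    proof (cases "X = P")
      case True
      obtain L where "L \<in> st P" "L \<noteq> l" using ex_line_through[OF P] by blast
      then show ?thesis using True by (auto simp: st_iff)
    next
      case False
      then obtain L where L: "L \<in> E" "I X L" "I P L" using join[of X P] X P by auto
      then have "L \<noteq> l" using X False I_sym by (auto simp: st_iff)
      then show ?thesis using L by (auto simp: st_iff)
    qed
  next
    fix L assume L: "L \<in> E - (st P - {l})"
    show "\<exists>X\<in>st l - {P}. I X L"
    proof (cases "L = l")
      case True
      obtain X where "X \<in> st l" "X \<noteq> P" using ex_line_through[OF lE(1)] by blast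
      then show ?thesis using True I_sym by (auto simp: st_iff)
    next
      case False
      have LE: "L \<in> E" "\<not> I P L" using L False by (auto simp: st_iff)
      obtain X where X: "X \<in> E" "I L X" "I l X" using join[of L l] LE lE False by auto
      then have "X \<noteq> P" using LE I_sym by blast
      then show ?thesis using X I_sym by (auto simp: st_iff)
    qed
  qed (use st_subset in auto)
  then have "st l - {P} = Ps \<and> st P - {l} = Ls" using min_domD[OF min] all sub_Ls by blast
  then show ?thesis by blast
qed

text \<open>An added point z cannot make up for a point y of l, because the q lines through y other
  than l would all pass through z; nor for a line M of the pencil, because the q points of M other
  than P would all equal z. Adding a line is the dual situation.\<close>

lemma punctured_stable:
  assumes P: "P \<in> E" and l: "l \<in> st P" and d: "dom Ps' Ls'"
    and ext: "Ps' \<subseteq> insert z (st l - {P})" "Ls' \<subseteq> st P - {l}"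
  shows "2 * q \<le> card Ps' + card Ls'"
proof -
  have lE: "l \<in> E" "I P l" "P \<in> st l" using l P I_sym by (auto simp: st_iff)
  have sub': "Ps' \<subseteq> E" "Ls' \<subseteq> E" using d by (auto simp: dom_def)
  have sup: "st l - {P} \<subseteq> Ps'"
  proof
    fix y assume y: "y \<in> st l - {P}"
    then have yE: "y \<in> E" "I y l" "y \<noteq> P" using I_sym by (auto simp: st_iff)
    show "y \<in> Ps'"
    proof (rule ccontr)
      assume y': "y \<notin> Ps'"
      have z: "I z L \<and> z \<in> E \<and> z \<noteq> y" if L: "L \<in> st y - {l}" for L
      proof -
        have LE: "L \<in> E" "I y L" "L \<noteq> l" using L by (auto simp: st_iff)
        have "\<not> I P L" using join_eq[of P y L l] LE P yE lE by blast
        then have "L \<notin> Ls'" using ext(2) by (auto simp: st_iff)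
        then have "\<exists>X\<in>Ps'. I X L" using d LE(1) unfolding dom_def by blast
        then obtain X where X: "X \<in> Ps'" "I X L" by blast
        have "X \<noteq> y" using X y' by blast
        then have "\<not> I X l" using join_eq[of X y L l] X LE yE lE sub' by blast
        then have "X \<notin> st l" using I_sym by (auto simp: st_iff)
        then have "X = z" using X ext by blast
        then show ?thesis using X \<open>X \<noteq> y\<close> sub' by blast
      qed
      have "card (st y - {l}) = q" using card_st[OF yE(1)] yE lE by (simp add: st_iff)
      then obtain L M where LM: "L \<in> st y - {l}" "M \<in> st y - {l}" "L \<noteq> M"
        using ex_two_distinct[of "st y - {l}"] q_ge_2 by auto
      have "L \<in> E" "M \<in> E" "I y L" "I y M" using LM by (auto simp: st_iff)
      then show False using join_eq[of z y L M] z[OF LM(1)] z[OF LM(2)] yE LM(3) by blast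
    qed
  qed
  have "st P - {l} \<subseteq> Ls'"
  proof (rule ccontr)
    assume "\<not> ?thesis"
    then obtain M where M: "M \<in> st P" "M \<noteq> l" "M \<notin> Ls'" by blast
    have ME: "M \<in> E" "I P M" "P \<in> st M" using M P I_sym by (auto simp: st_iff)
    have "X = z" if X: "X \<in> st M - {P}" for X
    proof -
      have "X \<in> Ps'" using missing_line_points[OF d P M(1,3), of X] X ext(2) by blast
      moreover have "X \<notin> st l"
        using line_meet_le_1[of M l X P] ME lE M(2) X P I_sym by (auto simp: st_iff)
      ultimately show ?thesis using ext(1) by blast
    qed
    moreover have "card (st M - {P}) = q" using card_st[OF ME(1)] ME by simp
    ultimately show False using ex_two_distinct[of "st M - {P}"] q_ge_2 by (metis finite_Diff finite_st)
  qed
  then have "card (st P - {l}) \<le> card Ls'" using finite_sub[OF sub'(2)] card_mono by blast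
  moreover have "card (st l - {P}) \<le> card Ps'" using sup finite_sub[OF sub'(1)] card_mono by blast
  ultimately show ?thesis using card_st[OF P] card_st[OF lE(1)] l lE by simp
qed

end

section \<open>Classification\<close>

interpretation pg: incidence_plane "pg_elems :: 'a::{finite,field} vec3 set set" inc "CARD('a)"
proof
  show "inc X Y \<longleftrightarrow> inc Y X" for X Y :: "'a vec3 set" by (rule inc_commute)
  show "\<exists>L\<in>pg_elems. inc X L \<and> inc Y L" if "X \<in> pg_elems" "Y \<in> pg_elems" "X \<noteq> Y" for X Y :: "'a vec3 set"
    using that by (rule ex_join)
  show "card {Y \<in> pg_elems. inc X Y} = CARD('a) + 1" if "X \<in> pg_elems" for X :: "'a vec3 set"
    using card_onset[OF that] by (simp add: onset_def)
  show "2 \<le> CARD('a)" by (rule two_le_card_field)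
  show "2 * (CARD('a) - 1) \<le> card S" if "P \<in> pg_elems" "m \<in> pg_elems" "\<not> inc P m" "S \<subseteq> pg_elems"
    "\<And>L. L \<in> S \<Longrightarrow> \<not> inc P L" "\<And>X. X \<in> pg_elems \<Longrightarrow> X \<noteq> P \<Longrightarrow> \<not> inc X m \<Longrightarrow> \<exists>L\<in>S. inc X L"
    for P m :: "'a vec3 set" and S
    using that by (rule jamison)
  show "L = M" if "X \<in> pg_elems" "Y \<in> pg_elems" "X \<noteq> Y" "L \<in> pg_elems" "M \<in> pg_elems"
    "inc X L" "inc Y L" "inc X M" "inc Y M" for X Y L M :: "'a vec3 set"
    using that by (rule join_unique)
qed simp

section \<open>Duality and stability in PG(2,q)\<close>

lemma pg_st [simp]: "pg.st X = onset X"
  by (simp add: pg.st_def onset_def)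

lemma pg_dom: "pg.dom Ps Ls \<longleftrightarrow> dominating Ps Ls"
  by (simp add: pg.dom_def dominating_def)

lemma pg_min_dom: "minimal_dominating Ps Ls \<Longrightarrow> pg.min_dom Ps Ls"
  unfolding pg.min_dom_def minimal_dominating_def pg_dom by blast

lemma dominating_swap: "dominating Ps Ls \<Longrightarrow> dominating Ls Ps"
  using pg.dom_swap by (simp add: pg_dom)

lemma dsize_commute: "dsize A B = dsize B A"
  by (simp add: dsize_def)

lemma minimal_dominating_swap:
  assumes "minimal_dominating Ps Ls"
  shows "minimal_dominating Ls Ps"
  unfolding minimal_dominating_def
proof (intro conjI allI impI notI)
  show "dominating Ls Ps" using assms dominating_swap unfolding minimal_dominating_def by blast
  fix A B assume "A \<subseteq> Ls \<and> B \<subseteq> Ps \<and> (A, B) \<noteq> (Ls, Ps)" "dominating A B"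
  then have "B \<subseteq> Ps \<and> A \<subseteq> Ls \<and> (B, A) \<noteq> (Ps, Ls)" "dominating B A"
    unfolding prod.inject using dominating_swap by blast+
  then show False using assms unfolding minimal_dominating_def by blast
qed

lemma stable_swap:
  assumes "stable Ps Ls"
  shows "stable Ls Ps"
  unfolding stable_def
proof (intro conjI notI)
  show "minimal_dominating Ls Ps" using assms minimal_dominating_swap unfolding stable_def by blast
  assume "\<exists>A' B'. dominating A' B' \<and> Ls \<subseteq> A' \<and> Ps \<subseteq> B' \<and> dsize A' B' = dsize Ls Ps + 1 \<and>
    (\<exists>A B. A \<subseteq> A' \<and> B \<subseteq> B' \<and> dominating A B \<and> dsize A B < dsize Ls Ps)"
  then obtain A' B' A B where "dominating A' B'" "Ls \<subseteq> A'" "Ps \<subseteq> B'" "dsize A' B' = dsize Ls Ps + 1"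
    "A \<subseteq> A'" "B \<subseteq> B'" "dominating A B" "dsize A B < dsize Ls Ps" by blast
  then have "dominating B' A'" "Ps \<subseteq> B'" "Ls \<subseteq> A'" "dsize B' A' = dsize Ps Ls + 1"
    "B \<subseteq> B'" "A \<subseteq> A'" "dominating B A" "dsize B A < dsize Ps Ls"
    using dominating_swap by (simp_all add: dsize_commute)
  then show False using assms unfolding stable_def by blast
qed

lemma one_extra:
  fixes Ps Ls :: "'b set"
  assumes "Ps \<subseteq> Ps'" "Ls \<subseteq> Ls'" "finite Ps'" "finite Ls'" "card Ps' + card Ls' = card Ps + card Ls + 1"
  shows "\<exists>z. (Ps' = insert z Ps \<and> Ls' = Ls) \<or> (Ps' = Ps \<and> Ls' = insert z Ls)"
proof -
  have "card (Ps' - Ps) + card (Ls' - Ls) = 1"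
    using assms card_mono[of Ps' Ps] card_mono[of Ls' Ls] by (simp add: card_Diff_subset finite_subset)
  then consider "card (Ps' - Ps) = 1" "card (Ls' - Ls) = 0" | "card (Ps' - Ps) = 0" "card (Ls' - Ls) = 1"
    by linarith
  then show ?thesis
  proof cases
    case 1
    then obtain z where "Ps' - Ps = {z}" by (auto simp: card_1_singleton_iff)
    moreover have "Ls' - Ls = {}" using 1 assms by simp
    ultimately show ?thesis using assms by blast
  next
    case 2
    then obtain z where "Ls' - Ls = {z}" by (auto simp: card_1_singleton_iff)
    moreover have "Ps' - Ps = {}" using 2 assms by simp
    ultimately show ?thesis using assms by blast
  qed
qed

lemma stableI:
  assumes "minimal_dominating Ps Ls"
    and "\<And>z A B. dominating A B \<Longrightarrow> A \<subseteq> insert z Ps \<Longrightarrow> B \<subseteq> Ls \<Longrightarrow> dsize Ps Ls \<le> dsize A B"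
    and "\<And>z A B. dominating A B \<Longrightarrow> A \<subseteq> Ps \<Longrightarrow> B \<subseteq> insert z Ls \<Longrightarrow> dsize Ps Ls \<le> dsize A B"
  shows "stable Ps Ls"
  unfolding stable_def
proof (intro conjI notI)
  show "minimal_dominating Ps Ls" by fact
  assume "\<exists>Ps' Ls'. dominating Ps' Ls' \<and> Ps \<subseteq> Ps' \<and> Ls \<subseteq> Ls' \<and>
          dsize Ps' Ls' = dsize Ps Ls + 1 \<and>
          (\<exists>Ps'' Ls''. Ps'' \<subseteq> Ps' \<and> Ls'' \<subseteq> Ls' \<and> dominating Ps'' Ls'' \<and>
               dsize Ps'' Ls'' < dsize Ps Ls)"
  then obtain Ps' Ls' A B where *: "Ps \<subseteq> Ps'" "Ls \<subseteq> Ls'" "dsize Ps' Ls' = dsize Ps Ls + 1"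
    "A \<subseteq> Ps'" "B \<subseteq> Ls'" "dominating A B" "dsize A B < dsize Ps Ls" by blast
  obtain z where "(Ps' = insert z Ps \<and> Ls' = Ls) \<or> (Ps' = Ps \<and> Ls' = insert z Ls)"
    using one_extra[OF *(1,2) finite_pg_elems finite_pg_elems *(3)[unfolded dsize_def]] by blast
  then have "dsize Ps Ls \<le> dsize A B"
  proof
    assume "Ps' = insert z Ps \<and> Ls' = Ls"
    then show ?thesis using assms(2)[of A B z] * by blast
  next
    assume "Ps' = Ps \<and> Ls' = insert z Ls"
    then show ?thesis using assms(3)[of A B z] * by blast
  qed
  then show False using *(7) by simp
qed

lemma pencil_imp_stable:
  fixes P :: "'a::{finite,field} vec3 set"
  assumes min: "minimal_dominating Ps (onset P)" and "pg.pencil_config P Ps" "card Ps + 2 < 2 * CARD('a)"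
  shows "stable Ps (onset P)"
proof (rule stableI[OF min])
  have P: "P \<in> pg_elems" using assms(2) by (simp add: pg.pencil_config_def)
  have size: "dsize Ps (onset P) = card Ps + (CARD('a) + 1)" using card_onset[OF P] by (simp add: dsize_def)
  have m: "pg.min_dom Ps (pg.st P)" using pg_min_dom[OF min] by simp
  show "dsize Ps (onset P) \<le> dsize A B" if "dominating A B" "A \<subseteq> insert z Ps" "B \<subseteq> onset P" for z A B
    using pg.pencil_stable[OF m assms(2,3), of A z B] that unfolding size unfolding pg_dom pg_st dsize_def by blast
  show "dsize Ps (onset P) \<le> dsize A B" if "dominating A B" "A \<subseteq> Ps" "B \<subseteq> insert z (onset P)" for z A B
    using pg.pencil_stable[OF m assms(2,3), of A z B] that unfolding size unfolding pg_dom pg_st dsize_def by blast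
qed

lemma punctured_imp_stable:
  fixes P :: "'a::{finite,field} vec3 set"
  assumes min: "minimal_dominating (onset l - {P}) (onset P - {l})" and P: "P \<in> pg_elems" and l: "l \<in> onset P"
  shows "stable (onset l - {P}) (onset P - {l})"
proof (rule stableI[OF min])
  have l': "l \<in> pg_elems" "P \<in> onset l" using P l by (auto simp: onset_iff inc_commute)
  have size: "dsize (onset l - {P}) (onset P - {l}) = 2 * CARD('a)"
    using card_onset[OF P] card_onset[OF l'(1)] l l' by (simp add: dsize_def)
  show "dsize (onset l - {P}) (onset P - {l}) \<le> dsize A B"
    if "dominating A B" "A \<subseteq> insert z (onset l - {P})" "B \<subseteq> onset P - {l}" for z A B
    using pg.punctured_stable[of P l A B z] that P l unfolding size unfolding pg_dom pg_st dsize_def by blast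
  show "dsize (onset l - {P}) (onset P - {l}) \<le> dsize A B"
    if "dominating A B" "A \<subseteq> onset l - {P}" "B \<subseteq> insert z (onset P - {l})" for z A B
    using pg.punctured_stable[of l P B A z] dominating_swap[OF that(1)] that(2,3) l'
    unfolding size unfolding pg_dom pg_st dsize_def by (simp only: add.commute)
qed

lemma small_blocking_set:
  fixes B :: "'a::{finite,field} vec3 set set"
  assumes p: "prime p" "CARD('a) = p ^ n" and q16: "CARD('a) > 16"
    and B: "nontrivial_minimal_blocking_set B"
  shows "\<exists>K. card B = CARD('a) + 1 + K \<and> ((CARD('a))\<^sup>2 \<le> cube_factor p * K ^ 3
    \<or> (CARD('a) = K * K \<and> (\<exists>Sl. baer_subplane B Sl)))"
proof -
  let ?q = "CARD('a)"
  have blk: "blocking_set B" and nolin: "\<And>L. L \<in> pg_elems \<Longrightarrow> \<not> onset L \<subseteq> B"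
    and minB: "\<And>B'. B' \<subset> B \<Longrightarrow> \<not> blocking_set B'"
    using B by (auto simp: nontrivial_minimal_blocking_set_def)
  have Bpg: "B \<subseteq> pg_elems" and hit: "\<And>L. L \<in> pg_elems \<Longrightarrow> \<exists>X\<in>B. inc X L"
    using blk by (auto simp: blocking_set_def)
  have "(1, 0, 0) \<noteq> (0 :: 'a vec3)" by (simp add: vec3_eq_iff)
  then obtain L0 :: "'a vec3 set" where "L0 \<in> pg_elems" using proj_class_in_pg_elems by blast
  then have "\<not> onset L0 \<subseteq> B" by (rule nolin)
  then obtain P0 where "P0 \<in> onset L0" and P0': "P0 \<notin> B" by blast
  then have P0: "P0 \<in> pg_elems" "P0 \<notin> B" by (simp_all add: onset_iff)
  have "?q + 1 \<le> card B" using pg.blocking_card_ge[OF Bpg hit P0] .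
  then obtain K where K: "card B = ?q + 1 + K" using le_Suc_ex by blast
  have "K = r \<and> ?q = K * K \<and> (\<exists>Sl. baer_subplane B Sl)" if small: "\<not> ?q\<^sup>2 \<le> cube_factor p * K ^ 3"
      and r: "?q = r * r" and long: "\<And>R. R \<in> B \<Longrightarrow> r + 1 \<le> card {L \<in> onset R. r + 1 \<le> card (B \<inter> onset L)}" for r
  proof -
    have B0: "B \<noteq> {}" using K by auto
    have r4: "r \<ge> 4"
    proof (rule ccontr)
      assume "\<not> 4 \<le> r"
      then have "r * r \<le> 4 * 4" by (intro mult_mono) auto
      then show False using q16 r by simp
    qed
    have "K ^ 3 \<le> cube_factor p * K ^ 3" by (simp add: cube_factor_def)
    then have K3: "K ^ 3 < ?q ^ 2" using small by linarith
    have ne: "B \<inter> pg.st L \<noteq> {}" if L: "L \<in> pg_elems" for L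
    proof -
      obtain X where X: "X \<in> B" "inc X L" using hit[OF L] by blast
      then have "X \<in> onset L" using Bpg inc_commute[of X L] by (simp add: onset_iff subsetD)
      then show ?thesis using X(1) unfolding pg_st by blast
    qed
    have main: "K = r \<and> (\<forall>R\<in>B. \<forall>L\<in>pg.st R. card (B \<inter> pg.st L) = 1 \<or> card (B \<inter> pg.st L) = r + 1)
      \<and> (\<forall>R\<in>B. card {L \<in> pg.st R. card (B \<inter> pg.st L) = r + 1} = r + 1)"
      by (rule pg.many_long_lines_imp_baer[OF Bpg B0 ne r r4 K K3]) (use long in simp_all)
    define Sl where "Sl = {L \<in> pg_elems. card (B \<inter> onset L) = r + 1}"
    have sec: "card (B \<inter> pg.st L) = 1 \<or> card (B \<inter> pg.st L) = r + 1" if "R \<in> B" "L \<in> pg.st R" for R L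
      using main that by blast
    have num: "card {L \<in> pg.st R. card (B \<inter> pg.st L) = r + 1} = r + 1" if "R \<in> B" for R
      using main that by blast
    have "baer_subplane B Sl"
      unfolding baer_subplane_def
    proof (intro conjI ballI impI exI[of _ r])
      show "card (Sl \<inter> onset X) = r + 1" if "X \<in> B" for X
      proof -
        have "Sl \<inter> onset X = {L \<in> pg.st X. card (B \<inter> pg.st L) = r + 1}"
          unfolding Sl_def pg_st by (rule set_eqI) (simp only: onset_iff Int_iff mem_Collect_eq, blast)
        then show ?thesis using num[OF that] by simp
      qed
      show "\<exists>L\<in>Sl. inc X L \<and> inc Y L" if XY: "X \<in> B" "Y \<in> B" "X \<noteq> Y" for X Y
      proof -
        obtain L where L: "L \<in> pg_elems" "inc X L" "inc Y L" using ex_join[of X Y] XY Bpg by blast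
        have "card (B \<inter> pg.st L) = r + 1"
          by (rule pg.baer_lines_meet(1)[where B = B and r = r and X = X and Y = Y])
            (fact Bpg sec num XY L)+
        then show ?thesis using L by (auto simp: Sl_def)
      qed
      show "\<exists>X\<in>B. inc X L \<and> inc X M" if "L \<in> Sl" "M \<in> Sl" "L \<noteq> M" for L M
      proof (rule pg.baer_lines_meet(2)[where B = B and r = r])
        show "L \<in> pg_elems" "M \<in> pg_elems" "card (B \<inter> pg.st L) = r + 1" "card (B \<inter> pg.st M) = r + 1"
          using that by (simp_all add: Sl_def)
      qed (fact Bpg sec num)+
    qed (use r Bpg in \<open>auto simp: Sl_def\<close>)
    then show ?thesis using main r by blast
  qed
  note baer = this
  have tang: "\<exists>r. ?q = r * r \<and> r + 1 \<le> card {L \<in> onset R. r + 1 \<le> card (B \<inter> onset L)}"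
    if small: "\<not> ?q\<^sup>2 \<le> cube_factor p * K ^ 3" and R: "R \<in> B" for R
  proof -
    have "B - {R} \<subset> B" using R by blast
    then have "\<not> blocking_set (B - {R})" using minB by blast
    then obtain l where l: "l \<in> pg_elems" "\<And>X. X \<in> B - {R} \<Longrightarrow> \<not> inc X l"
      using Bpg unfolding blocking_set_def by blast
    have "inc R l" using hit[OF l(1)] l(2) by blast
    then have "R \<in> onset l" using R Bpg inc_commute[of R l] by (simp add: onset_iff subsetD)
    moreover have "X = R" if "X \<in> B" "X \<in> onset l" for X
    proof (rule ccontr)
      assume "X \<noteq> R"
      then have "\<not> inc X l" using that(1) l(2) by blast
      then show False using that(2) inc_commute[of X l] by (simp add: onset_iff)
    qed
    ultimately have tangent: "B \<inter> onset l = {R}" using R by blast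
    have "K ^ 3 \<le> cube_factor p * K ^ 3" by (simp add: cube_factor_def)
    then have K3: "K ^ 3 < ?q ^ 2" using small by linarith
    have Kq: "K < ?q"
    proof (rule ccontr)
      assume "\<not> K < ?q"
      then have "?q ^ 3 \<le> K ^ 3" by (intro power_mono) auto
      moreover have "?q ^ 2 \<le> ?q ^ 3" using q16 by (intro power_increasing) auto
      ultimately show False using K3 by linarith
    qed
    have K': "card B = ?q + K + 1" using K by simp
    obtain m line g h where m: "inj (line :: 'a \<Rightarrow> _)" "range line \<subseteq> onset R"
      "\<And>a. card (B \<inter> onset (line a)) = m a + 1"
      "linear_prod m = monom 1 ?q * g + h" "lead_coeff g = 1" "degree g = K" "degree h \<le> K"
      using tangent_multiplicities[OF blk R l(1) tangent K' Kq] by blast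
    have line_R: "line a \<in> onset R" for a using m(2) by blast
    \<comment> \<open>A multiplicity of q or more would put all q + 1 points of the line, R
      included, into B, against nontriviality.\<close>
    have "m a < ?q" for a
    proof (rule ccontr)
      assume "\<not> m a < ?q"
      have lp: "line a \<in> pg_elems" using line_R[of a] by (simp add: onset_iff)
      have "card (onset (line a)) \<le> card (B \<inter> onset (line a))"
        using \<open>\<not> m a < ?q\<close> card_onset[OF lp] m(3)[of a] by simp
      then have "B \<inter> onset (line a) = onset (line a)" by (intro card_seteq) auto
      then show False using nolin[OF lp] by blast
    qed
    from lacunary_bound[OF p q16 m(4-7) Kq this] small
    obtain r where r: "?q = r * r" "r + 1 \<le> card {a. m a \<ge> r}" by blast
    have "line ` {a. m a \<ge> r} \<subseteq> {L \<in> onset R. r + 1 \<le> card (B \<inter> onset L)}"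
    proof
      fix L assume "L \<in> line ` {a. m a \<ge> r}"
      then obtain a where "L = line a" "m a \<ge> r" by blast
      then show "L \<in> {L \<in> onset R. r + 1 \<le> card (B \<inter> onset L)}"
        using line_R[of a] m(3)[of a] by simp
    qed
    then have "card (line ` {a. m a \<ge> r}) \<le> card {L \<in> onset R. r + 1 \<le> card (B \<inter> onset L)}"
      by (intro card_mono) auto
    moreover have "card (line ` {a. m a \<ge> r}) = card {a. m a \<ge> r}"
      using m(1) by (intro card_image) (simp add: inj_on_def)
    ultimately show ?thesis using r by auto
  qed
  show ?thesis
  proof (cases "?q\<^sup>2 \<le> cube_factor p * K ^ 3")
    case False
    have "B \<noteq> {}" using K by auto
    then obtain R0 where "R0 \<in> B" by blast
    then obtain r where r: "?q = r * r" using tang[OF False] by blast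
    have "r + 1 \<le> card {L \<in> onset R. r + 1 \<le> card (B \<inter> onset L)}" if R: "R \<in> B" for R
    proof -
      \<comment> \<open>A priori r depends on the point R, but its square is q.\<close>
      obtain r' where r': "?q = r' * r'" "r' + 1 \<le> card {L \<in> onset R. r' + 1 \<le> card (B \<inter> onset L)}"
        using tang[OF False R] by blast
      have "r' ^ 2 = r ^ 2" using r r'(1) by (simp add: power2_eq_square)
      then have "r' = r" by simp
      then show ?thesis using r' by simp
    qed
    from baer[OF False r this] show ?thesis using K by blast
  qed (use K in blast)
qed

text \<open>The n + 1 lines of Sl through a point X carry n further points of Sp each, and no other
  line through X carries any. Nonemptiness is assumed because for square q two empty sets satisfy
  \<open>baer_subplane\<close>.\<close>

lemma baer_subplane_card:
  fixes Sp :: "'a::{finite,field} vec3 set set"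
  assumes "baer_subplane Sp Sl" "Sp \<noteq> {}"
  shows "\<exists>n. n * n = CARD('a) \<and> card Sp = CARD('a) + n + 1"
proof -
  note baer = assms(1)[unfolded baer_subplane_def]
  have Sp: "Sp \<subseteq> pg_elems" "Sl \<subseteq> pg_elems"
    and join: "\<forall>X\<in>Sp. \<forall>Y\<in>Sp. X \<noteq> Y \<longrightarrow> (\<exists>L\<in>Sl. inc X L \<and> inc Y L)"
    and order: "\<exists>n::nat. n * n = CARD('a) \<and> (\<forall>L\<in>Sl. card (Sp \<inter> onset L) = n + 1)
      \<and> (\<forall>X\<in>Sp. card (Sl \<inter> onset X) = n + 1)"
    using baer by - (elim conjE, assumption)+
  have joinS: "\<exists>L\<in>Sl. inc X L \<and> inc Y L" if "X \<in> Sp" "Y \<in> Sp" "X \<noteq> Y" for X Y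
    using join that by blast
  obtain n where n: "n * n = CARD('a)" "\<And>L. L \<in> Sl \<Longrightarrow> card (Sp \<inter> onset L) = n + 1"
    "\<And>X. X \<in> Sp \<Longrightarrow> card (Sl \<inter> onset X) = n + 1"
    using order by (elim exE conjE) blast
  obtain X where X: "X \<in> Sp" using assms(2) by blast
  have Xpg: "X \<in> pg_elems" using X Sp by blast
  have "(\<Sum>L\<in>onset X. card ((Sp - {X}) \<inter> onset L)) = (\<Sum>L\<in>Sl \<inter> onset X. card ((Sp - {X}) \<inter> onset L))"
  proof (rule sum.mono_neutral_right)
    show "\<forall>L\<in>onset X - Sl \<inter> onset X. card ((Sp - {X}) \<inter> onset L) = 0"
    proof
      fix L assume L: "L \<in> onset X - Sl \<inter> onset X"
      have False if Y: "Y \<in> (Sp - {X}) \<inter> onset L" for Y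
      proof -
        have YX: "Y \<in> Sp" "Y \<noteq> X" "inc Y L" "L \<in> pg_elems" "inc X L" "Y \<in> pg_elems"
          using Y L inc_commute[of Y L] by (simp_all add: onset_iff)
        obtain M where M: "M \<in> Sl" "inc Y M" "inc X M" using joinS[of Y X] YX X by blast
        have "L = M" using join_unique[of Y X L M] YX Xpg M Sp(2) by blast
        then show False using L M(1) by blast
      qed
      then have "(Sp - {X}) \<inter> onset L = {}" by (rule equals0I)
      then show "card ((Sp - {X}) \<inter> onset L) = 0" by simp
    qed
  qed simp_all
  also have "\<dots> = (\<Sum>L\<in>Sl \<inter> onset X. n)"
  proof (rule sum.cong[OF refl])
    fix L assume L: "L \<in> Sl \<inter> onset X"
    then have XL: "X \<in> Sp \<inter> onset L" using X Xpg by (simp add: onset_iff inc_commute)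
    have "(Sp - {X}) \<inter> onset L = Sp \<inter> onset L - {X}" by blast
    then show "card ((Sp - {X}) \<inter> onset L) = n" using n(2) L XL by simp
  qed
  also have "\<dots> = (n + 1) * n" using n(3)[OF X] by simp
  finally have "card (Sp - {X}) = (n + 1) * n"
    using pg.card_pencil_partition[OF Xpg Sp(1)] by simp
  moreover have "Suc (card (Sp - {X})) = card Sp" using X by (intro card_Suc_Diff1) auto
  ultimately have "card Sp = CARD('a) + n + 1" using n(1) by simp
  then show ?thesis using n(1) by blast
qed

lemma baer_config_out_size:
  fixes A B :: "'a::{finite,field} vec3 set set"
  assumes "baer_config_out A B" "dominating A B"
  shows "real (dsize A B) = 2 * real CARD('a) + sqrt (real CARD('a)) + 2"
proof -
  obtain Sl P where c: "baer_subplane A Sl" "P \<in> pg_elems" "B = onset P"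
    using assms(1) unfolding baer_config_out_def by blast
  \<comment> \<open>Without points all q^2 + q + 1 lines would have to belong to the pencil, which
    has only q + 1.\<close>
  have "A \<noteq> {}"
  proof
    assume "A = {}"
    then have "pg_elems \<subseteq> B" using assms(2) unfolding dominating_def by blast
    moreover have "card B = CARD('a) + 1" using c card_onset by blast
    moreover have "card (pg_elems :: 'a vec3 set set) = CARD('a) * CARD('a) + CARD('a) + 1"
      using pg.card_E c(2) by blast
    moreover have "finite B" by simp
    ultimately show False using card_mono[of B pg_elems] by simp
  qed
  then obtain n where n: "n * n = CARD('a)" "card A = CARD('a) + n + 1"
    using baer_subplane_card c(1) by blast
  have "sqrt (real CARD('a)) = n" by (rule real_sqrt_unique) (simp_all add: power2_eq_square n(1)[symmetric])
  then show ?thesis using n(2) c card_onset[OF c(2)] by (simp add: dsize_def)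
qed

section \<open>Real estimates drawn from the cubic bound\<close>

lemma powr_cube:
  fixes x a :: real
  assumes "x > 0"
  shows "(x powr a) ^ 3 = x powr (a * 3)"
proof -
  have "x powr (a * 3) = (x powr a) powr 3" by (simp add: powr_powr)
  also have "\<dots> = (x powr a) ^ 3" using assms by (intro powr_numeral) simp
  finally show ?thesis by simp
qed

text \<open>The first inequality is the gap of the theorem. The second keeps this alternative apart
  from the Baer subplanes, so that the size 2 q + sqrt q + 2 is left to the latter.\<close>

lemma cube_bound_consequences:
  assumes "q > 16" "q\<^sup>2 \<le> cube_factor p * K ^ 3"
  shows "c_const p * real q powr (2/3) \<le> real K" "sqrt (real q) + 1 < real K"
proof -
  define \<delta> :: real where "\<delta> = real (cube_factor p)"
  have \<delta>: "\<delta> = 1 \<or> \<delta> = 2" by (simp add: \<delta>_def cube_factor_def)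
  have "real (q\<^sup>2) \<le> real (cube_factor p * K ^ 3)" using assms(2) by (simp only: of_nat_le_iff)
  then have main: "(real q)\<^sup>2 \<le> \<delta> * real K ^ 3" by (simp add: \<delta>_def)
  have "(2 powr (- 1 / 3)) ^ 3 = (1 / 2 :: real)"
    by (subst powr_cube) (simp_all add: powr_minus)
  then have c: "c_const p \<ge> 0" "\<delta> * c_const p ^ 3 = 1"
    by (auto simp: c_const_def \<delta>_def cube_factor_def)
  have q3: "(real q powr (2/3)) ^ 3 = (real q)\<^sup>2"
    using assms(1) by (subst powr_cube) simp_all
  show "c_const p * real q powr (2/3) \<le> real K"
  proof (rule ccontr)
    assume "\<not> ?thesis"
    then have "real K ^ 3 < (c_const p * real q powr (2/3)) ^ 3"
      by (intro power_strict_mono) auto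
    then have "\<delta> * real K ^ 3 < \<delta> * (c_const p * real q powr (2/3)) ^ 3"
      using \<delta> by auto
    also have "\<dots> = (\<delta> * c_const p ^ 3) * (real q)\<^sup>2" unfolding power_mult_distrib q3 by simp
    also have "\<dots> = (real q)\<^sup>2" unfolding c(2) by simp
    finally show False using main by simp
  qed
  define s where "s = sqrt (real q)"
  have s: "s > 4" "real q = s * s"
    using assms(1) real_less_rsqrt[of 4 "real q"] by (simp_all add: s_def)
  show "sqrt (real q) + 1 < real K"
  proof (rule ccontr)
    assume "\<not> ?thesis"
    then have "real K \<le> s + 1" by (simp add: s_def)
    \<comment> \<open>5/4 comes from s > 4; it is good enough because 2 (5/4)^3 = 125/32 is below
      4.\<close>
    then have "real K \<le> 5 / 4 * s" using s(1) by simp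
    then have "real K ^ 3 \<le> (5 / 4 * s) ^ 3" by (intro power_mono) auto
    also have "\<dots> = 125 / 64 * (s * s * s)" by (simp add: power3_eq_cube)
    finally have K3: "real K ^ 3 \<le> 125 / 64 * (s * s * s)" .
    have "0 < s * s * s" using s(1) by simp
    have "\<delta> * real K ^ 3 \<le> 2 * real K ^ 3" using \<delta> by auto
    also have "\<dots> \<le> 2 * (125 / 64 * (s * s * s))" using K3 by simp
    also have "\<dots> < 4 * (s * s * s)" using \<open>0 < s * s * s\<close> by linarith
    also have "\<dots> \<le> s * (s * s * s)" using s(1) by (intro mult_right_mono) auto
    also have "\<dots> = (real q)\<^sup>2" unfolding s(2) by (simp add: power2_eq_square)
    finally show False using main by simp
  qed
qed

text \<open>Packaging the conclusion makes its symmetry in points and lines usable: only dominating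
  sets with q concurrent lines have to be treated.\<close>

definition classification :: "nat \<Rightarrow> 'a::{finite,field} vec3 set set \<Rightarrow> 'a vec3 set set \<Rightarrow> bool" where
  "classification p Ps Ls \<longleftrightarrow> (let q = real CARD('a); d = real (dsize Ps Ls) in
     (( d = 2 * q \<and>
           (\<exists>l\<in>pg_elems. \<exists>P\<in>pg_elems. inc P l \<and> P \<notin> Ps \<and> l \<notin> Ls \<and>
               Ps \<subseteq> onset l \<and> card Ps = CARD('a) \<and> Ls \<subseteq> onset P \<and> card Ls = CARD('a)) )
       \<or> ( d = 2 * q + 2 \<and>
           (\<exists>l\<in>pg_elems. \<exists>P\<in>pg_elems. \<not> inc P l \<and> Ps = onset l \<and> Ls = onset P) )
       \<or> ( d = 2 * q + sqrt q + 1 \<and> (baer_config_in Ps Ls \<or> baer_config_in Ls Ps) )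
       \<or> ( 3 * q - 1 > d \<and> d > 2 * q + sqrt q + 1 \<and> stable Ps Ls \<and>
           (pencil_blocking_config Ps Ls \<or> pencil_blocking_config Ls Ps) \<and>
           \<not> pencil_plus_line Ls \<and> \<not> pencil_plus_line Ps \<and>
           (d = 2 * q + sqrt q + 2 \<longleftrightarrow> (baer_config_out Ps Ls \<or> baer_config_out Ls Ps)) \<and>
           (d = 2 * q + sqrt q + 2 \<or> d \<ge> 2 * q + c_const p * q powr (2/3) + 1) )
       \<or> d \<ge> 3 * q - 1)
       \<and> (d < 3 * q - 1 \<longrightarrow> stable Ps Ls))"

lemma classification_swap:
  assumes "classification p Ps Ls"
  shows "classification p Ls Ps"
proof -
  have st: "stable Ls Ps \<longleftrightarrow> stable Ps Ls" using stable_swap by blast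
  have 1: "(\<exists>l\<in>pg_elems. \<exists>P\<in>pg_elems. inc P l \<and> P \<notin> Ls \<and> l \<notin> Ps \<and>
               Ls \<subseteq> onset l \<and> card Ls = CARD('a) \<and> Ps \<subseteq> onset P \<and> card Ps = CARD('a))
    \<longleftrightarrow> (\<exists>l\<in>pg_elems. \<exists>P\<in>pg_elems. inc P l \<and> P \<notin> Ps \<and> l \<notin> Ls \<and>
               Ps \<subseteq> onset l \<and> card Ps = CARD('a) \<and> Ls \<subseteq> onset P \<and> card Ls = CARD('a))"
    using inc_commute by blast
  have 2: "(\<exists>l\<in>pg_elems. \<exists>P\<in>pg_elems. \<not> inc P l \<and> Ls = onset l \<and> Ps = onset P)
    \<longleftrightarrow> (\<exists>l\<in>pg_elems. \<exists>P\<in>pg_elems. \<not> inc P l \<and> Ps = onset l \<and> Ls = onset P)"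
    using inc_commute by blast
  show ?thesis
    using assms unfolding classification_def Let_def st 1 2 dsize_commute[of Ls Ps] by argo
qed

lemma not_pencil_plus_line:
  fixes Ps Ls :: "'a::{finite,field} vec3 set set"
  assumes min: "minimal_dominating Ps Ls" and small: "card Ps + card Ls + 1 < 3 * CARD('a)"
  shows "\<not> pencil_plus_line Ls"
proof
  assume "pencil_plus_line Ls"
  then obtain P l where P: "P \<in> pg_elems" "l \<notin> onset P" "Ls = insert l (onset P)"
    unfolding pencil_plus_line_def by blast
  have "onset P \<subseteq> Ls" using P(3) by blast
  then have "Ls = onset P" using pg.pencil_case[OF pg_min_dom[OF min] P(1) _ small] by simp
  then show False using P by blast
qed

lemma primal_pencil_classification:
  fixes Ps Ls :: "'a::{finite,field} vec3 set set"
  assumes p: "prime p" "CARD('a) = p ^ h" and q16: "CARD('a) > 16"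
    and min: "minimal_dominating Ps Ls"
    and P: "P \<in> pg_elems" and S: "S \<subseteq> Ls \<inter> onset P" "card S = CARD('a)"
  shows "classification p Ps Ls"
proof (cases "card Ps + card Ls + 1 < 3 * CARD('a)")
  case False
  then have "3 * CARD('a) \<le> dsize Ps Ls + 1" by (simp add: dsize_def)
  then have "real (3 * CARD('a)) \<le> real (dsize Ps Ls + 1)" by (simp only: of_nat_le_iff)
  then have "real (dsize Ps Ls) \<ge> 3 * real CARD('a) - 1" by simp
  then show ?thesis unfolding classification_def Let_def by linarith
next
  case small: True
  let ?q = "CARD('a)"
  let ?d = "real (dsize Ps Ls)"
  have mind: "pg.min_dom Ps Ls" by (rule pg_min_dom[OF min])
  have mind': "pg.min_dom Ls Ps" by (rule pg_min_dom[OF minimal_dominating_swap[OF min]])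
  have small': "card Ls + card Ps + 1 < 3 * ?q" using small by simp
  have dom: "dominating Ps Ls" using min by (simp add: minimal_dominating_def)
  have d_small: "3 * real ?q - 1 > ?d"
  proof -
    have "real (card Ps + card Ls + 1) < real (3 * ?q)" using small by (simp only: of_nat_less_iff)
    then show ?thesis by (simp add: dsize_def)
  qed
  show ?thesis
  proof (cases "onset P \<subseteq> Ls")
    case False
    then obtain l where l: "l \<in> onset P" "l \<notin> Ls" by blast
    have "S \<subseteq> onset P - {l}" using S l by blast
    moreover have "card (onset P - {l}) = ?q" using l card_onset[OF P] by simp
    ultimately have "S = onset P - {l}" using S(2) by (intro card_subset_eq) auto
    then have "onset P - {l} \<subseteq> Ls" using S by blast
    then have eq: "Ps = onset l - {P}" "Ls = onset P - {l}"
      using pg.punctured_pencil_case[OF mind P _ l(2) _ small] l(1) by simp_all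
    have l': "l \<in> pg_elems" "P \<in> onset l" "inc P l" using P l by (auto simp: onset_iff inc_commute)
    have cards: "card Ps = ?q" "card Ls = ?q"
      unfolding eq using card_onset[OF P] card_onset[OF l'(1)] l l' by simp_all
    have "stable Ps Ls" using punctured_imp_stable[OF _ P l(1)] min unfolding eq by blast
    moreover have "?d = 2 * real ?q" using cards by (simp add: dsize_def)
    moreover have "\<exists>l\<in>pg_elems. \<exists>P\<in>pg_elems. inc P l \<and> P \<notin> Ps \<and> l \<notin> Ls \<and>
               Ps \<subseteq> onset l \<and> card Ps = ?q \<and> Ls \<subseteq> onset P \<and> card Ls = ?q"
      using l' P cards eq by blast
    ultimately show ?thesis unfolding classification_def Let_def by blast
  next
    case True
    have Ls_eq: "Ls = onset P" and conf: "pg.pencil_config P Ps"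
      using pg.pencil_case[OF mind P _ small] True by simp_all
    have cLs: "card Ls = ?q + 1" using Ls_eq card_onset[OF P] by simp
    then have cPs: "card Ps + 2 < 2 * ?q" using small by simp
    have stab: "stable Ps Ls" using pencil_imp_stable[OF _ conf cPs] min Ls_eq by simp
    have Psub: "Ps \<subseteq> pg_elems" and PnPs: "P \<notin> Ps"
      and hit: "\<And>L. L \<in> pg_elems \<Longrightarrow> \<not> inc P L \<Longrightarrow> \<exists>X\<in>Ps. inc X L"
      and ess: "\<And>X. X \<in> Ps \<Longrightarrow> \<exists>L\<in>pg_elems. \<not> inc P L \<and> inc X L \<and> (\<forall>Y\<in>Ps. inc Y L \<longrightarrow> Y = X)"
      and off: "\<And>L. L \<in> onset P \<Longrightarrow> \<exists>X\<in>onset L. X \<noteq> P \<and> X \<notin> Ps"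
      using conf unfolding pg.pencil_config_def pg_st by blast+
    have d_eq: "?d = real ?q + 1 + real (card Ps)" using cLs by (simp add: dsize_def)
    show ?thesis
    proof (cases "\<exists>l\<in>pg_elems. onset l \<subseteq> Ps")
      case True
      then obtain l where l: "l \<in> pg_elems" "onset l \<subseteq> Ps" by blast
      \<comment> \<open>This is the pencil case in the dual plane, with l in the role of P.\<close>
      then have "Ps = onset l" "pg.pencil_config l Ls"
        using pg.pencil_case[OF mind' l(1) _ small'] by simp_all
      then have *: "Ps = onset l" "l \<notin> onset P" using Ls_eq by (simp_all add: pg.pencil_config_def)
      then have "\<not> inc P l" using l by (simp add: onset_iff)
      then have "\<exists>l\<in>pg_elems. \<exists>P\<in>pg_elems. \<not> inc P l \<and> Ps = onset l \<and> Ls = onset P"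
        using l P * Ls_eq by blast
      moreover have "card Ps = ?q + 1" using *(1) card_onset[OF l(1)] by simp
      then have "?d = 2 * real ?q + 2" unfolding d_eq by simp
      ultimately show ?thesis using stab unfolding classification_def Let_def by blast
    next
      case noline: False
      \<comment> \<open>Ps meets every line off P, so a line it misses passes through P and adding P
        repairs this. P is added only when some line is missed, for otherwise minimality would be
        lost.\<close>
      define Bl where "Bl = (if \<forall>L\<in>pg_elems. \<exists>X\<in>Ps. inc X L then Ps else insert P Ps)"
      have Bl: "Bl = Ps \<or> Bl = insert P Ps" by (simp add: Bl_def)
      have ntm: "nontrivial_minimal_blocking_set Bl"
        unfolding nontrivial_minimal_blocking_set_def
      proof (intro conjI ballI allI impI)
        show "blocking_set Bl"
        proof (cases "\<forall>L\<in>pg_elems. \<exists>X\<in>Ps. inc X L")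
          case True
          then show ?thesis using Psub by (simp add: Bl_def blocking_set_def)
        next
          case False
          then have "Bl = insert P Ps" unfolding Bl_def by (rule if_not_P)
          then show ?thesis unfolding blocking_set_def using Psub P hit by blast
        qed
        show "\<not> onset L \<subseteq> Bl" if L: "L \<in> pg_elems" for L
        proof
          assume sub: "onset L \<subseteq> Bl"
          \<comment> \<open>A full line in \<open>Bl\<close> must pass through P, since Ps contains
            no full line; but the last clause of \<open>pencil_config\<close> gives such a line a
            point other than P outside Ps.\<close>
          have "\<not> onset L \<subseteq> Ps" using noline L by blast
          then have "P \<in> onset L" using sub Bl by blast
          then have "L \<in> onset P" using L by (simp add: onset_iff inc_commute)
          then show False using off[of L] sub Bl by blast
        qed
        show "\<not> blocking_set B'" if B': "B' \<subset> Bl" for B'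
        proof
          assume bl: "blocking_set B'"
          obtain y where y: "y \<in> Bl" "y \<notin> B'" using B' by blast
          show False
          proof (cases "y \<in> Ps")
            case True
            then obtain L where L: "L \<in> pg_elems" "\<not> inc P L" "\<And>Y. Y \<in> Ps \<Longrightarrow> inc Y L \<Longrightarrow> Y = y"
              using ess by blast
            obtain X where X: "X \<in> B'" "inc X L" using bl L(1) unfolding blocking_set_def by blast
            then have "X \<noteq> P" using L(2) by blast
            then have "X \<in> Ps" using X(1) B' Bl by blast
            then show False using L(3) X y(2) by blast
          next
            case False
            then have yP: "y = P" "Bl = insert P Ps" using y Bl by blast+
            then have "\<not> (\<forall>L\<in>pg_elems. \<exists>X\<in>Ps. inc X L)" using PnPs Bl_def if_P by (metis insertI1)
            then obtain L where L: "L \<in> pg_elems" "\<And>X. X \<in> Ps \<Longrightarrow> \<not> inc X L" by blast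
            obtain X where "X \<in> B'" "inc X L" using bl L(1) unfolding blocking_set_def by blast
            then show False using L(2) B' yP y(2) by blast
          qed
        qed
      qed
      obtain K where K: "card Bl = ?q + 1 + K" and alt: "?q\<^sup>2 \<le> cube_factor p * K ^ 3
          \<or> (?q = K * K \<and> (\<exists>Sl. baer_subplane Bl Sl))"
        using small_blocking_set[OF p q16 ntm] by blast
      have pbc: "pencil_blocking_config Ps Ls"
        unfolding pencil_blocking_config_def
      proof (intro conjI)
        show "\<exists>P\<in>pg_elems. Ls = onset P" using P Ls_eq by blast
        have "Bl - Ps \<subseteq> {P}" using Bl by blast
        then have "card (Bl - Ps) \<le> card {P}" by (intro card_mono) simp_all
        moreover have "Ps \<subseteq> Bl" using Bl by blast
        ultimately show "\<exists>Bl. nontrivial_minimal_blocking_set Bl \<and> Ps \<subseteq> Bl \<and> card (Bl - Ps) \<le> 1"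
          using ntm by auto
      qed
      have npp: "\<not> pencil_plus_line Ls" "\<not> pencil_plus_line Ps"
        using not_pencil_plus_line[OF min small] not_pencil_plus_line[OF minimal_dominating_swap[OF min] small'] by blast+
      have out_size: "?d = 2 * real ?q + sqrt (real ?q) + 2" if "baer_config_out Ps Ls \<or> baer_config_out Ls Ps"
        using that baer_config_out_size[OF _ dom] baer_config_out_size[OF _ dominating_swap[OF dom]]
          dsize_commute[of Ps Ls] by auto
      have c_Bl: "real (card Bl) = real ?q + 1 + real K" unfolding K by simp
      have c_Ps: "Bl = Ps \<Longrightarrow> card Ps = card Bl" "Bl \<noteq> Ps \<Longrightarrow> card Ps + 1 = card Bl"
        using Bl PnPs by auto
      show ?thesis
      proof (cases "?q\<^sup>2 \<le> cube_factor p * K ^ 3")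
        case True
        have Kb: "c_const p * real ?q powr (2/3) \<le> real K" "sqrt (real ?q) + 1 < real K"
          using cube_bound_consequences[OF q16 True] by blast+
        \<comment> \<open>P may belong to \<open>Bl\<close> but not to Ps, so the size is only known
          to be at least (q + 1) + |\<open>Bl\<close>| - 1.\<close>
        have "real (card Bl) \<le> real (card Ps + 1)" unfolding of_nat_le_iff using c_Ps by (cases "Bl = Ps") auto
        then have d_ge: "?d \<ge> 2 * real ?q + 1 + real K" unfolding d_eq using c_Bl by simp
        have a: "?d > 2 * real ?q + sqrt (real ?q) + 2" using d_ge Kb(2) by linarith
        have b: "?d \<ge> 2 * real ?q + c_const p * real ?q powr (2/3) + 1" using d_ge Kb(1) by linarith
        have c: "?d = 2 * real ?q + sqrt (real ?q) + 2 \<longleftrightarrow> baer_config_out Ps Ls \<or> baer_config_out Ls Ps"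
          using a out_size by auto
        have e: "?d > 2 * real ?q + sqrt (real ?q) + 1" using a by linarith
        show ?thesis unfolding classification_def Let_def using d_small e stab pbc npp c b by blast
      next
        case False
        then obtain Sl where baer: "?q = K * K" "baer_subplane Bl Sl" using alt by blast
        have sq: "sqrt (real ?q) = real K" by (rule real_sqrt_unique) (simp_all add: power2_eq_square baer(1))
        \<comment> \<open>Whether P lies in the subplane decides between the sizes 2 q + sqrt q + 1
          and 2 q + sqrt q + 2.\<close>
        show ?thesis
        proof (cases "Bl = Ps")
          case True
          have dd: "?d = 2 * real ?q + sqrt (real ?q) + 2"
            unfolding d_eq c_Ps(1)[OF True] c_Bl sq by simp
          have "baer_config_out Ps Ls"
            unfolding baer_config_out_def using baer(2) True P PnPs Ls_eq by blast
          then show ?thesis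
            unfolding classification_def Let_def using d_small dd stab pbc npp by auto
        next
          case False
          then have "Bl = insert P Ps" using Bl by blast
          then have "baer_config_in Ps Ls"
            unfolding baer_config_in_def using baer(2) PnPs Ls_eq
            by (intro exI[of _ Bl] exI[of _ Sl] exI[of _ P]) auto
          moreover have "real (card Ps) + 1 = real (card Bl)" using c_Ps(2)[OF False] by linarith
          then have "?d = 2 * real ?q + sqrt (real ?q) + 1" unfolding d_eq sq using c_Bl by simp
          ultimately show ?thesis using stab unfolding classification_def Let_def by blast
        qed
      qed
    qed
  qed
qed

theorem theorem4:
  fixes Ps Ls :: "'a::{finite,field} vec3 set set"
    and p h :: nat
  assumes "prime p" and "CARD('a) = p ^ h" and "CARD('a) > 16"
    and "minimal_dominating Ps Ls" and "primal Ps Ls"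
  defines "q \<equiv> real CARD('a)" and "d \<equiv> real (dsize Ps Ls)"
  shows "(( d = 2 * q \<and>
           (\<exists>l\<in>pg_elems. \<exists>P\<in>pg_elems. inc P l \<and> P \<notin> Ps \<and> l \<notin> Ls \<and>
               Ps \<subseteq> onset l \<and> card Ps = CARD('a) \<and> Ls \<subseteq> onset P \<and> card Ls = CARD('a)) )
       \<or> ( d = 2 * q + 2 \<and>
           (\<exists>l\<in>pg_elems. \<exists>P\<in>pg_elems. \<not> inc P l \<and> Ps = onset l \<and> Ls = onset P) )
       \<or> ( d = 2 * q + sqrt q + 1 \<and> (baer_config_in Ps Ls \<or> baer_config_in Ls Ps) )
       \<or> ( 3 * q - 1 > d \<and> d > 2 * q + sqrt q + 1 \<and> stable Ps Ls \<and>
           (pencil_blocking_config Ps Ls \<or> pencil_blocking_config Ls Ps) \<and>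
           \<not> pencil_plus_line Ls \<and> \<not> pencil_plus_line Ps \<and>
           (d = 2 * q + sqrt q + 2 \<longleftrightarrow> (baer_config_out Ps Ls \<or> baer_config_out Ls Ps)) \<and>
           (d = 2 * q + sqrt q + 2 \<or> d \<ge> 2 * q + c_const p * q powr (2/3) + 1) )
       \<or> d \<ge> 3 * q - 1)
       \<and> (d < 3 * q - 1 \<longrightarrow> stable Ps Ls)"
proof -
  have "classification p Ps Ls"
    using assms(5) unfolding primal_def
  proof
    assume "\<exists>P\<in>pg_elems. \<exists>S. S \<subseteq> Ls \<inter> onset P \<and> card S = CARD('a)"
    then show ?thesis using primal_pencil_classification[OF assms(1-4)] by blast
  next
    assume "\<exists>l\<in>pg_elems. \<exists>S. S \<subseteq> Ps \<inter> onset l \<and> card S = CARD('a)"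
    then have "classification p Ls Ps"
      using primal_pencil_classification[OF assms(1-3) minimal_dominating_swap[OF assms(4)]] by blast
    then show ?thesis by (rule classification_swap)
  qed
  then show ?thesis unfolding classification_def Let_def q_def d_def .
qed

end
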